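(* Let $\delta t>0$ and $N=[T/\delta t]-1$, and let $(\boldsymbol{B}^n,\boldsymbol{u}_\star^n,\tilde{\boldsymbol{u}}^n,\boldsymbol{u}^n,p^n)$ be generated by the semi-discrete scheme (S) described in the context. Then the scheme is unconditionally energy stable (no restriction on $\delta t$), in the sense that for every time step $n$, $0\le n\le N$, $$s\|\boldsymbol{B}^{n+1}\|^2+\|\boldsymbol{u}^{n+1}\|^2+\delta t^2\|\nabla p^{n+1}\|^2+2\delta t\left(s\eta\|\nabla\times\boldsymbol{B}^{n+1}\|^2+\nu\|\nabla\tilde{\boldsymbol{u}}^{n+1}\|^2\right)\le s\|\boldsymbol{B}^n\|^2+\|\boldsymbol{u}^n\|^2+\delta t^2\|\nabla p^n\|^2 .$$ Moreover, $\nabla\cdot\boldsymbol{B}^{n+1}=\cdots=\nabla\cdot\boldsymbol{B}^0=0$ for $1\le n\le N$.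
   Context: $\Omega\subset\mathbb{R}^2$ is a bounded domain with outward unit normal $\boldsymbol{n}$ on $\partial\Omega$; $T>0$ is the final time; $\nu,\eta,s>0$ are constants; $[\cdot]$ is the integer part. $(\cdot,\cdot)$ and $\|\cdot\|$ are the $L^2(\Omega)$ inner product and norm (for scalar, vector or matrix functions). Two-dimensional conventions: for vectors $\boldsymbol{a},\boldsymbol{b}$, $\boldsymbol{a}\times\boldsymbol{b}=a_1b_2-a_2b_1$ (scalar); for a vector $\boldsymbol{a}$ and scalar $c$, $\boldsymbol{a}\times c=(a_2c,-a_1c)$ and $c\times\boldsymbol{a}=-\boldsymbol{a}\times c$; for a vector field $\nabla\times\boldsymbol{B}=\partial_xB_2-\partial_yB_1$ (scalar); for a scalar field $\nabla\times\phi=(\partial_y\phi,-\partial_x\phi)$. $\boldsymbol{B}\times\nabla\times\boldsymbol{C}$ means $\boldsymbol{B}\times(\nabla\times\boldsymbol{C})$. Scheme (S) (time discretization of the incompressible magneto-hydrodynamic equations). Start from initial data $(\boldsymbol{u}^0,\boldsymbol{B}^0,p^0)$ with $\nabla\cdot\boldsymbol{u}^0=0$, $\boldsymbol{u}^0|_{\partial\Omega}=0$, $\nabla\cdot\boldsymbol{B}^0=0$, $\boldsymbol{B}^0\times\boldsymbol{n}|_{\partial\Omega}=0$. Given $(\boldsymbol{u}^n,\boldsymbol{B}^n,p^n)$, $n\ge 0$, compute $(\boldsymbol{u}^{n+1},\boldsymbol{B}^{n+1},p^{n+1})$ by: Step 1: find $\boldsymbol{B}^{n+1}$ and $\boldsymbol{u}_\star^n$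 with $$\frac{\boldsymbol{B}^{n+1}-\boldsymbol{B}^n}{\delta t}+\eta\nabla\times\nabla\times\boldsymbol{B}^{n+1}-\nabla\times(\boldsymbol{u}_\star^n\times\boldsymbol{B}^n)=0,\qquad \frac{\boldsymbol{u}_\star^n-\boldsymbol{u}^n}{\delta t}+s\boldsymbol{B}^n\times\nabla\times\boldsymbol{B}^{n+1}=0,\qquad \boldsymbol{B}^{n+1}\times\boldsymbol{n}|_{\partial\Omega}=0.$$ Step 2: find $\tilde{\boldsymbol{u}}^{n+1}$ with $$\frac{\tilde{\boldsymbol{u}}^{n+1}-\boldsymbol{u}_\star^n}{\delta t}+(\boldsymbol{u}^n\cdot\nabla)\tilde{\boldsymbol{u}}^{n+1}-\nu\Delta\tilde{\boldsymbol{u}}^{n+1}+\nabla p^n=0,\qquad \tilde{\boldsymbol{u}}^{n+1}|_{\partial\Omega}=0.$$ Step 3: find $\boldsymbol{u}^{n+1},p^{n+1}$ with $$\frac{\boldsymbol{u}^{n+1}-\tilde{\boldsymbol{u}}^{n+1}}{\delta t}+\nabla(p^{n+1}-p^n)=0,\qquad \nabla\cdot\boldsymbol{u}^{n+1}=0,\qquad \boldsymbol{u}^{n+1}\cdot\boldsymbol{n}|_{\partial\Omega}=0.$$ All functions are assumed regular enough for these equations to make sense. *)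

theory Defs
  imports "HOL-Analysis.Analysis"
begin

section \<open>Planar vector calculus\<close>

definition pd :: "2 \<Rightarrow> (real^2 \<Rightarrow> 'a::real_normed_vector) \<Rightarrow> real^2 \<Rightarrow> 'a"
  where "pd i f x = frechet_derivative f (at x) (axis i 1)"

definition grad :: "(real^2 \<Rightarrow> real) \<Rightarrow> real^2 \<Rightarrow> real^2"
  where "grad p x = (\<chi> i. pd i p x)"

text \<open>The gradient matrix of a vector field; the norm on \<^typ>\<open>real^2^2\<close> is the Frobenius norm.\<close>

definition vgrad :: "(real^2 \<Rightarrow> real^2) \<Rightarrow> real^2 \<Rightarrow> real^2^2"
  where "vgrad v x = jacobian v (at x)"

definition divergence :: "(real^2 \<Rightarrow> real^2) \<Rightarrow> real^2 \<Rightarrow> real"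
  where "divergence v x = (\<Sum>i\<in>UNIV. pd i v x $ i)"

definition laplacian :: "(real^2 \<Rightarrow> real^2) \<Rightarrow> real^2 \<Rightarrow> real^2"
  where "laplacian v x = (\<Sum>i\<in>UNIV. pd i (pd i v) x)"

text \<open>Convective derivative \<open>(u \<cdot> \<nabla>) v\<close>.\<close>

definition conv :: "(real^2 \<Rightarrow> real^2) \<Rightarrow> (real^2 \<Rightarrow> real^2) \<Rightarrow> real^2 \<Rightarrow> real^2"
  where "conv u v x = (\<Sum>i\<in>UNIV. u x $ i *\<^sub>R pd i v x)"

text \<open>
  In two dimensions the curl of a vector field is a scalar field and the curl of a scalar
  field is a vector field; likewise for the cross product with a vector or a scalar on the right.
\<close>

definition curl :: "(real^2 \<Rightarrow> real^2) \<Rightarrow> real^2 \<Rightarrow> real"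
  where "curl v x = pd 1 v x $ 2 - pd 2 v x $ 1"

definition scurl :: "(real^2 \<Rightarrow> real) \<Rightarrow> real^2 \<Rightarrow> real^2"
  where "scurl \<phi> x = vector [pd 2 \<phi> x, - pd 1 \<phi> x]"

definition vcross :: "real^2 \<Rightarrow> real^2 \<Rightarrow> real"
  where "vcross a b = a $ 1 * b $ 2 - a $ 2 * b $ 1"

definition vcross_scalar :: "real^2 \<Rightarrow> real \<Rightarrow> real^2"
  where "vcross_scalar a c = vector [a $ 2 * c, - (a $ 1 * c)]"

definition L2norm :: "(real^2) set \<Rightarrow> (real^2 \<Rightarrow> 'a::real_normed_vector) \<Rightarrow> real"
  where "L2norm \<Omega> f = sqrt (LINT x:\<Omega>|lborel. (norm (f x))\<^sup>2)"


section \<open>Domains and their outward normal\<close>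

text \<open>
  Lipschitz boundary: near each boundary point, and after a rigid
  motion, \<open>\<Omega>\<close> is the region below the graph of a Lipschitz function. (Polygons such as squares
  are included.)
\<close>

definition bounded_lipschitz_domain :: "(real^2) set \<Rightarrow> bool" where
  "bounded_lipschitz_domain \<Omega> \<longleftrightarrow>
     open \<Omega> \<and> connected \<Omega> \<and> \<Omega> \<noteq> {} \<and> bounded \<Omega> \<and>
     (\<forall>x\<in>frontier \<Omega>. \<exists>r>0. \<exists>(Q :: real^2 \<Rightarrow> real^2) (g :: real \<Rightarrow> real) L.
        orthogonal_transformation Q \<and> L-lipschitz_on UNIV g \<and>
        (\<forall>y\<in>ball x r. y \<in> \<Omega> \<longleftrightarrow> Q (y - x) $ 2 < g (Q (y - x) $ 1)))"

text \<open>
  \<open>\<nu>\<close> is the outward unit normal of \<open>\<Omega>\<close> at the boundary point \<open>x\<close>: up to cones of arbitrarily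
  small aperture around the line orthogonal to \<open>\<nu>\<close>, near \<open>x\<close> the set \<open>\<Omega>\<close> is the half plane
  \<open>(y - x) \<bullet> \<nu> < 0\<close>. On a local graph \<open>y\<^sub>2 = g(y\<^sub>1)\<close> such a \<open>\<nu>\<close> exists exactly where \<open>g\<close> is
  differentiable, hence almost everywhere on a Lipschitz boundary, and it is then
  \<open>(- g', 1) / sqrt (1 + g'\<^sup>2)\<close>. Boundary conditions involving the normal are imposed
  wherever the normal exists.
\<close>

definition outward_unit_normal :: "(real^2) set \<Rightarrow> real^2 \<Rightarrow> real^2 \<Rightarrow> bool" where
  "outward_unit_normal \<Omega> x \<nu> \<longleftrightarrow>
     x \<in> frontier \<Omega> \<and> norm \<nu> = 1 \<and>
     (\<forall>\<epsilon>>0. \<forall>\<^sub>F y in at x.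
        ((y - x) \<bullet> \<nu> < - \<epsilon> * norm (y - x) \<longrightarrow> y \<in> \<Omega>) \<and>
        ((y - x) \<bullet> \<nu> > \<epsilon> * norm (y - x) \<longrightarrow> y \<notin> \<Omega>))"

definition zero_normal_trace :: "(real^2) set \<Rightarrow> (real^2 \<Rightarrow> real^2) \<Rightarrow> bool"
  where "zero_normal_trace \<Omega> v \<longleftrightarrow> (\<forall>x \<nu>. outward_unit_normal \<Omega> x \<nu> \<longrightarrow> v x \<bullet> \<nu> = 0)"

definition zero_tangential_trace :: "(real^2) set \<Rightarrow> (real^2 \<Rightarrow> real^2) \<Rightarrow> bool"
  where "zero_tangential_trace \<Omega> v \<longleftrightarrow> (\<forall>x \<nu>. outward_unit_normal \<Omega> x \<nu> \<longrightarrow> vcross (v x) \<nu> = 0)"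


section \<open>Regularity classes\<close>

text \<open>For open \<open>\<Omega>\<close>: \<open>C1_on\<close> and \<open>C2_on\<close> are the classes \<open>C\<^sup>1(\<Omega>)\<close> and \<open>C\<^sup>2(\<Omega>)\<close>.\<close>

definition C1_on :: "(real^2) set \<Rightarrow> (real^2 \<Rightarrow> 'a::real_normed_vector) \<Rightarrow> bool"
  where "C1_on \<Omega> f \<longleftrightarrow> (\<forall>x\<in>\<Omega>. f differentiable (at x)) \<and> (\<forall>i. continuous_on \<Omega> (pd i f))"

definition C2_on :: "(real^2) set \<Rightarrow> (real^2 \<Rightarrow> 'a::real_normed_vector) \<Rightarrow> bool"
  where "C2_on \<Omega> f \<longleftrightarrow> C1_on \<Omega> f \<and> (\<forall>i. C1_on \<Omega> (pd i f))"

text \<open>\<open>C\<^sup>1\<close> up to the boundary: \<open>f\<close> and its first derivatives extend continuously to the closure.\<close>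

definition C1_closure :: "(real^2) set \<Rightarrow> (real^2 \<Rightarrow> 'a::real_normed_vector) \<Rightarrow> bool"
  where "C1_closure \<Omega> f \<longleftrightarrow> C1_on \<Omega> f \<and> continuous_on (closure \<Omega>) f \<and>
    (\<forall>i. \<exists>h. continuous_on (closure \<Omega>) h \<and> (\<forall>x\<in>\<Omega>. h x = pd i f x))"

text \<open>
  The regularity of classical solutions: fields entering the equations with first derivatives are
  in \<open>C\<^sup>1(\<Omega>)\<close>, those entering with second derivatives in \<open>C\<^sup>2(\<Omega>)\<close>, each with one derivative fewer
  continuous up to the boundary. The pressure is in \<open>C\<^sup>1\<close> up to the boundary (\<open>C1_closure\<close>).
\<close>

definition first_order_regular :: "(real^2) set \<Rightarrow> (real^2 \<Rightarrow> real^2) \<Rightarrow> bool"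
  where "first_order_regular \<Omega> v \<longleftrightarrow> C1_on \<Omega> v \<and> continuous_on (closure \<Omega>) v"

definition second_order_regular :: "(real^2) set \<Rightarrow> (real^2 \<Rightarrow> real^2) \<Rightarrow> bool"
  where "second_order_regular \<Omega> v \<longleftrightarrow> C2_on \<Omega> v \<and> C1_closure \<Omega> v"


section \<open>The semi-discrete scheme\<close>

definition admissible_initial_data ::
  "(real^2) set \<Rightarrow> (real^2 \<Rightarrow> real^2) \<Rightarrow> (real^2 \<Rightarrow> real^2) \<Rightarrow> (real^2 \<Rightarrow> real) \<Rightarrow> bool" where
  "admissible_initial_data \<Omega> u0 B0 p0 \<longleftrightarrow>
     first_order_regular \<Omega> u0 \<and> first_order_regular \<Omega> B0 \<and> C1_closure \<Omega> p0 \<and>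
     (\<forall>x\<in>\<Omega>. divergence u0 x = 0) \<and> (\<forall>x\<in>frontier \<Omega>. u0 x = 0) \<and>
     (\<forall>x\<in>\<Omega>. divergence B0 x = 0) \<and> zero_tangential_trace \<Omega> B0"

text \<open>In the step predicates, \<open>u\<close>, \<open>B\<close>, \<open>p\<close> are the fields at time level \<open>n\<close> and
  \<open>u'\<close>, \<open>B'\<close>, \<open>p'\<close> those at level \<open>n + 1\<close>; \<open>us\<close> is \<open>u\<^sub>\<star>\<^sup>n\<close> and \<open>ut'\<close> is the
  intermediate velocity (written with a tilde) at level \<open>n + 1\<close>.\<close>

definition magnetic_step ::
  "(real^2) set \<Rightarrow> real \<Rightarrow> real \<Rightarrow> real \<Rightarrow> (real^2 \<Rightarrow> real^2) \<Rightarrow> (real^2 \<Rightarrow> real^2) \<Rightarrow>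
   (real^2 \<Rightarrow> real^2) \<Rightarrow> (real^2 \<Rightarrow> real^2) \<Rightarrow> bool" where
  "magnetic_step \<Omega> \<eta> s \<delta>t u B us B' \<longleftrightarrow>
     second_order_regular \<Omega> B' \<and> first_order_regular \<Omega> us \<and>
     (\<forall>x\<in>\<Omega>. (1 / \<delta>t) *\<^sub>R (B' x - B x) + \<eta> *\<^sub>R scurl (curl B') x
                - scurl (\<lambda>y. vcross (us y) (B y)) x = 0) \<and>
     (\<forall>x\<in>\<Omega>. (1 / \<delta>t) *\<^sub>R (us x - u x) + s *\<^sub>R vcross_scalar (B x) (curl B' x) = 0) \<and>
     zero_tangential_trace \<Omega> B'"

definition momentum_step ::
  "(real^2) set \<Rightarrow> real \<Rightarrow> real \<Rightarrow> (real^2 \<Rightarrow> real^2) \<Rightarrow> (real^2 \<Rightarrow> real) \<Rightarrow>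
   (real^2 \<Rightarrow> real^2) \<Rightarrow> (real^2 \<Rightarrow> real^2) \<Rightarrow> bool" where
  "momentum_step \<Omega> \<nu> \<delta>t u p us ut' \<longleftrightarrow>
     second_order_regular \<Omega> ut' \<and>
     (\<forall>x\<in>\<Omega>. (1 / \<delta>t) *\<^sub>R (ut' x - us x) + conv u ut' x - \<nu> *\<^sub>R laplacian ut' x + grad p x = 0) \<and>
     (\<forall>x\<in>frontier \<Omega>. ut' x = 0)"

definition projection_step ::
  "(real^2) set \<Rightarrow> real \<Rightarrow> (real^2 \<Rightarrow> real) \<Rightarrow> (real^2 \<Rightarrow> real^2) \<Rightarrow>
   (real^2 \<Rightarrow> real^2) \<Rightarrow> (real^2 \<Rightarrow> real) \<Rightarrow> bool" where
  "projection_step \<Omega> \<delta>t p ut' u' p' \<longleftrightarrow>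
     first_order_regular \<Omega> u' \<and> C1_closure \<Omega> p' \<and>
     (\<forall>x\<in>\<Omega>. (1 / \<delta>t) *\<^sub>R (u' x - ut' x) + grad (\<lambda>y. p' y - p y) x = 0) \<and>
     (\<forall>x\<in>\<Omega>. divergence u' x = 0) \<and> zero_normal_trace \<Omega> u'"

text \<open>The last time index \<open>N = [T/\<delta>t] - 1\<close> is an integer and equals \<open>-1\<close> if \<open>\<delta>t > T\<close>.\<close>

definition last_index :: "real \<Rightarrow> real \<Rightarrow> int"
  where "last_index T \<delta>t = \<lfloor>T / \<delta>t\<rfloor> - 1"

definition generated_by_scheme ::
  "(real^2) set \<Rightarrow> real \<Rightarrow> real \<Rightarrow> real \<Rightarrow> real \<Rightarrow> real \<Rightarrow>
   (nat \<Rightarrow> real^2 \<Rightarrow> real^2) \<Rightarrow> (nat \<Rightarrow> real^2 \<Rightarrow> real^2) \<Rightarrow> (nat \<Rightarrow> real^2 \<Rightarrow> real^2) \<Rightarrow>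
   (nat \<Rightarrow> real^2 \<Rightarrow> real^2) \<Rightarrow> (nat \<Rightarrow> real^2 \<Rightarrow> real) \<Rightarrow> bool" where
  "generated_by_scheme \<Omega> T \<nu> \<eta> s \<delta>t B us ut u p \<longleftrightarrow>
     admissible_initial_data \<Omega> (u 0) (B 0) (p 0) \<and>
     (\<forall>n. int n \<le> last_index T \<delta>t \<longrightarrow>
        magnetic_step \<Omega> \<eta> s \<delta>t (u n) (B n) (us n) (B (Suc n)) \<and>
        momentum_step \<Omega> \<nu> \<delta>t (u n) (p n) (us n) (ut (Suc n)) \<and>
        projection_step \<Omega> \<delta>t (p n) (ut (Suc n)) (u (Suc n)) (p (Suc n)))"

end

theory Submission
  imports Defs
begin

text \<open>
  Testing the magnetic equation with \<open>2 s \<delta>t B\<^sup>n\<^sup>+\<^sup>1\<close>, the equation of \<open>u\<^sub>\<star>\<close> with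
  \<open>2 \<delta>t u\<^sub>\<star>\<close> and the momentum equation with \<open>2 \<delta>t u~\<^sup>n\<^sup>+\<^sup>1\<close>, the two Lorentz terms
  \<open>(u\<^sub>\<star> \<times> B, \<nabla> \<times> B)\<close> cancel, and substituting the projection step turns the pressure terms into a
  telescoping difference. What is left is a sum of squares and of terms whose integral vanishes by
  the divergence theorem.

  The fields to which it is applied are only \<open>C\<^sup>1\<close> inside \<open>\<Omega>\<close> and continuous up to the boundary, with
  a bounded divergence and a normal trace that vanishes wherever the normal exists. After a
  partition of unity \<open>\<Omega>\<close> is the region below a Lipschitz graph \<open>y = g(x)\<close>, which the shear
  \<open>(x, t) \<mapsto> (x, g(x) - t)\<close> flattens; at depth \<open>t \<ge> \<epsilon>\<close> the derivatives are bounded, and the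
  flux through \<open>t = \<epsilon>\<close> is the integral of \<open>F\<^sub>2 - g' F\<^sub>1\<close>, which tends to zero with \<open>\<epsilon>\<close>. It
  matters here that \<open>g\<close> is differentiable almost everywhere, since only there a normal exists.

  The magnetic field stays solenoidal because \<open>B\<^sup>n\<^sup>+\<^sup>1 - B\<^sup>n\<close> is the curl of a scalar potential;
  the potential is a priori only \<open>C\<^sup>1\<close>, but its curl is \<open>C\<^sup>1\<close> by the equation, hence it is \<open>C\<^sup>2\<close>.
\<close>

section \<open>Differentiability almost everywhere of Lipschitz functions\<close>

text \<open>The obstacle is regularity at the boundary. Derivatives of the fields fed into the
  divergence theorem may be unbounded there, so a single partial derivative need not be integrable
  over \<Omega>. What saves the argument is that only combinations present in the scheme are needed:
  the equations express the Laplacian of the intermediate velocity and the curl of the magnetic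
  potential through quantities bounded up to the boundary, and the velocities are solenoidal. The
  divergence of each flux field is therefore bounded although its two summands may not be. Hence the
  divergence theorem assumes a bound on the divergence alone, and the chart argument stays at
  positive depth as long as the summands are treated separately. In the flattened chart a component
  is merely Lipschitz along horizontal lines, because the shear contains \<open>g\<close>; its
  horizontal derivative is integrated through translated difference quotients. The algebra of the
  energy estimate is done at each point before integrating, with three squares of increments
  discarded; this is the only source of the inequality.\<close>

lemma Vitali_open_intervals:
  fixes E U :: "real set" and P :: "real \<Rightarrow> real \<Rightarrow> bool"
  assumes "open U" and "E \<subseteq> U"
    and fine: "\<And>x d. x \<in> E \<Longrightarrow> d > 0 \<Longrightarrow> \<exists>p q. p < x \<and> x < q \<and> q - p < d \<and> P p q"
  obtains C :: "(real \<times> real) set"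
  where "countable C"
    and "\<And>p q. (p, q) \<in> C \<Longrightarrow> p < q \<and> {p<..<q} \<subseteq> U \<and> P p q"
    and "disjoint_family_on (\<lambda>(p, q). {p<..<q}) C"
    and "negligible (E - (\<Union>(p, q)\<in>C. {p<..<q}))"
proof -
  let ?K = "{(p, q). p < q \<and> {p<..<q} \<subseteq> U \<and> P p q}"
  let ?a = "\<lambda>(p, q). (p + q) / 2 :: real" and ?r = "\<lambda>(p, q). (q - p) / 2 :: real"
  \<comment> \<open>An interval is the ball around its midpoint, so the covering theorem for balls
    applies. The covered point is only inside the interval, not its centre, which suits secants that
    straddle it.\<close>
  have ball: "ball (?a i) (?r i) = (\<lambda>(p, q). {p<..<q}) i" for i
  proof (cases i)
    case (Pair p q)
    have "(p + q) / 2 - (q - p) / 2 = p" "(p + q) / 2 + (q - p) / 2 = q"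
      by (simp_all add: field_simps)
    then show ?thesis by (simp add: Pair ball_eq_greaterThanLessThan)
  qed
  have cov: "\<exists>i. i \<in> ?K \<and> x \<in> ball (?a i) (?r i) \<and> ?r i < d" if "x \<in> E" "d > 0" for x d
  proof -
    have "x \<in> U" using \<open>E \<subseteq> U\<close> that(1) by (rule subsetD)
    with \<open>open U\<close> obtain e where e: "e > 0" "ball x e \<subseteq> U"
      by (rule openE)
    have "min d e > 0" using \<open>d > 0\<close> e(1) by simp
    from fine[OF that(1) this] obtain p q
      where pq: "p < x" "x < q" "q - p < d" "q - p < e" "P p q"
      unfolding min_less_iff_conj by auto
    have "{p<..<q} \<subseteq> ball x e"
    proof
      fix y assume "y \<in> {p<..<q}"
      with pq have "\<bar>x - y\<bar> < e" by (simp add: abs_less_iff)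
      then show "y \<in> ball x e" by (simp add: dist_real_def)
    qed
    then have "{p<..<q} \<subseteq> U" using e(2) by (rule order_trans)
    with pq have "(p, q) \<in> ?K" by simp
    moreover have "x \<in> ball (?a (p, q)) (?r (p, q))"
      unfolding ball using pq by simp
    moreover have "?r (p, q) < d" using pq by simp
    ultimately show ?thesis by (intro exI[of _ "(p, q)"] conjI)
  qed
  obtain C where C: "countable C" "C \<subseteq> ?K"
     "pairwise (\<lambda>i j. disjnt (ball (?a i) (?r i)) (ball (?a j) (?r j))) C"
     "negligible (E - (\<Union>i\<in>C. ball (?a i) (?r i)))"
    by (rule Vitali_covering_theorem_balls[of E ?K ?a ?r, OF cov])
  show thesis
  proof
    show "countable C" by fact
    show "p < q \<and> {p<..<q} \<subseteq> U \<and> P p q" if "(p, q) \<in> C" for p q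
      using C(2) that by auto
    show "disjoint_family_on (\<lambda>(p, q). {p<..<q}) C"
      using C(3) unfolding ball by (auto simp: disjoint_family_on_def pairwise_def disjnt_def)
    show "negligible (E - (\<Union>(p, q)\<in>C. {p<..<q}))"
      using C(4) unfolding ball .
  qed
qed

text \<open>Continuity excludes an atom at \<open>b\<close>, so the formula for half-open intervals
  carries over. Increments thereby become a measure, in which disjoint intervals can be added
  up.\<close>

lemma emeasure_interval_measure_Ioo:
  assumes "a \<le> b" and "mono F" and "continuous_on UNIV F"
  shows "emeasure (interval_measure F) {a<..<b} = ennreal (F b - F a)"
proof (cases "a = b")
  case False
  have c: "continuous (at_right x) F" for x
    using assms(3) by (simp add: continuous_on_eq_continuous_at continuous_at_imp_continuous_within)
  have m: "\<And>x y. x \<le> y \<Longrightarrow> F x \<le> F y" using assms(2) by (auto dest: monoD)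
  have "emeasure (interval_measure F) {b..b} = 0"
    by (subst emeasure_interval_measure_Icc) (use m assms in auto)
  hence "{b} \<in> null_sets (interval_measure F)" by auto
  hence "emeasure (interval_measure F) ({a<..<b} \<union> {b}) = emeasure (interval_measure F) {a<..<b}"
    by (intro emeasure_Un_null_set) auto
  moreover have "{a<..<b} \<union> {b} = {a<..b}" using assms(1) False by auto
  ultimately show ?thesis
    using emeasure_interval_measure_Ioc[of a b F] m c assms(1) by simp
qed auto

text \<open>The secants straddle \<open>x\<close>, so at each scale the condition is open in
  \<open>x\<close>: the set is a countable intersection of open sets, hence Borel for arbitrary
  \<open>f\<close> and \<open>P\<close>. It takes the place of the sets where a Dini derivate lies
  below or above a level.\<close>

definition fine_slope :: "(real \<Rightarrow> real) \<Rightarrow> (real \<Rightarrow> bool) \<Rightarrow> real set"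
  where "fine_slope f P =
    {x. \<forall>d>0. \<exists>p q. p < x \<and> x < q \<and> q - p < d \<and> P ((f q - f p) / (q - p))}"

lemma fine_slope_borel: "fine_slope f P \<in> sets borel"
proof -
  let ?V = "\<lambda>n::nat. \<Union>(p, q)\<in>{(p, q). q - p < 1 / Suc n \<and> P ((f q - f p) / (q - p))}. {p<..<q}"
  have "fine_slope f P = (\<Inter>n. ?V n)"
  proof (intro equalityI subsetI)
    fix x assume "x \<in> fine_slope f P"
    then have "\<exists>p q. p < x \<and> x < q \<and> q - p < 1 / Suc n \<and> P ((f q - f p) / (q - p))" for n
      unfolding fine_slope_def by simp
    then show "x \<in> (\<Inter>n. ?V n)" by fastforce
  next
    fix x assume x: "x \<in> (\<Inter>n. ?V n)"
    show "x \<in> fine_slope f P"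
      unfolding fine_slope_def
    proof (safe)
      fix d :: real assume "d > 0"
      then obtain n where n: "1 / Suc n < d" using nat_approx_posE by blast
      from x have "x \<in> ?V n" by blast
      with n show "\<exists>p q. p < x \<and> x < q \<and> q - p < d \<and> P ((f q - f p) / (q - p))"
        by (smt (verit) UN_E case_prodE case_prod_conv greaterThanLessThan_iff mem_Collect_eq)
    qed
  qed
  moreover have "open (?V n)" for n by (intro open_UN) auto
  ultimately show ?thesis by simp
qed

text \<open>
  Cover the set by short intervals of slope \<open>< a\<close> and, inside these, again by intervals of slope
  \<open>> b\<close>: comparing the increments of \<open>f\<close> over both covers shows that \<open>b\<close> times the measure of the
  set is at most \<open>a\<close> times it.
\<close>

lemma fine_slope_crossing_null:
  assumes f: "mono f" "continuous_on UNIV f" and ab: "0 < a" "a < b"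
  shows "fine_slope f (\<lambda>m. m < a) \<inter> fine_slope f (\<lambda>m. b < m) \<in> null_sets lborel"
proof -
  let ?E = "fine_slope f (\<lambda>m. m < a) \<inter> fine_slope f (\<lambda>m. b < m)"
  let ?\<mu> = "interval_measure f"
  have Ioo: "emeasure ?\<mu> {p<..<q} = ennreal (f q - f p)" if "p \<le> q" for p q
    using emeasure_interval_measure_Ioo[OF that f] .
  \<comment> \<open>Cutting down to a bounded set makes the measure m finite, so that b m \<le> a m
    can force m = 0.\<close>
  have null: "?E \<inter> {-M<..<M} \<in> null_sets lborel" for M :: real
  proof -
    define E where "E = ?E \<inter> {-M<..<M}"
    have Eb: "E \<in> sets borel" unfolding E_def by (intro sets.Int fine_slope_borel) auto
    have "emeasure lborel E \<le> emeasure lborel {-M<..<M}"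
      by (intro emeasure_mono) (auto simp: E_def)
    also have "\<dots> < \<infinity>" by (cases "-M \<le> M") auto
    finally have fin: "emeasure lborel E < \<infinity>" .
    have key: "ennreal b * emeasure lborel E \<le> ennreal a * (emeasure lborel E + ennreal e)"
      if "e > 0" for e :: real
    proof -
      have "E \<in> sets lebesgue" using Eb by simp
      then obtain U where U: "open U" "E \<subseteq> U" "emeasure lebesgue (U - E) < ennreal e"
        and "U - E \<in> lmeasurable"
        using \<open>e > 0\<close> by (rule sets_lebesgue_outer_open)
      have Ub: "emeasure lborel U \<le> emeasure lborel E + ennreal e"
      proof -
        have "emeasure lborel U = emeasure lborel (E \<union> (U - E))" using U by (simp add: Un_absorb1)
        also have "\<dots> \<le> emeasure lborel E + emeasure lborel (U - E)"
          using U Eb by (intro emeasure_subadditive) auto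
        also have "emeasure lborel (U - E) = emeasure lebesgue (U - E)"
          using U Eb by (simp add: emeasure_completion)
        finally show ?thesis using U(3) by (meson add_left_mono dual_order.trans less_imp_le)
      qed
      obtain C where C: "countable C"
        "\<And>p q. (p, q) \<in> C \<Longrightarrow> p < q \<and> {p<..<q} \<subseteq> U \<and> (f q - f p) / (q - p) < a"
        "disjoint_family_on (\<lambda>(p, q). {p<..<q}) C"
        "negligible (E - (\<Union>(p, q)\<in>C. {p<..<q}))"
        by (rule Vitali_open_intervals[OF U(1,2), of "\<lambda>p q. (f q - f p) / (q - p) < a"])
           (auto simp: E_def fine_slope_def)
      define V where "V = (\<Union>(p, q)\<in>C. {p<..<q})"
      have V: "open V" "V \<subseteq> U" unfolding V_def using C(2) by (auto intro!: open_UN)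
      \<comment> \<open>The second cover is sought inside \<open>V\<close>, so that its increments
        of \<open>f\<close> are part of those counted by the first.\<close>
      obtain D where D: "countable D"
        "\<And>p q. (p, q) \<in> D \<Longrightarrow> p < q \<and> {p<..<q} \<subseteq> V \<and> b < (f q - f p) / (q - p)"
        "disjoint_family_on (\<lambda>(p, q). {p<..<q}) D"
        "negligible (E \<inter> V - (\<Union>(p, q)\<in>D. {p<..<q}))"
        by (rule Vitali_open_intervals[OF V(1), of "E \<inter> V" "\<lambda>p q. b < (f q - f p) / (q - p)"])
           (auto simp: E_def fine_slope_def)
      define W where "W = (\<Union>(p, q)\<in>D. {p<..<q})"
      have W: "open W" "W \<subseteq> V" unfolding W_def using D(2) by (auto intro!: open_UN)
      have EW: "emeasure lborel E \<le> emeasure lborel W"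
      proof -
        have "negligible ((E - V) \<union> (E \<inter> V - W))"
          using C(4) D(4) unfolding V_def W_def by (rule negligible_Un)
        then have "negligible (E - W)" by (rule negligible_subset) auto
        then have "E - W \<in> null_sets lebesgue" by (simp add: negligible_iff_null_sets)
        then have 0: "emeasure lborel (E - W) = 0"
          using Eb W by (auto simp: null_sets_def emeasure_completion)
        have "emeasure lborel E \<le> emeasure lborel (W \<union> (E - W))"
          using Eb W by (intro emeasure_mono) auto
        also have "\<dots> \<le> emeasure lborel W + emeasure lborel (E - W)"
          using W Eb by (intro emeasure_subadditive) auto
        finally show ?thesis using 0 by simp
      qed
      \<comment> \<open>With \<mu> the measure of increments and |.| Lebesgue measure, the chain
        reads b |E| \<le> b |W| \<le> \<mu>(W) \<le> \<mu>(V) \<le> a |V| \<le> a |U|.\<close>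
      have "ennreal b * emeasure lborel E \<le> ennreal b * emeasure lborel W"
        using EW by (rule mult_left_mono) simp
      also have "emeasure lborel W = (\<integral>\<^sup>+i. emeasure lborel ((\<lambda>(p, q). {p<..<q}) i) \<partial>count_space D)"
        unfolding W_def by (intro emeasure_UN_countable D) auto
      also have "ennreal b * \<dots> = (\<integral>\<^sup>+i. ennreal b * emeasure lborel ((\<lambda>(p, q). {p<..<q}) i) \<partial>count_space D)"
        by (simp add: nn_integral_cmult)
      also have "\<dots> \<le> (\<integral>\<^sup>+i. emeasure ?\<mu> ((\<lambda>(p, q). {p<..<q}) i) \<partial>count_space D)"
      proof (intro nn_integral_mono, clarsimp)
        fix p q assume "(p, q) \<in> D"
        from D(2)[OF this] have "p < q" "b * (q - p) \<le> f q - f p" by (auto simp: field_simps)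
        then show "ennreal b * emeasure lborel {p<..<q} \<le> emeasure ?\<mu> {p<..<q}"
          using ab by (simp add: Ioo ennreal_mult[symmetric] ennreal_leI)
      qed
      also have "\<dots> = emeasure ?\<mu> W"
        unfolding W_def by (intro emeasure_UN_countable[symmetric] D) auto
      also have "\<dots> \<le> emeasure ?\<mu> V" using W V by (intro emeasure_mono) auto
      also have "\<dots> = (\<integral>\<^sup>+i. emeasure ?\<mu> ((\<lambda>(p, q). {p<..<q}) i) \<partial>count_space C)"
        unfolding V_def by (intro emeasure_UN_countable C) auto
      also have "\<dots> \<le> (\<integral>\<^sup>+i. ennreal a * emeasure lborel ((\<lambda>(p, q). {p<..<q}) i) \<partial>count_space C)"
      proof (intro nn_integral_mono, clarsimp)
        fix p q assume "(p, q) \<in> C"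
        from C(2)[OF this] have "p < q" "f q - f p \<le> a * (q - p)" by (auto simp: field_simps)
        then show "emeasure ?\<mu> {p<..<q} \<le> ennreal a * emeasure lborel {p<..<q}"
          using ab by (simp add: Ioo ennreal_mult[symmetric] ennreal_leI)
      qed
      also have "\<dots> = ennreal a * (\<integral>\<^sup>+i. emeasure lborel ((\<lambda>(p, q). {p<..<q}) i) \<partial>count_space C)"
        by (simp add: nn_integral_cmult)
      also have "(\<integral>\<^sup>+i. emeasure lborel ((\<lambda>(p, q). {p<..<q}) i) \<partial>count_space C) = emeasure lborel V"
        unfolding V_def by (intro emeasure_UN_countable[symmetric] C) auto
      also have "\<dots> \<le> emeasure lborel U" using U V by (intro emeasure_mono) auto
      also have "\<dots> \<le> emeasure lborel E + ennreal e" by (rule Ub)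
      finally show ?thesis by (simp add: mult_left_mono)
    qed
    define m where "m = measure lborel E"
    have em: "emeasure lborel E = ennreal m"
      using fin by (simp add: m_def emeasure_eq_ennreal_measure)
    have m0: "m \<ge> 0" by (simp add: m_def)
    have "b * m \<le> a * m + e" if "e > 0" for e
    proof -
      have "ennreal b * ennreal m \<le> ennreal a * (ennreal m + ennreal (e / a))"
        using key[of "e / a"] that ab em by simp
      also have "ennreal a * (ennreal m + ennreal (e / a)) = ennreal (a * (m + e / a))"
        using m0 that ab by (simp add: ennreal_mult ennreal_plus[symmetric] del: ennreal_plus)
      finally have "ennreal (b * m) \<le> ennreal (a * (m + e / a))"
        using ab m0 by (simp add: ennreal_mult)
      then have "b * m \<le> a * (m + e / a)"
        using ab m0 that by (subst (asm) ennreal_le_iff) auto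
      also have "\<dots> = a * m + e" using ab by (simp add: distrib_left)
      finally show ?thesis .
    qed
    then have "b * m \<le> a * m" by (rule field_le_epsilon)
    with mult_strict_right_mono[OF ab(2), of m] m0 have "m = 0" by linarith
    with em Eb have "E \<in> null_sets lborel" by (simp add: null_sets_def)
    then show ?thesis unfolding E_def .
  qed
  have "?E = (\<Union>n::nat. ?E \<inter> {- real n<..<real n})"
  proof -
    have "\<exists>n::nat. - real n < x \<and> x < real n" for x :: real
      using reals_Archimedean2[of "\<bar>x\<bar>"] by (auto simp: abs_less_iff) (metis minus_less_iff)
    then show ?thesis by auto
  qed
  moreover have "(\<Union>n::nat. ?E \<inter> {- real n<..<real n}) \<in> null_sets lborel"
    by (intro null_sets_UN' null) simp
  ultimately show ?thesis by (rule ssubst)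
qed

text \<open>\<open>D\<close> is the lower limit of the slopes of secants straddling
  \<open>x\<close>. If the upper limit exceeded it, two rationals in between would put
  \<open>x\<close> into a crossing set; slopes are at least 1 so that these rationals are positive.
  Secants ending at \<open>x\<close> are limits of straddling ones by continuity, which turns the
  limit into an ordinary derivative.\<close>

lemma differentiable_off_crossings:
  fixes f :: "real \<Rightarrow> real"
  assumes cont: "continuous_on UNIV f"
    and slope: "\<And>p q. p < q \<Longrightarrow> 1 \<le> (f q - f p) / (q - p) \<and> (f q - f p) / (q - p) \<le> K"
    and x: "\<And>a b. a \<in> \<rat> \<Longrightarrow> b \<in> \<rat> \<Longrightarrow> 0 < a \<Longrightarrow> a < b \<Longrightarrow>
              x \<notin> fine_slope f (\<lambda>m. m < a) \<inter> fine_slope f (\<lambda>m. b < m)"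
  shows "\<exists>D. (f has_real_derivative D) (at x)"
proof -
  let ?S = "\<lambda>d. {(f q - f p) / (q - p) | p q. p < x \<and> x < q \<and> q - p < d}"
  define D where "D = (SUP d\<in>{0<..}. Inf (?S d))"
  have ne: "?S d \<noteq> {}" if "d > 0" for d
  proof -
    have "x - d/3 < x" "x < x + d/3" "(x + d/3) - (x - d/3) < d" using that by auto
    then show ?thesis by blast
  qed
  have bb: "bdd_below (?S d)" and lo: "\<And>y. y \<in> ?S d \<Longrightarrow> 1 \<le> y \<and> y \<le> K" for d
    using slope by (auto intro!: bdd_belowI[of _ 1])
  have InfK: "Inf (?S d) \<le> K" if "d > 0" for d
    using ne[OF that] lo[of _ d] bb[of d] by (meson cInf_lower ex_in_conv order_trans)
  have ba: "bdd_above ((\<lambda>d. Inf (?S d)) ` {0<..})"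
    by (intro bdd_aboveI[of _ K]) (auto intro: InfK)
  have Inf1: "1 \<le> Inf (?S d)" if "d > 0" for d
    using ne[OF that] lo[of _ d] by (meson cInf_greatest)
  have D1: "1 \<le> D" unfolding D_def
    by (rule order_trans[OF Inf1[of 1] cSUP_upper[OF _ ba]]) auto
  have lower: "\<exists>d>0. \<forall>p q. p < x \<longrightarrow> x < q \<longrightarrow> q - p < d \<longrightarrow> D - e < (f q - f p) / (q - p)" if "e > 0" for e
  proof -
    have "D - e < D" using that by simp
    then obtain d where d: "d > 0" "D - e < Inf (?S d)"
      unfolding D_def using less_cSUP_iff[OF _ ba] by auto
    then have "D - e < (f q - f p) / (q - p)" if "p < x" "x < q" "q - p < d" for p q
      using cInf_lower[OF _ bb[of d], of "(f q - f p) / (q - p)"] that by fastforce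
    with d show ?thesis by blast
  qed
  have upper: "\<exists>d>0. \<forall>p q. p < x \<longrightarrow> x < q \<longrightarrow> q - p < d \<longrightarrow> (f q - f p) / (q - p) < D + e" if "e > 0" for e
  proof -
    \<comment> \<open>Two rationals with D < a < b < D + e: slopes below \<open>a\<close> occur at
      every scale, so at small scales none exceeds \<open>b\<close>.\<close>
    obtain a where a: "a \<in> \<rat>" "D < a" "a < D + e/2" using Rats_dense_in_real[of D "D + e/2"] \<open>e > 0\<close> by auto
    obtain b where b: "b \<in> \<rat>" "D + e/2 < b" "b < D + e" using Rats_dense_in_real[of "D+e/2" "D + e"] \<open>e > 0\<close> by auto
    have "x \<in> fine_slope f (\<lambda>m. m < a)"
      unfolding fine_slope_def
    proof safe
      fix d :: real assume "d > 0"
      then have "Inf (?S d) \<le> D" unfolding D_def by (intro cSUP_upper ba) auto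
      then have "Inf (?S d) < a" using a(2) by (rule order.strict_trans1)
      then have "\<exists>y\<in>?S d. y < a" by (rule cInf_lessD[OF ne[OF \<open>d > 0\<close>]])
      then show "\<exists>p q. p < x \<and> x < q \<and> q - p < d \<and> (f q - f p) / (q - p) < a" by auto
    qed
    then have "x \<notin> fine_slope f (\<lambda>m. b < m)" using x[OF a(1) b(1)] a b D1 by simp
    then obtain d where "d > 0" "\<forall>p q. p < x \<longrightarrow> x < q \<longrightarrow> q - p < d \<longrightarrow> \<not> b < (f q - f p) / (q - p)"
      unfolding fine_slope_def by auto
    then show ?thesis using b(3) by (meson not_less order.strict_trans1)
  qed
  have lim: "((\<lambda>h. (f (x + h) - f x) / h) \<longlongrightarrow> D) (at 0)"
  proof (rule tendstoI)
    fix e :: real assume e: "e > 0"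
    obtain d1 where d1: "d1 > 0" "\<forall>p q. p < x \<longrightarrow> x < q \<longrightarrow> q - p < d1 \<longrightarrow> D - e/2 < (f q - f p) / (q - p)"
      using lower[of "e/2"] e by auto
    obtain d2 where d2: "d2 > 0" "\<forall>p q. p < x \<longrightarrow> x < q \<longrightarrow> q - p < d2 \<longrightarrow> (f q - f p) / (q - p) < D + e/2"
      using upper[of "e/2"] e by auto
    define d where "d = min d1 d2"
    have d: "d > 0" using d1(1) d2(1) by (simp add: d_def)
    have d': "\<bar>(f q - f p) / (q - p) - D\<bar> \<le> e/2" if "p < x" "x < q" "q - p < d" for p q
    proof -
      have "D - e/2 < (f q - f p) / (q - p)" "(f q - f p) / (q - p) < D + e/2"
        using d1(2) d2(2) that by (auto simp: d_def)
      then show ?thesis by linarith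
    qed
    have "isCont f x" using cont by (simp add: continuous_on_eq_continuous_at)
    then have fl: "(f \<longlongrightarrow> f x) (at_left x)" and fr: "(f \<longlongrightarrow> f x) (at_right x)"
      by (simp_all add: isCont_def filterlim_at_split)
    have right: "\<bar>(f q - f x) / (q - x) - D\<bar> \<le> e/2" if q: "x < q" "q - x < d" for q
    proof (rule tendsto_upperbound)
      show "((\<lambda>p. \<bar>(f q - f p) / (q - p) - D\<bar>) \<longlongrightarrow> \<bar>(f q - f x) / (q - x) - D\<bar>) (at_left x)"
        using q by (intro tendsto_intros fl) auto
      show "\<forall>\<^sub>F p in at_left x. \<bar>(f q - f p) / (q - p) - D\<bar> \<le> e/2"
        unfolding eventually_at_left_field
        by (rule exI[of _ "q - d"]) (use q d' in auto)
    qed auto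
    have left: "\<bar>(f x - f p) / (x - p) - D\<bar> \<le> e/2" if p: "p < x" "x - p < d" for p
    proof (rule tendsto_upperbound)
      show "((\<lambda>q. \<bar>(f q - f p) / (q - p) - D\<bar>) \<longlongrightarrow> \<bar>(f x - f p) / (x - p) - D\<bar>) (at_right x)"
        using p by (intro tendsto_intros fr) auto
      show "\<forall>\<^sub>F q in at_right x. \<bar>(f q - f p) / (q - p) - D\<bar> \<le> e/2"
        unfolding eventually_at_right_field
        by (rule exI[of _ "p + d"]) (use p d' in auto)
    qed auto
    have "dist ((f (x + h) - f x) / h) D < e" if "h \<noteq> 0" "\<bar>h\<bar> < d" for h
    proof (cases "h > 0")
      case True
      then show ?thesis using right[of "x + h"] that e by (simp add: dist_real_def)
    next
      case False
      have "(f x - f (x + h)) / (x - (x + h)) = (f (x + h) - f x) / h"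
        using that by (simp add: field_simps)
      then show ?thesis using left[of "x + h"] False that e by (simp add: dist_real_def)
    qed
    then show "\<forall>\<^sub>F h in at 0. dist ((f (x + h) - f x) / h) D < e"
      unfolding eventually_at using d by (intro exI[of _ d]) (auto simp: dist_real_def)
  qed
  then show ?thesis unfolding DERIV_def by blast
qed

text \<open>Rademacher's theorem on the line. Adding (L + 1) x lifts all slopes into [1, 2 L + 1]
  without affecting differentiability; the function becomes monotone with positive slopes, and the
  exceptional points lie in the crossing sets of countably many rational pairs.\<close>

theorem lipschitz_AE_differentiable:
  fixes g :: "real \<Rightarrow> real"
  assumes "L-lipschitz_on UNIV g"
  shows "AE x in lborel. \<exists>D. (g has_real_derivative D) (at x)"
proof -
  define f where "f x = g x + (L + 1) * x" for x
  have slope: "1 \<le> (f q - f p) / (q - p) \<and> (f q - f p) / (q - p) \<le> 2 * L + 1" if "p < q" for p q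
  proof -
    have "\<bar>g q - g p\<bar> \<le> L * (q - p)"
      using lipschitz_onD[OF assms, of q p] that by (simp add: dist_real_def)
    then have "-(L * (q - p)) \<le> g q - g p" "g q - g p \<le> L * (q - p)" by linarith+
    then show ?thesis using that unfolding f_def by (simp add: field_simps)
  qed
  have cont: "continuous_on UNIV f"
    unfolding f_def by (intro continuous_intros lipschitz_on_continuous_on[OF assms])
  have mono: "mono f"
  proof (rule monoI)
    fix x y :: real assume "x \<le> y"
    show "f x \<le> f y"
    proof (cases "x = y")
      case False
      then have "x < y" using \<open>x \<le> y\<close> by simp
      then show ?thesis using slope[of x y] by (simp add: field_simps)
    qed simp
  qed
  let ?I = "{(a, b). a \<in> \<rat> \<and> b \<in> \<rat> \<and> 0 < a \<and> a < b}"
  let ?N = "\<Union>(a, b)\<in>?I. fine_slope f (\<lambda>m. m < a) \<inter> fine_slope f (\<lambda>m. b < m)"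
  have "?N \<in> null_sets lborel"
  proof (rule null_sets_UN')
    have "?I \<subseteq> \<rat> \<times> \<rat>" by auto
    then show "countable ?I" by (rule countable_subset) (simp add: countable_rat)
    show "\<And>i. i \<in> ?I \<Longrightarrow> (case i of (a, b) \<Rightarrow> fine_slope f (\<lambda>m. m < a) \<inter> fine_slope f (\<lambda>m. b < m)) \<in> null_sets lborel"
      using fine_slope_crossing_null[OF mono cont] by clarify
  qed
  then show ?thesis
  proof (rule AE_I')
    have "\<exists>D. (g has_real_derivative D) (at x)" if "x \<notin> ?N" for x
    proof -
      have "x \<notin> fine_slope f (\<lambda>m. m < a) \<inter> fine_slope f (\<lambda>m. b < m)"
        if "a \<in> \<rat>" "b \<in> \<rat>" "0 < a" "a < b" for a b
      proof
        assume "x \<in> fine_slope f (\<lambda>m. m < a) \<inter> fine_slope f (\<lambda>m. b < m)"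
        moreover have "(a, b) \<in> ?I" using that by simp
        ultimately have "x \<in> ?N" by (intro UN_I[of "(a, b)"]) simp_all
        with \<open>x \<notin> ?N\<close> show False ..
      qed
      from differentiable_off_crossings[OF cont slope this]
      obtain D where "(f has_real_derivative D) (at x)" by blast
      then have "((\<lambda>x. f x - (L + 1) * x) has_real_derivative (D - (L + 1))) (at x)"
        by (auto intro!: derivative_eq_intros)
      then show ?thesis unfolding f_def by auto
    qed
    then show "{x \<in> space lborel. \<not> (\<exists>D. (g has_real_derivative D) (at x))} \<subseteq> ?N"
      by (intro subsetI) (metis (mono_tags, lifting) mem_Collect_eq)
  qed
qed

section \<open>Fields on the region below a Lipschitz graph\<close>

lemma AE_lborel_fst:
  fixes P :: "'a::euclidean_space \<Rightarrow> bool"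
  assumes "AE x in lborel. P x"
  shows "AE z in (lborel :: ('a \<times> 'b::euclidean_space) measure). P (fst z)"
proof -
  obtain N where N: "{x \<in> space lborel. \<not> P x} \<subseteq> N" "emeasure lborel N = 0" "N \<in> sets lborel"
    using assms by (rule AE_E)
  have "emeasure lborel (N \<times> (UNIV :: 'b set)) = emeasure (lborel \<Otimes>\<^sub>M lborel) (N \<times> (UNIV :: 'b set))"
    by (simp add: lborel_prod)
  also have "\<dots> = 0"
    using N by (subst lborel.emeasure_pair_measure_Times) auto
  finally have "N \<times> (UNIV :: 'b set) \<in> null_sets lborel"
    using N(3) by (auto simp: null_sets_def lborel_prod[symmetric])
  then show ?thesis
    by (rule AE_I') (use N(1) in auto)
qed

text \<open>Restricting to the increments 1 / Suc n gives a sequence, as dominated convergence and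
  the measurability of a derivative require.\<close>

lemma DERIV_imp_quotient_limit:
  fixes f :: "real \<Rightarrow> real"
  assumes "(f has_real_derivative D) (at x)"
  shows "(\<lambda>n. real (Suc n) * (f (x + 1 / Suc n) - f x)) \<longlonglongrightarrow> D"
proof -
  have "filterlim (\<lambda>n. 1 / real (Suc n)) (at 0) sequentially"
    using LIMSEQ_Suc[OF lim_1_over_n[where 'a = real]]
    by (intro filterlim_atI) auto
  from filterlim_compose[OF assms[unfolded DERIV_def] this]
  show ?thesis by (simp add: field_simps)
qed

text \<open>The support condition confines the function to a compact box. It serves with
  \<open>e\<close> > 0 for derivatives, which are controlled only strictly below the graph, and with
  \<open>e\<close> = 0 for the components of the field.\<close>

lemma strip_bounded_integrable:
  fixes \<phi> :: "real \<times> real \<Rightarrow> real"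
  assumes cont: "continuous_on {z. e \<le> snd z} \<phi>"
    and supp: "\<And>a t. e \<le> t \<Longrightarrow> M \<le> \<bar>a\<bar> \<or> N \<le> t \<Longrightarrow> \<phi> (a, t) = 0"
  shows "integrable lborel (\<lambda>z. indicator {z. e \<le> snd z} z * \<phi> z)"
    and "\<exists>K\<ge>0. \<forall>z. e \<le> snd z \<longrightarrow> \<bar>\<phi> z\<bar> \<le> K"
proof -
  let ?B = "cbox (-M, e) (M, N)"
  have sub: "?B \<subseteq> {z. e \<le> snd z}" by auto
  have c: "continuous_on ?B \<phi>" by (rule continuous_on_subset[OF cont sub])
  have "integrable lborel (\<lambda>z. indicator ?B z *\<^sub>R \<phi> z)"
    by (intro borel_integrable_compact c) simp
  moreover have "indicator ?B z *\<^sub>R \<phi> z = indicator {z. e \<le> snd z} z * \<phi> z" for z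
  proof (cases z)
    case (Pair a t)
    show ?thesis
    proof (cases "e \<le> t \<and> (M \<le> \<bar>a\<bar> \<or> N \<le> t)")
      case True
      then have "\<phi> z = 0" using supp[of t a] Pair by blast
      then show ?thesis by simp
    next
      case False
      then show ?thesis using Pair by (auto simp: indicator_def abs_less_iff)
    qed
  qed
  ultimately show "integrable lborel (\<lambda>z. indicator {z. e \<le> snd z} z * \<phi> z)" by (simp only:)
  have "compact (\<phi> ` ?B)" by (intro compact_continuous_image c) simp
  then have "bounded (\<phi> ` ?B)" by (rule compact_imp_bounded)
  then obtain K where K: "K > 0" "\<And>y. y \<in> \<phi> ` ?B \<Longrightarrow> norm y \<le> K"
    unfolding bounded_pos by blast
  have "\<bar>\<phi> z\<bar> \<le> K" if "e \<le> snd z" for z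
  proof (cases z)
    case (Pair a t)
    show ?thesis
    proof (cases "M \<le> \<bar>a\<bar> \<or> N \<le> t")
      case True
      then have "\<phi> z = 0" using supp[of t a] Pair that by simp
      then show ?thesis using K(1) by simp
    next
      case False
      then have "z \<in> ?B" using Pair that by (auto simp: abs_less_iff)
      then show ?thesis using K(2)[of "\<phi> z"] by simp
    qed
  qed
  then show "\<exists>K\<ge>0. \<forall>z. e \<le> snd z \<longrightarrow> \<bar>\<phi> z\<bar> \<le> K" using K(1) by (intro exI[of _ K]) auto
qed

text \<open>One chart in Cartesian coordinates, with a field of components \<open>P\<close> and
  \<open>R\<close>. Moving parallel to the graph changes both arguments of \<open>P\<close>, hence
  its total derivative; for \<open>R\<close> only vertical motion matters. The only bound up to the
  graph concerns the sum \<open>P1 + R2\<close>. The assumption \<open>trace\<close> says that the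
  product of the field with the normal direction (-m, 1) vanishes.\<close>

locale subgraph_field =
  fixes g :: "real \<Rightarrow> real" and L M C :: real and P R P1 P2 R2 :: "real \<times> real \<Rightarrow> real"
  assumes lip: "L-lipschitz_on UNIV g"
    and M0: "0 \<le> M"
    and P_deriv: "\<And>a b. b < g a \<Longrightarrow>
      (P has_derivative (\<lambda>v. P1 (a, b) * fst v + P2 (a, b) * snd v)) (at (a, b))"
    and R_deriv: "\<And>a b. b < g a \<Longrightarrow> ((\<lambda>b. R (a, b)) has_real_derivative R2 (a, b)) (at b)"
    and cont_P: "continuous_on {z. snd z \<le> g (fst z)} P"
    and cont_R: "continuous_on {z. snd z \<le> g (fst z)} R"
    and cont_P1: "continuous_on {z. snd z < g (fst z)} P1"
    and cont_P2: "continuous_on {z. snd z < g (fst z)} P2"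
    and cont_R2: "continuous_on {z. snd z < g (fst z)} R2"
    and supp: "\<And>a b. b \<le> g a \<Longrightarrow> M \<le> \<bar>a\<bar> \<or> b \<le> - M \<Longrightarrow> P (a, b) = 0 \<and> R (a, b) = 0"
    and supp': "\<And>a b. b < g a \<Longrightarrow> M \<le> \<bar>a\<bar> \<or> b \<le> - M \<Longrightarrow>
      P1 (a, b) = 0 \<and> P2 (a, b) = 0 \<and> R2 (a, b) = 0"
    and bounded_div: "\<And>a b. b < g a \<Longrightarrow> \<bar>P1 (a, b) + R2 (a, b)\<bar> \<le> C"
    and trace: "\<And>a m. (g has_real_derivative m) (at a) \<Longrightarrow> R (a, g a) = m * P (a, g a)"
begin

text \<open>Depth coordinates: the second entry measures the vertical distance below the graph. The
  map is its own inverse and preserves area.\<close>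

definition T :: "real \<times> real \<Rightarrow> real \<times> real"
  where "T z = (fst z, g (fst z) - snd z)"

text \<open>Over [-M, M] the graph is at most |g 0| + L M high, so a point at depth \<open>N\<close>
  has height at most -M and lies outside the support.\<close>

definition N :: real where "N = M + \<bar>g 0\<bar> + L * M"

text \<open>Almost everywhere the derivative of \<open>g\<close>, in a form that is visibly measurable.\<close>

definition G :: "real \<Rightarrow> real"
  where "G a = lim (\<lambda>n. real (Suc n) * (g (a + 1 / Suc n) - g a))"

lemma T_simp [simp]: "T (a, t) = (a, g a - t)"
  by (simp add: T_def)

lemma cont_g: "continuous_on S g"
  using lipschitz_on_continuous_on[OF lip] continuous_on_subset by blast

lemma cont_T: "continuous_on S T"
  unfolding T_def by (intro continuous_intros continuous_on_compose2[OF cont_g]) auto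

lemma g_meas [measurable]: "g \<in> borel_measurable borel"
  using cont_g by (rule borel_measurable_continuous_onI)

lemma G_meas [measurable]: "G \<in> borel_measurable borel"
  unfolding G_def by (intro borel_measurable_lim_metric) measurable

lemma L0: "0 \<le> L"
  using lip by (rule lipschitz_on_nonneg)

lemma g_diff: "\<bar>g x - g y\<bar> \<le> L * \<bar>x - y\<bar>"
  using lipschitz_onD[OF lip, of x y] by (simp add: dist_real_def)

lemma G_deriv: "AE a in lborel. (g has_real_derivative G a) (at a) \<and> \<bar>G a\<bar> \<le> L"
  using lipschitz_AE_differentiable[OF lip]
proof (rule AE_mp, intro AE_I2 impI)
  fix a assume "\<exists>D. (g has_real_derivative D) (at a)"
  then obtain D where D: "(g has_real_derivative D) (at a)" ..
  from DERIV_imp_quotient_limit[OF D] have lim: "(\<lambda>n. real (Suc n) * (g (a + 1 / Suc n) - g a)) \<longlonglongrightarrow> D" .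
  then have GD: "G a = D" unfolding G_def by (rule limI)
  have "\<bar>D\<bar> \<le> L"
  proof (rule LIMSEQ_le_const2[OF tendsto_rabs[OF lim]], intro exI allI impI)
    fix n
    have "\<bar>g (a + 1 / Suc n) - g a\<bar> \<le> L * (1 / Suc n)" using g_diff[of "a + 1 / Suc n" a] by simp
    then show "\<bar>real (Suc n) * (g (a + 1 / Suc n) - g a)\<bar> \<le> L" 
      by (simp only: abs_mult abs_of_nat) (simp add: field_simps)
  qed
  then show "(g has_real_derivative G a) (at a) \<and> \<bar>G a\<bar> \<le> L" using D GD by simp
qed

lemma beyond_N: assumes "M \<le> \<bar>a\<bar> \<or> N \<le> t" shows "M \<le> \<bar>a\<bar> \<or> g a - t \<le> - M"
proof (cases "M \<le> \<bar>a\<bar>")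
  case False
  have "L * \<bar>a\<bar> \<le> L * M" using False L0 by (intro mult_left_mono) auto
  then have "g a \<le> \<bar>g 0\<bar> + L * M" using g_diff[of a 0] by simp
  then show ?thesis using assms False by (simp add: N_def)
qed simp

lemma T_strip:
  assumes "continuous_on {z. snd z < g (fst z)} \<psi>" and "0 < e"
  shows "continuous_on {z. e \<le> snd z} (\<lambda>z. \<psi> (T z))"
  by (rule continuous_on_compose2[OF assms(1) cont_T]) (use assms(2) in \<open>auto simp: T_def\<close>)

lemma T_strip0:
  assumes "continuous_on {z. snd z \<le> g (fst z)} \<psi>"
  shows "continuous_on {z. 0 \<le> snd z} (\<lambda>z. \<psi> (T z))"
  by (rule continuous_on_compose2[OF assms(1) cont_T]) (auto simp: T_def)

lemma supp_T: "0 \<le> t \<Longrightarrow> M \<le> \<bar>a\<bar> \<or> N \<le> t \<Longrightarrow> P (T (a, t)) = 0 \<and> R (T (a, t)) = 0"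
  using supp[of "g a - t" a] beyond_N[of a t] by simp

lemma supp'_T: "0 < t \<Longrightarrow> M \<le> \<bar>a\<bar> \<or> N \<le> t \<Longrightarrow>
    P1 (T (a, t)) = 0 \<and> P2 (T (a, t)) = 0 \<and> R2 (T (a, t)) = 0"
  using supp'[of "g a - t" a] beyond_N[of a t] by simp

lemmas strips =
  strip_bounded_integrable[where M = M and N = N]

lemma vertical_integral:
  assumes e: "0 < e"
    and d: "\<And>b. b < g a \<Longrightarrow> (F has_real_derivative f b) (at b)"
    and c: "continuous_on {..<g a} f"
    and z: "\<And>t. 0 < t \<Longrightarrow> N \<le> t \<Longrightarrow> F (g a - t) = 0 \<and> f (g a - t) = 0"
  shows "(LINT t|lborel. indicator {e..} t * f (g a - t)) = F (g a - e)"
proof -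
  \<comment> \<open>If \<open>N\<close> < \<open>e\<close> the interval degenerates to a point, and
    \<open>F (g a - e)\<close> is zero as well.\<close>
  define K where "K = max e N"
  have "(LINT t|lborel. f (g a - t) * indicator {e..K} t) = - F (g a - K) - (- F (g a - e))"
  proof (rule integral_FTC_Icc_real[where F = "\<lambda>t. - F (g a - t)" and f = "\<lambda>t. f (g a - t)"])
    show "e \<le> K" by (simp add: K_def)
    show "((\<lambda>t. - F (g a - t)) has_real_derivative f (g a - t)) (at t)" if "e \<le> t" "t \<le> K" for t
    proof -
      have "((\<lambda>t. F (g a - t)) has_real_derivative f (g a - t) * (0 - 1)) (at t)"
        by (rule DERIV_chain2[OF d]) (use that e in \<open>auto intro!: derivative_eq_intros\<close>)
      from DERIV_minus[OF this] show ?thesis by simp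
    qed
    show "isCont (\<lambda>t. f (g a - t)) t" if "e \<le> t" "t \<le> K" for t
    proof (rule isCont_o2[where f = "\<lambda>t. g a - t" and g = f])
      show "isCont f (g a - t)"
        using c that e by (simp add: continuous_on_eq_continuous_at)
    qed simp
  qed
  moreover have "f (g a - t) * indicator {e..K} t = indicator {e..} t * f (g a - t)" for t
    using z[of t] e by (auto simp: indicator_def K_def)
  moreover have "F (g a - K) = 0" using z[of K] e by (simp add: K_def)
  ultimately show ?thesis by simp
qed

text \<open>At fixed depth the point follows the graph, which is only Lipschitz, so the mean value
  theorem is applied along the straight segment between the end points. For small increments this
  segment stays at depth at least e/2, where \<open>P1\<close> and \<open>P2\<close> are
  bounded.\<close>

lemma horizontal_quotient_bound:
  assumes e: "0 < e"
  shows "\<exists>K n0. \<forall>n\<ge>n0. \<forall>a t. e \<le> t \<longrightarrow>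
    \<bar>real (Suc n) * (P (T (a + 1 / Suc n, t)) - P (T (a, t)))\<bar> \<le> K"
proof -
  have e2: "0 < e / 2" using e by simp
  obtain K1 where K1: "K1 \<ge> 0" "\<And>z. e / 2 \<le> snd z \<Longrightarrow> \<bar>P1 (T z)\<bar> \<le> K1"
    using strips(2)[OF T_strip[OF cont_P1 e2]] supp'_T e2 by (metis order_less_le_trans)
  obtain K2 where K2: "K2 \<ge> 0" "\<And>z. e / 2 \<le> snd z \<Longrightarrow> \<bar>P2 (T z)\<bar> \<le> K2"
    using strips(2)[OF T_strip[OF cont_P2 e2]] supp'_T e2 by (metis order_less_le_trans)
  have bd: "\<bar>P1 (a, b)\<bar> \<le> K1 \<and> \<bar>P2 (a, b)\<bar> \<le> K2" if "b \<le> g a - e / 2" for a b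
    using K1(2)[of "(a, g a - b)"] K2(2)[of "(a, g a - b)"] that by simp
  \<comment> \<open>From this index on, the graph varies by at most L / Suc n \<le> e/2 over the
    increment.\<close>
  obtain n0 :: nat where n0: "2 * L / e < real n0" using reals_Archimedean2 by blast
  have "\<bar>real (Suc n) * (P (T (a + 1 / Suc n, t)) - P (T (a, t)))\<bar> \<le> K1 + K2 * L"
    if n: "n \<ge> n0" and t: "e \<le> t" for n a t
  proof -
    define k where "k = 1 / real (Suc n)"
    have k: "0 < k" by (simp add: k_def)
    have Lk: "L * k \<le> e / 2"
    proof -
      have "2 * L / e \<le> real (Suc n)" using n0 n by simp
      then show ?thesis using e by (simp add: k_def field_simps)
    qed
    define \<Delta> where "\<Delta> = g (a + k) - g a"
    have \<Delta>: "\<bar>\<Delta>\<bar> \<le> L * k" using g_diff[of "a + k" a] k by (simp add: \<Delta>_def)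
    define c where "c \<sigma> = (a + \<sigma> * k, g a - t + \<sigma> * \<Delta>)" for \<sigma> :: real
    \<comment> \<open>The chord can rise above the graph by at most 2 \<sigma> (1 - \<sigma>) L k,
      as averaging the comparisons with both end points shows; the cruder bound L k
      suffices.\<close>
    have inside: "g a - t + \<sigma> * \<Delta> \<le> g (a + \<sigma> * k) - e / 2" if "0 \<le> \<sigma>" "\<sigma> \<le> 1" for \<sigma>
    proof -
      have "\<bar>\<sigma> * k\<bar> = \<sigma> * k" using that k by simp
      then have A: "g a \<le> g (a + \<sigma> * k) + \<sigma> * (L * k)"
        using g_diff[of a "a + \<sigma> * k"] by (simp add: algebra_simps)
      have B: "g (a + k) \<le> g (a + \<sigma> * k) + (1 - \<sigma>) * (L * k)"
      proof -
        have "\<bar>a + k - (a + \<sigma> * k)\<bar> = (1 - \<sigma>) * k"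
          using that k by (subst abs_of_nonneg) (auto simp: algebra_simps mult_left_le_one_le)
        then show ?thesis using g_diff[of "a + k" "a + \<sigma> * k"] by (simp add: algebra_simps)
      qed
      have "g a + \<sigma> * \<Delta> = (1 - \<sigma>) * g a + \<sigma> * g (a + k)"
        by (simp add: \<Delta>_def algebra_simps)
      also have "\<dots> \<le> (1 - \<sigma>) * (g (a + \<sigma> * k) + \<sigma> * (L * k)) + \<sigma> * (g (a + \<sigma> * k) + (1 - \<sigma>) * (L * k))"
        using A B that by (intro add_mono mult_left_mono) auto
      also have "\<dots> = g (a + \<sigma> * k) + (2 * (\<sigma> * (1 - \<sigma>))) * (L * k)"
        by (simp add: algebra_simps)
      also have "\<dots> \<le> g (a + \<sigma> * k) + 1 * (L * k)"
      proof (intro add_left_mono mult_right_mono)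
        have "0 \<le> (1 - 2 * \<sigma>)\<^sup>2" by simp
        then have "\<sigma> * (1 - \<sigma>) * 4 \<le> 1" by (simp add: power2_eq_square algebra_simps)
        then show "2 * (\<sigma> * (1 - \<sigma>)) \<le> 1" by linarith
      qed (use L0 k in simp)
      finally show ?thesis using Lk t by simp
    qed
    have der: "((\<lambda>\<sigma>. P (c \<sigma>)) has_real_derivative (P1 (c \<sigma>) * k + P2 (c \<sigma>) * \<Delta>)) (at \<sigma>)"
      if "0 \<le> \<sigma>" "\<sigma> \<le> 1" for \<sigma>
    proof -
      have "g a - t + \<sigma> * \<Delta> < g (a + \<sigma> * k)" using inside[OF that] e by simp
      from P_deriv[OF this]
      have 1: "(P has_derivative (\<lambda>v. P1 (c \<sigma>) * fst v + P2 (c \<sigma>) * snd v)) (at (c \<sigma>))"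
        by (simp add: c_def)
      have 2: "(c has_derivative (\<lambda>h. (h * k, h * \<Delta>))) (at \<sigma>)"
        unfolding c_def by (auto intro!: derivative_eq_intros)
      from diff_chain_at[OF 2 1] show ?thesis
        unfolding has_field_derivative_def o_def
        by (rule has_derivative_eq_rhs) (auto simp: algebra_simps)
    qed
    obtain \<sigma> where \<sigma>: "0 < \<sigma>" "\<sigma> < 1" "P (c 1) - P (c 0) = (1 - 0) * (P1 (c \<sigma>) * k + P2 (c \<sigma>) * \<Delta>)"
      using MVT2[of 0 1 "\<lambda>\<sigma>. P (c \<sigma>)" "\<lambda>\<sigma>. P1 (c \<sigma>) * k + P2 (c \<sigma>) * \<Delta>"] der by auto
    have "\<bar>P1 (c \<sigma>)\<bar> \<le> K1" "\<bar>P2 (c \<sigma>)\<bar> \<le> K2"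
      using bd[of "g a - t + \<sigma> * \<Delta>" "a + \<sigma> * k"] inside[of \<sigma>] \<sigma> by (auto simp: c_def)
    then have "\<bar>P1 (c \<sigma>) * k + P2 (c \<sigma>) * \<Delta>\<bar> \<le> K1 * k + K2 * (L * k)"
      using k \<Delta> K1(1) K2(1)
      by (intro order_trans[OF abs_triangle_ineq] add_mono) (auto simp: abs_mult intro!: mult_mono)
    then have "\<bar>P (c 1) - P (c 0)\<bar> \<le> (K1 + K2 * L) * k"
      using \<sigma>(3) by (simp add: algebra_simps)
    moreover have "c 1 = T (a + k, t)" "c 0 = T (a, t)" by (simp_all add: c_def \<Delta>_def)
    ultimately have "\<bar>P (T (a + k, t)) - P (T (a, t))\<bar> \<le> (K1 + K2 * L) * k" by simp
    then show ?thesis unfolding k_def 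
      by (simp only: abs_mult abs_of_nat) (simp add: field_simps del: T_simp of_nat_Suc)
  qed
  then show ?thesis by blast
qed

lemma horizontal_quotient_limit:
  assumes "0 < t" and "(g has_real_derivative m) (at a)"
  shows "(\<lambda>n. real (Suc n) * (P (T (a + 1 / Suc n, t)) - P (T (a, t))))
           \<longlonglongrightarrow> P1 (T (a, t)) + m * P2 (T (a, t))"
proof -
  have 1: "(P has_derivative (\<lambda>v. P1 (T (a, t)) * fst v + P2 (T (a, t)) * snd v)) (at (T (a, t)))"
    using P_deriv[of "g a - t" a] assms(1) by simp
  have 2: "((\<lambda>a. T (a, t)) has_derivative (\<lambda>h. (h, m * h))) (at a)"
    using assms(2) unfolding T_simp has_field_derivative_def
    by (auto intro!: derivative_eq_intros)
  from diff_chain_at[OF 2 1]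
  have "((\<lambda>a. P (T (a, t))) has_real_derivative (P1 (T (a, t)) + m * P2 (T (a, t)))) (at a)"
    unfolding has_field_derivative_def o_def
    by (rule has_derivative_eq_rhs) (auto simp: algebra_simps)
  from DERIV_imp_quotient_limit[OF this] show ?thesis .
qed

lemma upper_strip_measurable [measurable]: "{z :: real \<times> real. c \<le> snd z} \<in> sets borel"
  and upper_strip_measurable' [measurable]: "{z :: real \<times> real. c < snd z} \<in> sets borel"
  by (intro borel_closed borel_open closed_Collect_le open_Collect_less continuous_intros)+

text \<open>Almost everywhere the integrand is the derivative of \<open>P (T (a, t))\<close> in
  \<open>a\<close>. Each difference quotient in \<open>a\<close> has integral zero because Lebesgue
  measure is invariant under translation, and the uniform bound on the quotients lets dominated
  convergence pass to the limit.\<close>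

lemma integral_horizontal_derivative:
  assumes e: "0 < e"
  shows "(LINT z|lborel. indicator {z. e \<le> snd z} z * (P1 (T z) + G (fst z) * P2 (T z))) = 0"
proof -
  let ?i = "indicator {z. e \<le> snd z} :: real \<times> real \<Rightarrow> real"
  have cP: "continuous_on {z. e \<le> snd z} (\<lambda>z. P (T z))"
    by (rule continuous_on_subset[OF T_strip0[OF cont_P]]) (use e in auto)
  have sP: "P (T (a, t)) = 0" if "e \<le> t" "M \<le> \<bar>a\<bar> \<or> N \<le> t" for a t
    using supp_T[of t a] that e by linarith
  have intP: "integrable lborel (\<lambda>z. ?i z * P (T z))"
    using strips(1)[OF cP sP] .
  have iP1: "integrable lborel (\<lambda>z. ?i z * P1 (T z))"
    using e supp'_T by (intro strips(1)[OF T_strip[OF cont_P1 e]]) (meson order_less_le_trans)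
  have iP2: "integrable lborel (\<lambda>z. ?i z * P2 (T z))"
    using e supp'_T by (intro strips(1)[OF T_strip[OF cont_P2 e]]) (meson order_less_le_trans)
  define h where "h n z = ?i z * (real (Suc n) * (P (T (fst z + 1 / Suc n, snd z)) - P (T z)))" for n z
  have shift: "integrable lborel (\<lambda>z. ?i z * P (T (fst z + k, snd z)))"
    and shift_eq: "(LINT z|lborel. ?i z * P (T (fst z + k, snd z))) = (LINT z|lborel. ?i z * P (T z))" for k
  proof -
    have eq: "?i z * P (T (fst z + k, snd z)) = (\<lambda>z. ?i z * P (T z)) ((k, 0) + z)" for z
      by (cases z) (simp add: indicator_def add.commute)
    have i: "integrable (distr lborel borel ((+) (k, 0))) (\<lambda>z. ?i z * P (T z))"
      unfolding lborel_distr_plus by (rule intP)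
    show "integrable lborel (\<lambda>z. ?i z * P (T (fst z + k, snd z)))"
      unfolding eq by (rule integrable_distr[OF _ i]) simp
    have m: "(\<lambda>z. ?i z * P (T z)) \<in> borel_measurable borel"
      using borel_measurable_integrable[OF intP] by simp
    have "(LINT z|lborel. (\<lambda>z. ?i z * P (T z)) ((k, 0) + z))
        = (LINT z|distr lborel borel ((+) (k, 0)). ?i z * P (T z))"
      by (rule integral_distr[symmetric]) (use m in simp_all)
    then show "(LINT z|lborel. ?i z * P (T (fst z + k, snd z))) = (LINT z|lborel. ?i z * P (T z))"
      unfolding eq lborel_distr_plus .
  qed
  have h_eq: "h n = (\<lambda>z. real (Suc n) * (?i z * P (T (fst z + 1 / Suc n, snd z)) - ?i z * P (T z)))" for n
    unfolding h_def by (simp add: fun_eq_iff algebra_simps del: of_nat_Suc)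
  have h_int: "integrable lborel (h n)" for n
    unfolding h_eq by (intro integrable_mult_right Bochner_Integration.integrable_diff shift intP)
  have h0: "(LINT z|lborel. h n z) = 0" for n
    unfolding h_eq
    by (simp only: integral_mult_right_zero Bochner_Integration.integral_diff[OF shift intP] shift_eq diff_self mult_zero_right)
  obtain K n0 where K: "\<And>n a t. n \<ge> n0 \<Longrightarrow> e \<le> t \<Longrightarrow>
    \<bar>real (Suc n) * (P (T (a + 1 / Suc n, t)) - P (T (a, t)))\<bar> \<le> K"
    using horizontal_quotient_bound[OF e] by blast
  have "K \<ge> 0" using K[of n0 e 0] e by (meson abs_ge_zero order_refl order_trans)
  \<comment> \<open>One unit wider than the support, so as to contain it after a shift of at most
    1.\<close>
  let ?B = "cbox (-(M + 1), e) (M + 1, N)"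
  have hB: "norm (h (n + n0) z) \<le> K * indicator ?B z" for n z
  proof (cases z)
    case (Pair a t)
    show ?thesis
    proof (cases "e \<le> t \<and> \<not> (M + 1 \<le> \<bar>a\<bar> \<or> N \<le> t)")
      case True
      then have "z \<in> ?B" using Pair by (auto simp: abs_less_iff)
      then show ?thesis using K[of "n + n0" t a] True Pair by (simp add: h_def del: of_nat_Suc T_simp)
    next
      case False
      have k: "0 < 1 / real (Suc (n + n0))" "1 / real (Suc (n + n0)) \<le> 1" by auto
      have "h (n + n0) z = 0"
      proof (cases "e \<le> t")
        case True
        with False have "M + 1 \<le> \<bar>a\<bar> \<or> N \<le> t" by simp
        with k have "M \<le> \<bar>a\<bar> \<or> N \<le> t" "M \<le> \<bar>a + 1 / real (Suc (n + n0))\<bar> \<or> N \<le> t" by linarith+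
        from this[THEN sP[OF True]] show ?thesis
          unfolding h_def Pair by (simp del: T_simp of_nat_Suc)
      next
        case False
        then show ?thesis by (simp add: h_def Pair)
      qed
      then show ?thesis using \<open>K \<ge> 0\<close> by simp
    qed
  qed
  have "(\<lambda>n. LINT z|lborel. h (n + n0) z) \<longlonglongrightarrow>
      (LINT z|lborel. ?i z * (P1 (T z) + G (fst z) * P2 (T z)))"
  proof (rule integral_dominated_convergence)
    have "(\<lambda>z. G (fst z)) \<in> borel_measurable (lborel :: (real \<times> real) measure)"
      by (intro measurable_compose[OF _ G_meas]) (simp add: borel_prod[symmetric])
    from borel_measurable_add[OF borel_measurable_integrable[OF iP1]
        borel_measurable_times[OF this borel_measurable_integrable[OF iP2]]]
    have "(\<lambda>z. ?i z * P1 (T z) + G (fst z) * (?i z * P2 (T z))) \<in> borel_measurable lborel" .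
    moreover have "(\<lambda>z. ?i z * (P1 (T z) + G (fst z) * P2 (T z)))
        = (\<lambda>z. ?i z * P1 (T z) + G (fst z) * (?i z * P2 (T z)))"
      by (simp add: fun_eq_iff algebra_simps)
    ultimately show "(\<lambda>z. ?i z * (P1 (T z) + G (fst z) * P2 (T z))) \<in> borel_measurable lborel"
      by (simp only:)
    show "h (n + n0) \<in> borel_measurable lborel" for n using h_int by auto
    show "integrable lborel (\<lambda>z. K * indicator ?B z)"
      by (intro integrable_mult_right integrable_real_indicator) (simp, rule emeasure_lborel_cbox_finite)
    show "AE z in lborel. (\<lambda>n. h (n + n0) z) \<longlonglongrightarrow> ?i z * (P1 (T z) + G (fst z) * P2 (T z))"
      using AE_lborel_fst[OF G_deriv]
    proof (rule AE_mp, intro AE_I2 impI)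
      fix z :: "real \<times> real"
      assume D: "(g has_real_derivative G (fst z)) (at (fst z)) \<and> \<bar>G (fst z)\<bar> \<le> L"
      show "(\<lambda>n. h (n + n0) z) \<longlonglongrightarrow> ?i z * (P1 (T z) + G (fst z) * P2 (T z))"
      proof (cases "e \<le> snd z")
        case True
        have "(\<lambda>n. h n z) \<longlonglongrightarrow> ?i z * (P1 (T z) + G (fst z) * P2 (T z))"
          unfolding h_def
          using horizontal_quotient_limit[of "snd z" "G (fst z)" "fst z"] D True e
          by (intro tendsto_mult_left) (simp del: T_simp of_nat_Suc)
        then show ?thesis by (rule LIMSEQ_ignore_initial_segment)
      qed (simp add: h_def)
    qed
    show "AE z in lborel. norm (h (n + n0) z) \<le> K * indicator ?B z" for n
      by (intro AE_I2 hB)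
  qed
  then have "(\<lambda>n. 0 :: real) \<longlonglongrightarrow> (LINT z|lborel. ?i z * (P1 (T z) + G (fst z) * P2 (T z)))"
    by (simp only: h0)
  then show ?thesis using LIMSEQ_unique tendsto_const by blast
qed

text \<open>At depth at least \<open>e\<close> the three derivatives are integrable separately. The
  vanishing horizontal derivative trades \<open>P1\<close> for - g' \<open>P2\<close>; then only
  vertical derivatives remain, and integrating them along vertical lines leaves the flux through
  depth \<open>e\<close>.\<close>

lemma integral_divergence_strip:
  assumes e: "0 < e"
  shows "(LINT z|lborel. indicator {z. e \<le> snd z} z * (P1 (T z) + R2 (T z))) =
         (LINT a|lborel. R (T (a, e)) - G a * P (T (a, e)))"
proof -
  let ?i = "indicator {z. e \<le> snd z} :: real \<times> real \<Rightarrow> real"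
  have iP1: "integrable lborel (\<lambda>z. ?i z * P1 (T z))"
    using e supp'_T by (intro strips(1)[OF T_strip[OF cont_P1 e]]) (meson order_less_le_trans)
  have iP2: "integrable lborel (\<lambda>z. ?i z * P2 (T z))"
    using e supp'_T by (intro strips(1)[OF T_strip[OF cont_P2 e]]) (meson order_less_le_trans)
  have iR2: "integrable lborel (\<lambda>z. ?i z * R2 (T z))"
    using e supp'_T by (intro strips(1)[OF T_strip[OF cont_R2 e]]) (meson order_less_le_trans)
  have mG: "(\<lambda>z. G (fst z)) \<in> borel_measurable (lborel :: (real \<times> real) measure)"
    by (intro measurable_compose[OF _ G_meas]) (simp add: borel_prod[symmetric])
  have iGP2: "integrable lborel (\<lambda>z. G (fst z) * (?i z * P2 (T z)))"
  proof (rule Bochner_Integration.integrable_bound[OF integrable_mult_right[OF iP2, of L]])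
    show "(\<lambda>z. G (fst z) * (?i z * P2 (T z))) \<in> borel_measurable lborel"
      using mG borel_measurable_integrable[OF iP2] by (rule borel_measurable_times)
    show "AE z in lborel. norm (G (fst z) * (?i z * P2 (T z))) \<le> norm (L * (?i z * P2 (T z)))"
      using AE_lborel_fst[OF G_deriv]
      by (rule AE_mp) (use L0 in \<open>auto intro!: AE_I2 mult_right_mono simp: abs_mult\<close>)
  qed
  have "(LINT z|lborel. ?i z * (P1 (T z) + R2 (T z)))
      = (LINT z|lborel. ?i z * P1 (T z)) + (LINT z|lborel. ?i z * R2 (T z))"
    by (simp add: distrib_left Bochner_Integration.integral_add[OF iP1 iR2])
  also have "(LINT z|lborel. ?i z * P1 (T z)) = - (LINT z|lborel. G (fst z) * (?i z * P2 (T z)))"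
  proof -
    have "(LINT z|lborel. ?i z * (P1 (T z) + G (fst z) * P2 (T z)))
        = (LINT z|lborel. ?i z * P1 (T z) + G (fst z) * (?i z * P2 (T z)))"
      by (simp add: algebra_simps)
    with integral_horizontal_derivative[OF e] Bochner_Integration.integral_add[OF iP1 iGP2]
    show ?thesis by linarith
  qed
  also have "- (LINT z|lborel. G (fst z) * (?i z * P2 (T z))) + (LINT z|lborel. ?i z * R2 (T z))
      = (LINT z|lborel. ?i z * R2 (T z) - G (fst z) * (?i z * P2 (T z)))"
    by (simp add: Bochner_Integration.integral_diff[OF iR2 iGP2])
  also have "\<dots> = (LINT a|lborel. LINT t|lborel. ?i (a, t) * R2 (T (a, t)) - G (fst (a, t)) * (?i (a, t) * P2 (T (a, t))))"
    using lborel_pair.integral_fst'[of "\<lambda>z. ?i z * R2 (T z) - G (fst z) * (?i z * P2 (T z))"]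
      Bochner_Integration.integrable_diff[OF iR2 iGP2]
    by (simp add: lborel_prod)
  also have "\<dots> = (LINT a|lborel. R (T (a, e)) - G a * P (T (a, e)))"
  proof (rule integral_cong_AE)
    have "AE a in lborel. integrable lborel (\<lambda>t. ?i (a, t) * R2 (T (a, t)))"
      using lborel_pair.AE_integrable_fst'[of "\<lambda>z. ?i z * R2 (T z)"] iR2 by (simp add: lborel_prod)
    moreover have "AE a in lborel. integrable lborel (\<lambda>t. ?i (a, t) * P2 (T (a, t)))"
      using lborel_pair.AE_integrable_fst'[of "\<lambda>z. ?i z * P2 (T z)"] iP2 by (simp add: lborel_prod)
    ultimately show "AE a in lborel. (LINT t|lborel. ?i (a, t) * R2 (T (a, t)) - G (fst (a, t)) * (?i (a, t) * P2 (T (a, t))))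
        = R (T (a, e)) - G a * P (T (a, e))"
    proof eventually_elim
      case (elim a)
      have ind: "?i (a, t) = indicator {e..} t" for t by (simp add: indicator_def)
      have 1: "(LINT t|lborel. ?i (a, t) * R2 (T (a, t))) = R (T (a, e))"
        unfolding ind T_simp
      proof (rule vertical_integral[OF e])
        show "continuous_on {..<g a} (\<lambda>b. R2 (a, b))"
          by (rule continuous_on_compose2[OF cont_R2]) (auto intro!: continuous_intros)
        show "((\<lambda>b. R (a, b)) has_real_derivative R2 (a, b)) (at b)" if "b < g a" for b
          using R_deriv[OF that] .
        show "R (a, g a - t) = 0 \<and> R2 (a, g a - t) = 0" if "0 < t" "N \<le> t" for t
          using supp_T[of t a] supp'_T[of t a] that by simp
      qed
      have 2: "(LINT t|lborel. ?i (a, t) * P2 (T (a, t))) = P (T (a, e))"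
        unfolding ind T_simp
      proof (rule vertical_integral[OF e])
        show "continuous_on {..<g a} (\<lambda>b. P2 (a, b))"
          by (rule continuous_on_compose2[OF cont_P2]) (auto intro!: continuous_intros)
        show "((\<lambda>b. P (a, b)) has_real_derivative P2 (a, b)) (at b)" if "b < g a" for b
        proof -
          have "((\<lambda>b. (a, b)) has_derivative (\<lambda>h. (0, h))) (at b)"
            by (auto intro!: derivative_eq_intros)
          from diff_chain_at[OF this P_deriv[OF that]] show ?thesis
            unfolding has_field_derivative_def o_def
            by (rule has_derivative_eq_rhs) (auto simp: algebra_simps)
        qed
        show "P (a, g a - t) = 0 \<and> P2 (a, g a - t) = 0" if "0 < t" "N \<le> t" for t
          using supp_T[of t a] supp'_T[of t a] that by simp
      qed
      have "(LINT t|lborel. ?i (a, t) * R2 (T (a, t)) - G a * (?i (a, t) * P2 (T (a, t))))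
          = R (T (a, e)) - G a * P (T (a, e))"
        using elim by (simp only: Bochner_Integration.integral_diff integrable_mult_right
            integral_mult_right_zero 1 2)
      then show ?case by simp
    qed
    show "(\<lambda>a. LINT t|lborel. ?i (a, t) * R2 (T (a, t)) - G (fst (a, t)) * (?i (a, t) * P2 (T (a, t)))) \<in> borel_measurable lborel"
      using lborel_pair.integrable_fst'[of "\<lambda>z. ?i z * R2 (T z) - G (fst z) * (?i z * P2 (T z))"]
        Bochner_Integration.integrable_diff[OF iR2 iGP2]
      by (auto simp only: lborel_prod intro!: borel_measurable_integrable)
    have "continuous_on UNIV (\<lambda>a. R (T (a, e)))" "continuous_on UNIV (\<lambda>a. P (T (a, e)))"
      using e by (auto intro!: continuous_on_compose2[OF T_strip0[OF cont_R]]
        continuous_on_compose2[OF T_strip0[OF cont_P]] continuous_intros simp del: T_simp)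
    then show "(\<lambda>a. R (T (a, e)) - G a * P (T (a, e))) \<in> borel_measurable lborel"
      by (intro borel_measurable_diff borel_measurable_times) (auto intro: borel_measurable_continuous_onI simp del: T_simp)
  qed
  finally show ?thesis .
qed

text \<open>The strip identity passes to the limit on both sides. On the left
  \<open>bounded_div\<close> dominates the sum, although its summands may be unbounded. On the right
  the flux density is bounded by continuity of the field and converges to the trace, which is zero
  wherever \<open>g\<close> is differentiable.\<close>

theorem integral_divergence_zero:
  "(LINT z|lborel. indicator {z. 0 < snd z} z * (P1 (T z) + R2 (T z))) = 0"
proof -
  let ?e = "\<lambda>n. 1 / real (Suc n)"
  have e0: "?e \<longlonglongrightarrow> 0" using LIMSEQ_Suc[OF lim_1_over_n[where 'a = real]] .
  have contd: "continuous_on {z. 0 < snd z} (\<lambda>z. P1 (T z) + R2 (T z))"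
    by (intro continuous_on_add continuous_on_compose2[OF cont_P1 cont_T]
        continuous_on_compose2[OF cont_R2 cont_T]) (auto simp: T_def)
  have m0: "(\<lambda>z. indicator {z. 0 < snd z} z * (P1 (T z) + R2 (T z))) \<in> borel_measurable lborel"
    using borel_measurable_continuous_on_indicator[OF upper_strip_measurable' contd] by simp
  have C0: "0 \<le> C" using bounded_div[of "g 0 - 1" 0] by linarith
  let ?B = "cbox (-M, 0) (M, N)"
  have bnd: "\<bar>P1 (T z) + R2 (T z)\<bar> \<le> C * indicator ?B z" if "0 < snd z" for z
  proof (cases z)
    case (Pair a t)
    show ?thesis
    proof (cases "M \<le> \<bar>a\<bar> \<or> N \<le> t")
      case True
      then show ?thesis using supp'_T[of t a] that C0 Pair by simp
    next
      case False
      then have "z \<in> ?B" using that Pair by (auto simp: abs_less_iff)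
      then show ?thesis using bounded_div[of "g a - t" a] that Pair by simp
    qed
  qed
  have "(\<lambda>n. LINT z|lborel. indicator {z. ?e n \<le> snd z} z * (P1 (T z) + R2 (T z))) \<longlonglongrightarrow>
    (LINT z|lborel. indicator {z. 0 < snd z} z * (P1 (T z) + R2 (T z)))"
  proof (rule integral_dominated_convergence[OF m0])
    show "(\<lambda>z. indicator {z. ?e n \<le> snd z} z * (P1 (T z) + R2 (T z))) \<in> borel_measurable lborel" for n
    proof -
      have "{z :: real \<times> real. ?e n \<le> snd z} \<subseteq> {z. 0 < snd z}"
      proof safe
        fix a b :: real assume "?e n \<le> snd (a, b)"
        moreover have "0 < ?e n" by simp
        ultimately show "0 < snd (a, b)" by linarith
      qed
      from borel_measurable_continuous_on_indicator[OF upper_strip_measurable continuous_on_subset[OF contd this]]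
      show ?thesis by simp
    qed
    show "integrable lborel (\<lambda>z. C * indicator ?B z)"
      by (intro integrable_mult_right integrable_real_indicator) (simp, rule emeasure_lborel_cbox_finite)
    show "AE z in lborel. (\<lambda>n. indicator {z. ?e n \<le> snd z} z * (P1 (T z) + R2 (T z))) \<longlonglongrightarrow>
        indicator {z. 0 < snd z} z * (P1 (T z) + R2 (T z))"
    proof (intro AE_I2 tendsto_mult_right)
      fix z :: "real \<times> real"
      show "(\<lambda>n. indicator {z. ?e n \<le> snd z} z :: real) \<longlonglongrightarrow> indicator {z. 0 < snd z} z"
      proof (cases "0 < snd z")
        case True
        have "\<forall>\<^sub>F n in sequentially. ?e n < snd z" using e0 True by (rule order_tendstoD)
        then have "\<forall>\<^sub>F n in sequentially. indicator {z. ?e n \<le> snd z} z = (indicator {z. 0 < snd z} z :: real)"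
          by eventually_elim (use True in \<open>simp add: indicator_def\<close>)
        then show ?thesis by (rule tendsto_eventually)
      next
        case False
        then have "\<not> ?e n \<le> snd z" for n by (smt (verit) divide_pos_pos of_nat_0_less_iff zero_less_Suc)
        then show ?thesis using False by simp
      qed
    qed
    show "AE z in lborel. norm (indicator {z. ?e n \<le> snd z} z * (P1 (T z) + R2 (T z))) \<le> C * indicator ?B z" for n
    proof (intro AE_I2)
      fix z :: "real \<times> real"
      have "0 < ?e n" by simp
      show "norm (indicator {z. ?e n \<le> snd z} z * (P1 (T z) + R2 (T z))) \<le> C * indicator ?B z"
      proof (cases "?e n \<le> snd z")
        case True
        with \<open>0 < ?e n\<close> have "0 < snd z" by linarith
        from bnd[OF this] True show ?thesis by simp
      next
        case False
        then show ?thesis using C0 by simp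
      qed
    qed
  qed
  moreover have "(LINT z|lborel. indicator {z. ?e n \<le> snd z} z * (P1 (T z) + R2 (T z)))
      = (LINT a|lborel. R (T (a, ?e n)) - G a * P (T (a, ?e n)))" for n
    by (rule integral_divergence_strip) simp
  moreover have "(\<lambda>n. LINT a|lborel. R (T (a, ?e n)) - G a * P (T (a, ?e n))) \<longlonglongrightarrow> (LINT (a::real)|lborel. 0)"
  proof -
    obtain KP where KP: "KP \<ge> 0" "\<And>z. 0 \<le> snd z \<Longrightarrow> \<bar>P (T z)\<bar> \<le> KP"
      using strips(2)[OF T_strip0[OF cont_P]] supp_T by metis
    obtain KR where KR: "KR \<ge> 0" "\<And>z. 0 \<le> snd z \<Longrightarrow> \<bar>R (T z)\<bar> \<le> KR"
      using strips(2)[OF T_strip0[OF cont_R]] supp_T by metis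
    show ?thesis
    proof (rule integral_dominated_convergence)
      show "(\<lambda>a. R (T (a, ?e n)) - G a * P (T (a, ?e n))) \<in> borel_measurable lborel" for n
      proof -
        have "continuous_on UNIV (\<lambda>a. R (T (a, ?e n)))" "continuous_on UNIV (\<lambda>a. P (T (a, ?e n)))"
          by (auto intro!: continuous_on_compose2[OF T_strip0[OF cont_R]]
            continuous_on_compose2[OF T_strip0[OF cont_P]] continuous_intros simp del: T_simp)
        then show ?thesis
          by (intro borel_measurable_diff borel_measurable_times) (auto intro: borel_measurable_continuous_onI simp del: T_simp)
      qed
      show "integrable lborel (\<lambda>a. (KR + L * KP) * indicator {-M..M} a)"
        by (intro integrable_mult_right integrable_real_indicator) (auto simp: M0)
      show "AE a in lborel. (\<lambda>n. R (T (a, ?e n)) - G a * P (T (a, ?e n))) \<longlonglongrightarrow> 0"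
        using G_deriv
      proof (rule AE_mp, intro AE_I2 impI)
        fix a assume D: "(g has_real_derivative G a) (at a) \<and> \<bar>G a\<bar> \<le> L"
        have l: "(\<lambda>n. \<psi> (T (a, ?e n))) \<longlonglongrightarrow> \<psi> (T (a, 0))"
          if "continuous_on {z. snd z \<le> g (fst z)} \<psi>" for \<psi> :: "real \<times> real \<Rightarrow> real"
        proof (rule continuous_on_tendsto_compose[OF T_strip0[OF that]])
          show "(\<lambda>n. (a, ?e n)) \<longlonglongrightarrow> (a, 0)" by (intro tendsto_intros e0)
        qed auto
        have "(\<lambda>n. R (T (a, ?e n)) - G a * P (T (a, ?e n))) \<longlonglongrightarrow> R (T (a, 0)) - G a * P (T (a, 0))"
          by (intro tendsto_intros l cont_P cont_R)
        then show "(\<lambda>n. R (T (a, ?e n)) - G a * P (T (a, ?e n))) \<longlonglongrightarrow> 0"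
          using trace[of "G a" a] D by simp
      qed
      show "AE a in lborel. norm (R (T (a, ?e n)) - G a * P (T (a, ?e n))) \<le> (KR + L * KP) * indicator {-M..M} a" for n
        using G_deriv
      proof (rule AE_mp, intro AE_I2 impI)
        fix a assume D: "(g has_real_derivative G a) (at a) \<and> \<bar>G a\<bar> \<le> L"
        show "norm (R (T (a, ?e n)) - G a * P (T (a, ?e n))) \<le> (KR + L * KP) * indicator {-M..M} a"
        proof (cases "M \<le> \<bar>a\<bar>")
          case True
          then show ?thesis using supp_T[of "?e n" a] KP KR L0 by (simp add: indicator_def)
        next
          case False
          have "\<bar>R (T (a, ?e n))\<bar> \<le> KR" by (rule KR(2)) simp
          moreover have "\<bar>G a * P (T (a, ?e n))\<bar> \<le> L * KP"
            unfolding abs_mult using D L0 KP by (intro mult_mono KP(2)) auto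
          ultimately have "\<bar>R (T (a, ?e n)) - G a * P (T (a, ?e n))\<bar> \<le> KR + L * KP" by linarith
          moreover have "a \<in> {-M..M}" using False by auto
          ultimately show ?thesis by simp
        qed
      qed
    qed simp
  qed
  ultimately have "(LINT z|lborel. indicator {z. 0 < snd z} z * (P1 (T z) + R2 (T z))) = (LINT (a::real)|lborel. 0)"
    by (simp only:) (rule LIMSEQ_unique)
  then show ?thesis by simp
qed

end

section \<open>Partial derivatives in the plane\<close>

lemma has_derivative_pd:
  fixes f :: "real^2 \<Rightarrow> 'a::real_normed_vector"
  assumes "f differentiable (at x)"
  shows "(f has_derivative (\<lambda>v. v $ 1 *\<^sub>R pd 1 f x + v $ 2 *\<^sub>R pd 2 f x)) (at x)"
proof -
  have D: "(f has_derivative frechet_derivative f (at x)) (at x)"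
    using assms by (simp add: frechet_derivative_works)
  then interpret D: linear "frechet_derivative f (at x)"
    by (rule has_derivative_linear)
  have eq: "frechet_derivative f (at x) = (\<lambda>v. v $ 1 *\<^sub>R pd 1 f x + v $ 2 *\<^sub>R pd 2 f x)"
  proof
    fix v :: "real^2"
    have "v = v $ 1 *\<^sub>R axis 1 1 + v $ 2 *\<^sub>R axis 2 1"
      by (simp add: vec_eq_iff forall_2 axis_def)
    then show "frechet_derivative f (at x) v = v $ 1 *\<^sub>R pd 1 f x + v $ 2 *\<^sub>R pd 2 f x"
      by (metis D.add D.scale pd_def)
  qed
  show ?thesis using D unfolding eq .
qed

lemma pd_eqI:
  assumes "(f has_derivative f') (at x)"
  shows "pd i f x = f' (axis i 1)"
  unfolding pd_def using frechet_derivative_at[OF assms] by simp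

lemma C1_onI:
  assumes "\<And>x. x \<in> \<Omega> \<Longrightarrow> (f has_derivative f' x) (at x)"
    and "\<And>i. continuous_on \<Omega> (\<lambda>x. f' x (axis i 1))"
  shows "C1_on \<Omega> f"
  unfolding C1_on_def
proof (intro conjI ballI allI)
  show "f differentiable at x" if "x \<in> \<Omega>" for x
    using assms(1)[OF that] by (rule differentiableI)
  show "continuous_on \<Omega> (pd i f)" for i
    by (rule continuous_on_eq[OF assms(2)]) (simp add: pd_eqI[OF assms(1)])
qed

lemma C1_on_has_derivative:
  assumes "C1_on \<Omega> f" and "x \<in> \<Omega>"
  shows "(f has_derivative (\<lambda>v. v $ 1 *\<^sub>R pd 1 f x + v $ 2 *\<^sub>R pd 2 f x)) (at x)"
  using assms has_derivative_pd unfolding C1_on_def by blast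

lemma C1_on_pd_continuous: "C1_on \<Omega> f \<Longrightarrow> continuous_on \<Omega> (pd i f)"
  by (simp add: C1_on_def)

lemma C1_on_continuous: "C1_on \<Omega> f \<Longrightarrow> continuous_on \<Omega> f"
  unfolding C1_on_def
  by (meson continuous_at_imp_continuous_on differentiable_imp_continuous_within)

lemma axis_2_simps [simp]:
  "axis (1::2) (1::real) $ 1 = 1" "axis (1::2) (1::real) $ 2 = 0"
  "axis (2::2) (1::real) $ 1 = 0" "axis (2::2) (1::real) $ 2 = 1"
  by (simp_all add: axis_def)

lemma pd_linear:
  assumes "bounded_linear h" and "f differentiable (at x)"
  shows "pd i (\<lambda>x. h (f x)) x = h (pd i f x)"
  using pd_eqI[OF bounded_linear.has_derivative[OF assms(1) assms(2)[unfolded frechet_derivative_works]]]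
  by (simp add: pd_def)

lemma C1_on_linear:
  assumes "bounded_linear h" and "C1_on \<Omega> f"
  shows "C1_on \<Omega> (\<lambda>x. h (f x))"
  by (rule C1_onI[OF bounded_linear.has_derivative[OF assms(1) C1_on_has_derivative[OF assms(2)]]])
    (auto intro!: continuous_intros bounded_linear.continuous_on[OF assms(1)] C1_on_pd_continuous[OF assms(2)])

lemma pd_diff:
  assumes "f differentiable (at x)" and "g differentiable (at x)"
  shows "pd i (\<lambda>x. f x - g x) x = pd i f x - pd i g x"
  using pd_eqI[OF has_derivative_diff[OF assms[unfolded frechet_derivative_works]]]
  by (simp add: pd_def)

lemma C1_on_add:
  assumes "C1_on \<Omega> f" and "C1_on \<Omega> g"
  shows "C1_on \<Omega> (\<lambda>x. f x + g x)"
  by (rule C1_onI[OF has_derivative_add[OF C1_on_has_derivative[OF assms(1)] C1_on_has_derivative[OF assms(2)]]])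
    (auto intro!: continuous_intros C1_on_pd_continuous assms)

lemma C1_on_diff:
  assumes "C1_on \<Omega> f" and "C1_on \<Omega> g"
  shows "C1_on \<Omega> (\<lambda>x. f x - g x)"
  by (rule C1_onI[OF has_derivative_diff[OF C1_on_has_derivative[OF assms(1)] C1_on_has_derivative[OF assms(2)]]])
    (auto intro!: continuous_intros C1_on_pd_continuous assms)

lemma pd_bilinear:
  assumes "bounded_bilinear h" and "f differentiable (at x)" and "g differentiable (at x)"
  shows "pd i (\<lambda>x. h (f x) (g x)) x = h (f x) (pd i g x) + h (pd i f x) (g x)"
  using pd_eqI[OF bounded_bilinear.FDERIV[OF assms(1) assms(2,3)[unfolded frechet_derivative_works]]]
  by (simp add: pd_def)

lemma C1_on_bilinear:
  assumes "bounded_bilinear h" and f: "C1_on \<Omega> f" and g: "C1_on \<Omega> g"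
  shows "C1_on \<Omega> (\<lambda>x. h (f x) (g x))"
  by (rule C1_onI[OF bounded_bilinear.FDERIV[OF assms(1) C1_on_has_derivative[OF f] C1_on_has_derivative[OF g]]])
    (auto intro!: continuous_on_add continuous_on_scaleR continuous_on_const
      bounded_bilinear.continuous_on[OF assms(1)]
      C1_on_pd_continuous[OF f] C1_on_pd_continuous[OF g] C1_on_continuous[OF f] C1_on_continuous[OF g])

lemma pd_cong:
  assumes "open \<Omega>" and "x \<in> \<Omega>" and eq: "\<And>y. y \<in> \<Omega> \<Longrightarrow> f y = g y"
  shows "pd i f x = pd i g x"
proof -
  have "(f has_derivative D) (at x) = (g has_derivative D) (at x)" for D
  proof
    show "(g has_derivative D) (at x)" if "(f has_derivative D) (at x)"
      using has_derivative_transform_within_open[OF that assms(1,2)] eq .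
    show "(f has_derivative D) (at x)" if "(g has_derivative D) (at x)"
      using has_derivative_transform_within_open[OF that assms(1,2)] eq[symmetric] .
  qed
  then show ?thesis by (simp add: pd_def frechet_derivative_def)
qed

lemma C1_on_transform:
  assumes "C1_on \<Omega> f" and "open \<Omega>" and eq: "\<And>y. y \<in> \<Omega> \<Longrightarrow> f y = g y"
  shows "C1_on \<Omega> g"
proof (rule C1_onI)
  show "(g has_derivative (\<lambda>v. v $ 1 *\<^sub>R pd 1 f x + v $ 2 *\<^sub>R pd 2 f x)) (at x)" if "x \<in> \<Omega>" for x
    using has_derivative_transform_within_open[OF C1_on_has_derivative[OF assms(1) that] assms(2) that] eq .
qed (intro continuous_on_add continuous_on_scaleR continuous_on_const C1_on_pd_continuous assms(1))

lemma divergence_cong: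
  assumes "open \<Omega>" and "x \<in> \<Omega>" and "\<And>y. y \<in> \<Omega> \<Longrightarrow> f y = g y"
  shows "divergence f x = divergence g x"
  unfolding divergence_def using pd_cong[OF assms] by simp

lemma divergence_continuous: "C1_on \<Omega> f \<Longrightarrow> continuous_on \<Omega> (divergence f)"
  unfolding divergence_def by (intro continuous_intros C1_on_pd_continuous)

lemma pd_nth: "f differentiable (at x) \<Longrightarrow> pd i (\<lambda>x. f x $ j) x = pd i f x $ j"
  by (rule pd_linear[OF bounded_linear_vec_nth])

section \<open>The divergence theorem in a boundary chart\<close>

text \<open>On each vertical line the map is a reflection followed by a translation, so the measure
  is preserved slice by slice.\<close>

lemma distr_shear:
  fixes g :: "real \<Rightarrow> real"
  assumes [measurable]: "g \<in> borel_measurable borel"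
  shows "distr lborel borel (\<lambda>z. (fst z, g (fst z) - snd z)) = (lborel :: (real \<times> real) measure)"
    (is "distr _ _ ?T = _")
proof (rule measure_eqI)
  have T [measurable]: "?T \<in> borel \<rightarrow>\<^sub>M borel"
    by (simp add: borel_prod[symmetric])
  fix A assume "A \<in> sets (distr lborel borel ?T)"
  then have A [measurable]: "A \<in> sets borel" by simp
  have A': "A \<in> sets (lborel \<Otimes>\<^sub>M lborel)" using A by (simp only: lborel_prod sets_lborel)
  have TA: "?T -` A \<in> sets (lborel \<Otimes>\<^sub>M lborel)"
    using measurable_sets[OF T A] by (simp only: lborel_prod sets_lborel space_borel Int_UNIV_right)
  have "emeasure (distr lborel borel ?T) A = emeasure lborel (?T -` A)"
    by (subst emeasure_distr) auto
  also have "\<dots> = (\<integral>\<^sup>+x. emeasure lborel (Pair x -` (?T -` A)) \<partial>lborel)"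
    using lborel.emeasure_pair_measure_alt[OF TA] by (simp add: lborel_prod)
  also have "\<dots> = (\<integral>\<^sup>+x. emeasure lborel (Pair x -` A) \<partial>lborel)"
  proof (rule nn_integral_cong)
    fix x :: real
    have S: "Pair x -` A \<in> sets borel"
      using sets_Pair1[OF A', of x] by simp
    have "emeasure lborel (Pair x -` (?T -` A)) = emeasure lborel ((\<lambda>t. g x + (-1) * t) -` (Pair x -` A))"
      by (rule arg_cong[where f = "emeasure lborel"]) auto
    also have "\<dots> = emeasure (distr lborel borel (\<lambda>t. g x + (-1) * t)) (Pair x -` A)"
      using S by (subst emeasure_distr) auto
    also have "distr lborel borel (\<lambda>t. g x + (-1) * t) = lborel"
      using lborel_real_affine[of "-1" "g x"] by (simp add: density_1)
    finally show "emeasure lborel (Pair x -` (?T -` A)) = emeasure lborel (Pair x -` A)" .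
  qed
  also have "\<dots> = emeasure lborel A"
    using lborel.emeasure_pair_measure_alt[OF A'] by (simp add: lborel_prod)
  finally show "emeasure (distr lborel borel ?T) A = emeasure lborel A" .
qed simp

text \<open>Links the product plane, where iterated integrals are taken, to the vectors on which the
  fields live.\<close>

definition vec2 :: "real \<times> real \<Rightarrow> real^2"
  where "vec2 z = fst z *\<^sub>R axis 1 1 + snd z *\<^sub>R axis 2 1"

lemma vec2_nth [simp]: "vec2 z $ 1 = fst z" "vec2 z $ 2 = snd z"
  by (simp_all add: vec2_def)

lemma vec2_eta: "vec2 (v $ 1, v $ 2) = v"
  by (simp add: vec_eq_iff forall_2)

lemma continuous_vec2: "continuous_on S vec2"
  unfolding vec2_def by (intro continuous_intros)

lemma vec2_borel [measurable]: "vec2 \<in> borel \<rightarrow>\<^sub>M borel"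
  by (intro borel_measurable_continuous_onI continuous_vec2)

lemma distr_vec2: "distr lborel borel vec2 = lborel"
proof (rule lborel_eqI[symmetric])
  fix l u :: "real^2" assume "\<And>b. b \<in> Basis \<Longrightarrow> l \<bullet> b \<le> u \<bullet> b"
  then have le: "l $ i \<le> u $ i" for i
    by (metis axis_in_Basis_iff cart_eq_inner_axis Basis_real_def singletonI)
  have eq: "vec2 -` box l u = {l $ 1<..<u $ 1} \<times> {l $ 2<..<u $ 2}"
    by (auto simp: mem_box_cart forall_2)
  have "emeasure (distr lborel borel vec2) (box l u) = emeasure (lborel \<Otimes>\<^sub>M lborel) ({l $ 1<..<u $ 1} \<times> {l $ 2<..<u $ 2})"
    by (subst emeasure_distr) (auto simp: eq lborel_prod)
  also have "\<dots> = ennreal (u $ 1 - l $ 1) * ennreal (u $ 2 - l $ 2)"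
    using le by (subst lborel.emeasure_pair_measure_Times) auto
  also have "\<dots> = ennreal (\<Prod>b\<in>Basis. (u - l) \<bullet> b)"
  proof -
    have "(\<Prod>b\<in>Basis. (u - l) \<bullet> b) = (\<Prod>i\<in>UNIV. (u - l) $ i)"
      unfolding Basis_vec_def
      by (simp add: cart_eq_inner_axis[symmetric] prod.UNION_disjoint UNION_singleton_eq_range prod.reindex inj_on_def axis_eq_axis)
    then show ?thesis using le by (simp add: UNIV_2 ennreal_mult)
  qed
  finally show "emeasure (distr lborel borel vec2) (box l u) = ennreal (\<Prod>b\<in>Basis. (u - l) \<bullet> b)" .
qed simp

lemma distr_orthogonal:
  fixes Q :: "real^2 \<Rightarrow> real^2"
  assumes Q: "orthogonal_transformation Q"
  shows "distr lborel borel Q = lborel"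
proof (rule lborel_eqI[symmetric])
  fix l u :: "real^2" assume le: "\<And>b. b \<in> Basis \<Longrightarrow> l \<bullet> b \<le> u \<bullet> b"
  have "bounded_linear Q"
    using orthogonal_transformation_linear[OF Q] by (simp add: linear_conv_bounded_linear)
  then have cont: "continuous_on UNIV Q" by (rule linear_continuous_on)
  then have [measurable]: "Q \<in> borel \<rightarrow>\<^sub>M borel" by (rule borel_measurable_continuous_onI)
  have inv: "orthogonal_transformation (inv Q)" using Q by (rule orthogonal_transformation_inv)
  have vi: "Q -` box l u = inv Q ` box l u"
    using Q by (simp add: bij_vimage_eq_inv_image orthogonal_transformation_bij)
  have op: "open (Q -` box l u)" using cont by (intro open_vimage) auto
  have "emeasure (distr lborel borel Q) (box l u) = emeasure lborel (Q -` box l u)"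
    by (subst emeasure_distr) auto
  also have "\<dots> = emeasure lebesgue (inv Q ` box l u)"
    using op by (simp add: vi emeasure_completion)
  also have "\<dots> = ennreal (measure lebesgue (inv Q ` box l u))"
    by (intro emeasure_eq_measure2 measurable_orthogonal_image inv lmeasurable_box)
  also have "\<dots> = ennreal (measure lebesgue (box l u))"
    by (simp add: measure_orthogonal_image inv)
  also have "\<dots> = ennreal (\<Prod>b\<in>Basis. (u - l) \<bullet> b)"
    using le by (simp add: measure_lborel_box_eq)
  finally show "emeasure (distr lborel borel Q) (box l u) = ennreal (\<Prod>b\<in>Basis. (u - l) \<bullet> b)" .
qed simp


text \<open>The divergence is the trace of the derivative, so it may be computed in the orthonormal
  basis that \<open>Q\<close> sends to the coordinate axes.\<close>

lemma divergence_orthonormal: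
  fixes Q F :: "real^2 \<Rightarrow> real^2"
  assumes Q: "orthogonal_transformation Q" and F: "F differentiable (at y)"
  defines "D \<equiv> frechet_derivative F (at y)"
  shows "divergence F y = D (inv Q (axis 1 1)) \<bullet> inv Q (axis 1 1) + D (inv Q (axis 2 1)) \<bullet> inv Q (axis 2 1)"
proof -
  define e where "e k = inv Q (axis k 1)" for k :: 2
  have inv: "orthogonal_transformation (inv Q)" using Q by (rule orthogonal_transformation_inv)
  have bij: "bij Q" using Q by (rule orthogonal_transformation_bij)
  have Qe: "Q (e k) = axis k 1" for k unfolding e_def using bij by (simp add: bij_is_surj surj_f_inv_f)
  have enth: "e k $ i = Q (axis i 1) $ k" for i k
  proof -
    have "e k $ i = e k \<bullet> axis i 1" by (simp add: cart_eq_inner_axis)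
    also have "\<dots> = Q (e k) \<bullet> Q (axis i 1)" using Q by (simp add: orthogonal_transformation_def)
    also have "\<dots> = Q (axis i 1) $ k" by (simp add: Qe cart_eq_inner_axis inner_commute)
    finally show ?thesis .
  qed
  have orth: "e 1 $ i * e 1 $ j + e 2 $ i * e 2 $ j = (if i = j then 1 else 0)" for i j
  proof -
    have "Q (axis i 1) \<bullet> Q (axis j 1) = axis i 1 \<bullet> (axis j 1 :: real^2)"
      using Q by (simp add: orthogonal_transformation_def)
    then have "Q (axis i 1) \<bullet> Q (axis j 1) = (if i = j then 1 else 0)"
      by (simp add: inner_axis_axis)
    then show ?thesis unfolding enth by (simp add: inner_vec_def sum_2)
  qed
  have Dv: "D v = v $ 1 *\<^sub>R pd 1 F y + v $ 2 *\<^sub>R pd 2 F y" for v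
    unfolding D_def by (simp add: frechet_derivative_at[OF has_derivative_pd[OF F], symmetric])
  have "D (e 1) \<bullet> e 1 + D (e 2) \<bullet> e 2
      = (e 1 $ 1 * e 1 $ 1 + e 2 $ 1 * e 2 $ 1) * pd 1 F y $ 1
      + (e 1 $ 1 * e 1 $ 2 + e 2 $ 1 * e 2 $ 2) * pd 1 F y $ 2
      + (e 1 $ 2 * e 1 $ 1 + e 2 $ 2 * e 2 $ 1) * pd 2 F y $ 1
      + (e 1 $ 2 * e 1 $ 2 + e 2 $ 2 * e 2 $ 2) * pd 2 F y $ 2"
    by (simp add: Dv inner_vec_def sum_2 algebra_simps)
  also have "\<dots> = divergence F y"
    unfolding orth by (simp add: divergence_def sum_2)
  finally show ?thesis by (simp add: e_def)
qed

text \<open>The chart describes \<Omega> only inside \<open>ball x r\<close>, while the graph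
  argument wants the whole subgraph. Since the field vanishes off \<open>cball x \<rho>\<close> and
  \<rho> < r, every point of the subgraph lies either in \<Omega> or in the open set where the field
  is zero, and on the union of the two the field is still continuously differentiable.\<close>

theorem local_divergence_zero:
  fixes \<Omega> :: "(real^2) set" and Q F :: "real^2 \<Rightarrow> real^2"
  assumes \<Omega>: "open \<Omega>"
    and Q: "orthogonal_transformation Q" and lip: "L-lipschitz_on UNIV g"
    and chart: "\<And>y. y \<in> ball x r \<Longrightarrow> y \<in> \<Omega> \<longleftrightarrow> Q (y - x) $ 2 < g (Q (y - x) $ 1)"
    and \<rho>: "0 \<le> \<rho>" "\<rho> < r"
    and C1: "C1_on \<Omega> F" and cont: "continuous_on (closure \<Omega>) F"
    and zero: "\<And>y. y \<notin> cball x \<rho> \<Longrightarrow> F y = 0"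
    and C: "\<And>y. y \<in> \<Omega> \<Longrightarrow> \<bar>divergence F y\<bar> \<le> C"
    and trace: "zero_normal_trace \<Omega> F"
  shows "(LINT y:\<Omega>|lborel. divergence F y) = 0"
proof -
  let ?Qi = "inv Q"
  define e f where "e = ?Qi (axis 1 1)" and "f = ?Qi (axis 2 1)"
  define S where "S z = x + ?Qi (vec2 z)" for z
  define D where "D y = frechet_derivative F (at y)" for y
  have Qi: "orthogonal_transformation ?Qi" using Q by (rule orthogonal_transformation_inv)
  have linQi: "linear ?Qi" using Qi by (rule orthogonal_transformation_linear)
  have bij: "bij Q" using Q by (rule orthogonal_transformation_bij)
  have QS: "Q (S z - x) = vec2 z" for z
    unfolding S_def using bij by (simp add: bij_is_surj surj_f_inv_f)
  have Seta: "S (Q (y - x) $ 1, Q (y - x) $ 2) = y" for y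
    unfolding S_def vec2_eta using bij by (simp add: bij_is_inj)
  have S_eq: "S z = x + (fst z *\<^sub>R e + snd z *\<^sub>R f)" for z
    unfolding S_def vec2_def e_def f_def by (simp add: linear_add[OF linQi] linear_scale[OF linQi])
  have ef: "e \<bullet> e = 1" "f \<bullet> f = 1" "e \<bullet> f = 0" "f \<bullet> e = 0"
    using Qi unfolding e_def f_def orthogonal_transformation_def by (simp_all add: inner_axis_axis)
  have distS: "dist x (S z) = norm (vec2 z)" for z
    unfolding S_def by (simp add: dist_norm orthogonal_transformation_norm[OF Qi])
  \<comment> \<open>The margin 1 lets a non-strict inequality place the point strictly outside the
    closed ball.\<close>
  have far: "S (a, b) \<notin> cball x \<rho>" if "\<rho> + 1 \<le> \<bar>a\<bar> \<or> b \<le> - (\<rho> + 1)" for a b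
  proof -
    have "\<bar>a\<bar> \<le> norm (vec2 (a, b))" "\<bar>b\<bar> \<le> norm (vec2 (a, b))"
      using component_le_norm_cart[of "vec2 (a, b)" 1] component_le_norm_cart[of "vec2 (a, b)" 2] by auto
    then show ?thesis using that by (auto simp: distS)
  qed
  have contS: "continuous_on A S" for A
    unfolding S_eq by (intro continuous_intros)
  define U where "U = - cball x \<rho>"
  have U: "open U" unfolding U_def by (intro open_Compl closed_cball)
  have der0: "(F has_derivative (\<lambda>_. 0)) (at y)" if "y \<in> U" for y
    by (rule has_derivative_transform_within_open[OF has_derivative_const U that])
       (use zero in \<open>auto simp: U_def\<close>)
  have C1U: "C1_on U F"
    by (rule C1_onI[OF der0]) auto
  define W where "W = \<Omega> \<union> U"
  have C1W: "C1_on W F"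
    using C1 C1U unfolding C1_on_def W_def by (auto intro!: continuous_on_open_Un \<Omega> U)
  have DW: "(F has_derivative D y) (at y)" if "y \<in> W" for y
    using C1W that unfolding C1_on_def D_def by (simp add: frechet_derivative_works)
  have D_pd: "D y v = v $ 1 *\<^sub>R pd 1 F y + v $ 2 *\<^sub>R pd 2 F y" if "y \<in> W" for y v
    unfolding D_def by (simp add: frechet_derivative_at[OF C1_on_has_derivative[OF C1W that], symmetric])
  have contD: "continuous_on W (\<lambda>y. D y v)" for v
    by (rule continuous_on_eq[of _ "\<lambda>y. v $ 1 *\<^sub>R pd 1 F y + v $ 2 *\<^sub>R pd 2 F y"])
       (auto simp: D_pd intro!: continuous_intros C1_on_pd_continuous[OF C1W])
  have div: "divergence F y = D y e \<bullet> e + D y f \<bullet> f" if "y \<in> W" for y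
    unfolding D_def e_def f_def using C1W that
    by (intro divergence_orthonormal Q) (simp add: C1_on_def)
  have divU: "divergence F y = 0" if "y \<in> U" for y
    unfolding divergence_def by (simp add: pd_eqI[OF der0[OF that]])
  have inW: "S z \<in> W" if "snd z < g (fst z)" for z
    using chart[of "S z"] that \<rho> by (cases "S z \<in> ball x r") (auto simp: W_def U_def QS)
  have in\<Omega>: "S z \<in> \<Omega> \<longleftrightarrow> snd z < g (fst z)" if "S z \<in> ball x r" for z
    using chart[OF that] by (simp add: QS)
  have closure: "S z \<in> closure \<Omega>" if z: "snd z \<le> g (fst z)" "S z \<in> ball x r" for z
  proof -
    have lim: "(\<lambda>n. S (fst z, snd z - 1 / real (Suc n))) \<longlonglongrightarrow> S (fst z, snd z - 0)"
      unfolding S_eq fst_conv snd_conv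
      by (intro tendsto_intros) (use LIMSEQ_Suc[OF lim_1_over_n[where 'a = real]] in simp)
    have "\<forall>\<^sub>F n in sequentially. S (fst z, snd z - 1 / real (Suc n)) \<in> ball x r"
      by (rule topological_tendstoD[OF lim]) (use z in auto)
    then have "\<forall>\<^sub>F n in sequentially. S (fst z, snd z - 1 / real (Suc n)) \<in> closure \<Omega>"
    proof eventually_elim
      case (elim n)
      have "snd z - 1 / real (Suc n) < snd z" by simp
      also note z(1)
      finally have "S (fst z, snd z - 1 / real (Suc n)) \<in> \<Omega>"
        using in\<Omega>[OF elim] by simp
      then show ?case using closure_subset by blast
    qed
    from Lim_in_closed_set[OF closed_closure this _ lim] show ?thesis by simp
  qed
  \<comment> \<open>Two relatively open pieces are glued: inside \<open>ball x r\<close> the closed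
    subgraph lies in the closure of \<Omega>, and over \<open>U\<close> the field is zero.\<close>
  have contFS: "continuous_on {z. snd z \<le> g (fst z)} (\<lambda>z. F (S z))"
  proof -
    let ?A = "{z. snd z \<le> g (fst z)}"
    let ?A1 = "?A \<inter> S -` ball x r" and ?A2 = "?A \<inter> S -` U"
    have A: "?A1 \<union> ?A2 = ?A" using \<rho> by (auto simp: U_def)
    have "continuous_on (?A1 \<union> ?A2) (\<lambda>z. F (S z))"
    proof (rule continuous_on_Un_local_open)
      have o: "open (S -` V)" if "open V" for V
        using that contS by (intro open_vimage)
      show "openin (top_of_set (?A1 \<union> ?A2)) ?A1" "openin (top_of_set (?A1 \<union> ?A2)) ?A2"
        unfolding A by (intro openin_open_Int o open_ball U)+
      show "continuous_on ?A1 (\<lambda>z. F (S z))"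
        by (rule continuous_on_compose2[OF cont contS]) (use closure in auto)
      show "continuous_on ?A2 (\<lambda>z. F (S z))"
        by (rule continuous_on_eq[OF continuous_on_const[of _ 0]]) (use zero in \<open>auto simp: U_def\<close>)
    qed
    then show ?thesis unfolding A .
  qed
  have contDS: "continuous_on {z. snd z < g (fst z)} (\<lambda>z. D (S z) v \<bullet> w)" for v w
    by (intro continuous_on_inner continuous_on_const continuous_on_compose2[OF contD contS]) (use inW in auto)
  have DS: "((\<lambda>z. F (S z)) has_derivative (\<lambda>v. fst v *\<^sub>R D (S z) e + snd v *\<^sub>R D (S z) f)) (at z)"
    if "snd z < g (fst z)" for z
  proof -
    have 1: "(S has_derivative (\<lambda>v. fst v *\<^sub>R e + snd v *\<^sub>R f)) (at z)"
      unfolding S_eq by (auto intro!: derivative_eq_intros)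
    note d = DW[OF inW[OF that]]
    have lin: "linear (D (S z))" using has_derivative_linear[OF d] .
    show ?thesis
      using diff_chain_at[OF 1 d] unfolding o_def
      by (rule has_derivative_eq_rhs) (simp add: linear_add[OF lin] linear_scale[OF lin])
  qed
  have D0: "D (S (a, b)) v = 0" if "\<rho> + 1 \<le> \<bar>a\<bar> \<or> b \<le> - (\<rho> + 1)" for a b v
  proof -
    have "S (a, b) \<in> U" using far[OF that] by (simp add: U_def)
    then show ?thesis unfolding D_def by (simp add: frechet_derivative_at[OF der0, symmetric])
  qed
  \<comment> \<open>\<open>max C 0\<close> also covers the points of the subgraph outside \<Omega>,
    where the divergence is zero.\<close>
  interpret sf: subgraph_field g L "\<rho> + 1" "max C 0" "\<lambda>z. F (S z) \<bullet> e" "\<lambda>z. F (S z) \<bullet> f"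
    "\<lambda>z. D (S z) e \<bullet> e" "\<lambda>z. D (S z) f \<bullet> e" "\<lambda>z. D (S z) f \<bullet> f"
  proof
    show "L-lipschitz_on UNIV g" by (rule lip)
    show "0 \<le> \<rho> + 1" using \<rho> by simp
    show "((\<lambda>z. F (S z) \<bullet> e) has_derivative (\<lambda>v. D (S (a, b)) e \<bullet> e * fst v + D (S (a, b)) f \<bullet> e * snd v)) (at (a, b))"
      if "b < g a" for a b
      by (rule has_derivative_eq_rhs[OF has_derivative_inner_left[OF DS]])
         (use that in \<open>auto simp: inner_simps algebra_simps\<close>)
    show "((\<lambda>b. F (S (a, b)) \<bullet> f) has_real_derivative D (S (a, b)) f \<bullet> f) (at b)" if "b < g a" for a b
    proof -
      have 1: "((\<lambda>b. (a, b)) has_derivative (\<lambda>h. (0, h))) (at b)"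
        by (auto intro!: derivative_eq_intros)
      have 2: "((\<lambda>z. F (S z)) has_derivative (\<lambda>v. fst v *\<^sub>R D (S (a, b)) e + snd v *\<^sub>R D (S (a, b)) f)) (at (a, b))"
        using DS[of "(a, b)"] that by simp
      show ?thesis
        using has_derivative_inner_left[OF diff_chain_at[OF 1 2], of f]
        unfolding has_field_derivative_def o_def
        by (rule has_derivative_eq_rhs) (auto simp: algebra_simps)
    qed
    show "continuous_on {z. snd z \<le> g (fst z)} (\<lambda>z. F (S z) \<bullet> e)"
      "continuous_on {z. snd z \<le> g (fst z)} (\<lambda>z. F (S z) \<bullet> f)"
      by (intro continuous_on_inner contFS continuous_on_const)+
    show "continuous_on {z. snd z < g (fst z)} (\<lambda>z. D (S z) e \<bullet> e)"
      "continuous_on {z. snd z < g (fst z)} (\<lambda>z. D (S z) f \<bullet> e)"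
      "continuous_on {z. snd z < g (fst z)} (\<lambda>z. D (S z) f \<bullet> f)"
      by (rule contDS)+
    show "F (S (a, b)) \<bullet> e = 0 \<and> F (S (a, b)) \<bullet> f = 0" if "\<rho> + 1 \<le> \<bar>a\<bar> \<or> b \<le> - (\<rho> + 1)" for a b
      using zero[OF far[OF that]] by simp
    show "D (S (a, b)) e \<bullet> e = 0 \<and> D (S (a, b)) f \<bullet> e = 0 \<and> D (S (a, b)) f \<bullet> f = 0"
      if "\<rho> + 1 \<le> \<bar>a\<bar> \<or> b \<le> - (\<rho> + 1)" for a b
      using D0[OF that] by simp
    show "\<bar>D (S (a, b)) e \<bullet> e + D (S (a, b)) f \<bullet> f\<bar> \<le> max C 0" if "b < g a" for a b
    proof -
      have "S (a, b) \<in> W" using inW[of "(a, b)"] that by simp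
      then show ?thesis using div[of "S (a, b)"] C[of "S (a, b)"] divU[of "S (a, b)"]
        by (fastforce simp: W_def)
    qed
    show "F (S (a, g a)) \<bullet> f = m * (F (S (a, g a)) \<bullet> e)" if m: "(g has_real_derivative m) (at a)" for a m
    proof (cases "S (a, g a) \<in> ball x r")
      case False
      then have "F (S (a, g a)) = 0" using \<rho> by (intro zero) auto
      then show ?thesis by simp
    next
      case True
      define y0 where "y0 = S (a, g a)"
      \<comment> \<open>In the basis \<open>e\<close>, \<open>f\<close> the normal of the graph is
        (-m, 1) / q. Near \<open>y0\<close>, membership in \<Omega> compares \<open>k\<close> with g
        (a + h) - g a, which is m h up to \<epsilon> |h|. As q \<ge> 1, a point in the cone for the
        unit normal satisfies the comparison with room to spare.\<close>
      define q where "q = sqrt (1 + m\<^sup>2)"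
      have q: "q \<ge> 1" "q * q = 1 + m\<^sup>2" unfolding q_def by auto
      define \<nu> where "\<nu> = (1 / q) *\<^sub>R (f - m *\<^sub>R e)"
      have "outward_unit_normal \<Omega> y0 \<nu>"
        unfolding outward_unit_normal_def
      proof (intro conjI allI impI)
        have "y0 \<notin> \<Omega>" unfolding y0_def using in\<Omega>[OF True] by simp
        moreover have "y0 \<in> closure \<Omega>" unfolding y0_def by (rule closure) (use True in auto)
        ultimately show "y0 \<in> frontier \<Omega>" using \<Omega> by (simp add: frontier_def interior_open)
        have "\<nu> \<bullet> \<nu> = (1 / (q * q)) * (1 + m\<^sup>2)"
          unfolding \<nu>_def by (simp add: inner_simps ef power2_eq_square add_divide_distrib[symmetric])
        also have "\<dots> = 1" using q(1) by (simp add: q(2)[symmetric])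
        finally show "norm \<nu> = 1" by (simp add: norm_eq_1)
        fix \<epsilon> :: real assume \<epsilon>: "\<epsilon> > 0"
        have "((\<lambda>h. (g (a + h) - g a) / h) \<longlongrightarrow> m) (at 0)" using m by (simp add: DERIV_def)
        from tendstoD[OF this \<epsilon>] obtain d where d: "d > 0"
          "\<And>h. h \<noteq> 0 \<Longrightarrow> \<bar>h\<bar> < d \<Longrightarrow> \<bar>(g (a + h) - g a) / h - m\<bar> < \<epsilon>"
          unfolding eventually_at by (auto simp: dist_real_def)
        have lin: "\<bar>g (a + h) - g a - m * h\<bar> \<le> \<epsilon> * \<bar>h\<bar>" if "\<bar>h\<bar> < d" for h
        proof (cases "h = 0")
          case False
          have "((g (a + h) - g a) / h - m) * h = g (a + h) - g a - m * h"
            using False by (simp add: field_simps)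
          then have "\<bar>g (a + h) - g a - m * h\<bar> = \<bar>(g (a + h) - g a) / h - m\<bar> * \<bar>h\<bar>"
            by (simp add: abs_mult[symmetric])
          also have "\<dots> \<le> \<epsilon> * \<bar>h\<bar>" using d(2)[OF False that] by (intro mult_right_mono) auto
          finally show ?thesis .
        qed simp
        have yb: "y0 \<in> ball x r" using True by (simp add: y0_def)
        have "\<forall>\<^sub>F y in at y0. y \<in> ball x r \<inter> ball y0 d"
          using d(1) yb by (intro eventually_at_in_open' open_Int open_ball) auto
        then show "\<forall>\<^sub>F y in at y0.
          ((y - y0) \<bullet> \<nu> < - \<epsilon> * norm (y - y0) \<longrightarrow> y \<in> \<Omega>) \<and>
          ((y - y0) \<bullet> \<nu> > \<epsilon> * norm (y - y0) \<longrightarrow> y \<notin> \<Omega>)"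
        proof eventually_elim
          case (elim y)
          define h k where "h = Q (y - x) $ 1 - a" and "k = Q (y - x) $ 2 - g a"
          have yS: "y = S (a + h, g a + k)" unfolding h_def k_def using Seta[of y] by simp
          have yy: "y - y0 = h *\<^sub>R e + k *\<^sub>R f" unfolding yS y0_def S_eq by (simp add: algebra_simps)
          have "y \<in> \<Omega> \<longleftrightarrow> g a + k < g (a + h)" using in\<Omega>[of "(a + h, g a + k)"] elim yS by auto
          moreover have hn: "\<bar>h\<bar> \<le> norm (y - y0)"
          proof -
            have "h = (y - y0) \<bullet> e" unfolding yy by (simp add: inner_simps ef)
            moreover have "norm e = 1" using ef by (simp add: norm_eq_1)
            ultimately show ?thesis using Cauchy_Schwarz_ineq2[of "y - y0" e] by simp
          qed
          moreover have "\<bar>h\<bar> < d" using hn elim by (auto simp: dist_norm norm_minus_commute)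
          then have "\<bar>g (a + h) - g a - m * h\<bar> \<le> \<epsilon> * norm (y - y0)"
            using lin[of h] hn \<epsilon> by (meson mult_left_mono less_imp_le order_trans)
          moreover have "(y - y0) \<bullet> \<nu> = (k - m * h) / q"
            unfolding yy \<nu>_def by (simp add: inner_simps ef)
          moreover have "k - m * h < - (\<epsilon> * norm (y - y0))" if "(k - m * h) / q < - (\<epsilon> * norm (y - y0))"
          proof -
            have "k - m * h < - (\<epsilon> * norm (y - y0)) * q" using that q by (simp add: divide_less_eq)
            also have "\<dots> \<le> - (\<epsilon> * norm (y - y0)) * 1"
              using q \<epsilon> by (intro mult_left_mono_neg) auto
            finally show ?thesis by simp
          qed
          moreover have "k - m * h > \<epsilon> * norm (y - y0)" if "(k - m * h) / q > \<epsilon> * norm (y - y0)"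
          proof -
            have "\<epsilon> * norm (y - y0) * 1 \<le> \<epsilon> * norm (y - y0) * q"
              using q \<epsilon> by (intro mult_left_mono) auto
            also have "\<dots> < k - m * h" using that q by (simp add: less_divide_eq)
            finally show ?thesis by simp
          qed
          ultimately show ?case by (auto simp: abs_le_iff)
        qed
      qed
      then have "F y0 \<bullet> \<nu> = 0" using trace unfolding zero_normal_trace_def by blast
      then show ?thesis using q unfolding \<nu>_def y0_def by (simp add: inner_simps)
    qed
  qed
  have contdiv: "continuous_on \<Omega> (divergence F)" using C1 by (rule divergence_continuous)
  have meas: "(\<lambda>y. indicator \<Omega> y *\<^sub>R divergence F y) \<in> borel_measurable borel"
    using \<Omega> contdiv by (intro borel_measurable_continuous_on_indicator) auto
  have T: "sf.T \<in> borel \<rightarrow>\<^sub>M borel" using sf.cont_T by (rule borel_measurable_continuous_onI)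
  have Qm: "?Qi \<in> borel \<rightarrow>\<^sub>M borel"
    by (intro borel_measurable_continuous_onI linear_continuous_on)
       (use linQi in \<open>simp add: linear_conv_bounded_linear\<close>)
  \<comment> \<open>The shear, the passage to vectors, the orthogonal map and the translation each
    carry Lebesgue measure to itself, so the integral can be moved to depth coordinates.\<close>
  have "lborel = distr (distr (distr (distr lborel borel sf.T) borel vec2) borel ?Qi) borel ((+) x)"
    by (simp add: distr_shear[OF sf.g_meas, folded sf.T_def] distr_vec2 distr_orthogonal[OF Qi] lborel_distr_plus)
  also have "\<dots> = distr lborel borel (\<lambda>z. S (sf.T z))"
    using T Qm by (simp add: distr_distr o_def S_def)
  finally have lb: "lborel = distr lborel borel (\<lambda>z. S (sf.T z))" .
  have "(LINT y:\<Omega>|lborel. divergence F y) = (LINT y|distr lborel borel (\<lambda>z. S (sf.T z)). indicator \<Omega> y *\<^sub>R divergence F y)"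
    unfolding set_lebesgue_integral_def lb[symmetric] ..
  also have "\<dots> = (LINT z|lborel. indicator \<Omega> (S (sf.T z)) *\<^sub>R divergence F (S (sf.T z)))"
  proof (rule integral_distr)
    show "(\<lambda>z. S (sf.T z)) \<in> lborel \<rightarrow>\<^sub>M borel"
      using measurable_compose[OF T borel_measurable_continuous_onI[OF contS]] by simp
  qed (rule meas)
  also have "\<dots> = (LINT z|lborel. indicator {z. 0 < snd z} z * (D (S (sf.T z)) e \<bullet> e + D (S (sf.T z)) f \<bullet> f))"
  proof (rule Bochner_Integration.integral_cong[OF refl])
    fix z :: "real \<times> real"
    have iff: "0 < snd z \<longleftrightarrow> snd (sf.T z) < g (fst (sf.T z))" by (simp add: sf.T_def)
    show "indicator \<Omega> (S (sf.T z)) *\<^sub>R divergence F (S (sf.T z)) =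
      indicator {z. 0 < snd z} z * (D (S (sf.T z)) e \<bullet> e + D (S (sf.T z)) f \<bullet> f)"
    proof (cases "S (sf.T z) \<in> ball x r")
      case True
      then show ?thesis using in\<Omega>[OF True] iff div[of "S (sf.T z)"] by (auto simp: indicator_def W_def)
    next
      case False
      then have "S (sf.T z) \<in> U" using \<rho> by (auto simp: U_def)
      then show ?thesis using div[of "S (sf.T z)"] divU by (simp add: W_def)
    qed
  qed
  also have "\<dots> = 0" by (rule sf.integral_divergence_zero)
  finally show ?thesis .
qed

section \<open>The divergence theorem for fields with vanishing normal trace\<close>

lemma DERIV_max_0_square: "((\<lambda>s::real. (max 0 s)\<^sup>2) has_real_derivative 2 * max 0 s) (at s)"
proof (cases "s = 0")
  case True
  have "((\<lambda>h::real. ((max 0 (0 + h))\<^sup>2 - (max 0 0)\<^sup>2) / h) \<longlongrightarrow> 0) (at 0) \<longleftrightarrow> ((\<lambda>h::real. max 0 h) \<longlongrightarrow> 0) (at 0)"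
    by (rule LIM_equal) (auto simp: max_def power2_eq_square)
  moreover have "((\<lambda>h::real. max 0 h) \<longlongrightarrow> max 0 0) (at 0)" by (intro tendsto_intros)
  ultimately show ?thesis using True by (simp add: DERIV_def)
next
  case False
  show ?thesis
  proof (cases "s > 0")
    case True
    have "((\<lambda>s::real. s\<^sup>2) has_real_derivative 2 * max 0 s) (at s)"
      using True by (auto intro!: derivative_eq_intros)
    then show ?thesis
      by (rule has_field_derivative_transform_within_open[of _ _ _ "{0<..}"]) (use True in auto)
  next
    case neg: False
    have "((\<lambda>s::real. 0) has_real_derivative 2 * max 0 s) (at s)"
      using neg by (auto intro!: derivative_eq_intros)
    then show ?thesis
      by (rule has_field_derivative_transform_within_open[of _ _ _ "{..<0}"]) (use neg False in auto)
  qed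
qed

text \<open>The outer square smooths the kink of the positive part; one continuous derivative is
  what the product rule for the divergence asks for.\<close>

definition bump :: "real^2 \<Rightarrow> real \<Rightarrow> real^2 \<Rightarrow> real"
  where "bump x \<rho> y = (max 0 (\<rho>\<^sup>2 - (y - x) \<bullet> (y - x)))\<^sup>2"

lemma bump_nonneg: "0 \<le> bump x \<rho> y"
  by (simp add: bump_def)

lemma bump_pos_iff: "0 \<le> \<rho> \<Longrightarrow> 0 < bump x \<rho> y \<longleftrightarrow> y \<in> ball x \<rho>"
proof -
  assume "0 \<le> \<rho>"
  have "0 < bump x \<rho> y \<longleftrightarrow> (norm (y - x))\<^sup>2 < \<rho>\<^sup>2"
    by (auto simp: bump_def power2_norm_eq_inner max_def)
  also have "\<dots> \<longleftrightarrow> norm (y - x) < \<rho>"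
    using \<open>0 \<le> \<rho>\<close> by (meson norm_ge_zero power2_less_imp_less power_strict_mono zero_less_numeral)
  finally show ?thesis by (simp add: dist_norm norm_minus_commute)
qed

lemma C1_on_bump: "C1_on S (bump x \<rho>)"
proof (rule C1_onI)
  fix y :: "real^2"
  have "((\<lambda>y. \<rho>\<^sup>2 - (y - x) \<bullet> (y - x)) has_derivative (\<lambda>v. - 2 * ((y - x) \<bullet> v))) (at y)"
    by (auto intro!: derivative_eq_intros simp: inner_commute)
  from DERIV_compose_FDERIV[OF DERIV_max_0_square this]
  show "(bump x \<rho> has_derivative (\<lambda>v. (- 2 * ((y - x) \<bullet> v)) * (2 * max 0 (\<rho>\<^sup>2 - (y - x) \<bullet> (y - x))))) (at y)"
    by (simp add: bump_def[abs_def])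
qed (intro continuous_intros)

lemma C1_on_sum:
  assumes "finite X" and "\<And>x. x \<in> X \<Longrightarrow> C1_on S (f x)"
  shows "C1_on S (\<lambda>y. \<Sum>x\<in>X. f x y)"
  using assms
proof (induction X rule: finite_induct)
  case empty
  show ?case by (rule C1_onI[where f' = "\<lambda>_ _. 0"]) auto
next
  case (insert x X)
  then show ?case by (simp add: C1_on_add)
qed

lemma pd_sum:
  assumes "\<And>x. x \<in> X \<Longrightarrow> f x differentiable (at y)"
  shows "pd i (\<lambda>y. \<Sum>x\<in>X. f x y) y = (\<Sum>x\<in>X. pd i (f x) y)"
  unfolding pd_def[of i "f _"]
  by (intro pd_eqI has_derivative_sum) (use assms in \<open>simp add: frechet_derivative_works\<close>)

lemma C1_on_divide:
  fixes f g :: "real^2 \<Rightarrow> real"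
  assumes f: "C1_on S f" and g: "C1_on S g" and "\<And>y. y \<in> S \<Longrightarrow> g y \<noteq> 0"
  shows "C1_on S (\<lambda>y. f y / g y)"
  by (rule C1_onI[OF has_derivative_divide'[OF C1_on_has_derivative[OF f] C1_on_has_derivative[OF g]]])
    (use assms(3) in \<open>auto intro!: continuous_on_divide continuous_on_diff continuous_on_mult continuous_on_add
      continuous_on_const C1_on_pd_continuous[OF f] C1_on_pd_continuous[OF g] C1_on_continuous[OF f] C1_on_continuous[OF g]\<close>)

lemma continuous_on_compact_bounded:
  fixes f :: "'a::topological_space \<Rightarrow> 'b::real_normed_vector"
  assumes "compact K" and "continuous_on K f"
  obtains B where "B \<ge> 0" and "\<And>x. x \<in> K \<Longrightarrow> norm (f x) \<le> B"
proof -
  have "bounded (f ` K)" using assms by (intro compact_imp_bounded compact_continuous_image)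
  then obtain B where "B > 0" "\<And>y. y \<in> f ` K \<Longrightarrow> norm y \<le> B" unfolding bounded_pos by blast
  then show thesis by (intro that[of B]) auto
qed

lemma set_integrable_bounded_continuous:
  fixes f :: "'a::euclidean_space \<Rightarrow> real"
  assumes "open \<Omega>" and "bounded \<Omega>" and "continuous_on \<Omega> f" and "\<And>x. x \<in> \<Omega> \<Longrightarrow> \<bar>f x\<bar> \<le> C"
  shows "set_integrable lborel \<Omega> f"
  unfolding set_integrable_def
proof (rule Bochner_Integration.integrable_bound)
  show "integrable lborel (\<lambda>x. C * indicator \<Omega> x)"
    using assms emeasure_bounded_finite[OF assms(2)]
    by (intro integrable_mult_right integrable_real_indicator) auto
  show "(\<lambda>x. indicator \<Omega> x *\<^sub>R f x) \<in> borel_measurable lborel"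
    using borel_measurable_continuous_on_indicator[OF _ assms(3)] assms(1) by simp
  show "AE x in lborel. norm (indicator \<Omega> x *\<^sub>R f x) \<le> norm (C * indicator \<Omega> x)"
    using assms(4) by (intro AE_I2) (force simp: indicator_def)
qed

lemma divergence_scaleR:
  fixes F :: "real^2 \<Rightarrow> real^2"
  assumes "\<psi> differentiable (at y)" and "F differentiable (at y)"
  shows "divergence (\<lambda>y. \<psi> y *\<^sub>R F y) y = \<psi> y * divergence F y + (pd 1 \<psi> y * F y $ 1 + pd 2 \<psi> y * F y $ 2)"
  unfolding divergence_def using pd_bilinear[OF bounded_bilinear_scaleR assms]
  by (simp add: sum_2 algebra_simps)

text \<open>At an interior point the constant graph of height \<open>r\<close> lies above a whole
  ball contained in \<Omega>, so interior patches can be handled like boundary patches.\<close>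

lemma lipschitz_domain_chart:
  assumes "bounded_lipschitz_domain \<Omega>" and "x \<in> closure \<Omega>"
  shows "\<exists>r>0. \<exists>(Q :: real^2 \<Rightarrow> real^2) (g :: real \<Rightarrow> real) L.
        orthogonal_transformation Q \<and> L-lipschitz_on UNIV g \<and>
        (\<forall>y\<in>ball x r. y \<in> \<Omega> \<longleftrightarrow> Q (y - x) $ 2 < g (Q (y - x) $ 1))"
proof (cases "x \<in> frontier \<Omega>")
  case True
  then show ?thesis using assms(1) unfolding bounded_lipschitz_domain_def by blast
next
  case False
  have \<Omega>: "open \<Omega>" using assms(1) by (simp add: bounded_lipschitz_domain_def)
  with False assms(2) have "x \<in> \<Omega>" by (auto simp: frontier_def interior_open)
  with \<Omega> obtain r where r: "r > 0" "ball x r \<subseteq> \<Omega>" by (rule openE)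
  have "(y - x) $ 2 < r" if "y \<in> ball x r" for y
    using component_le_norm_cart[of "y - x" 2] that by (auto simp: dist_norm norm_minus_commute)
  moreover have "0-lipschitz_on UNIV (\<lambda>_::real. r)" by (rule lipschitz_onI) auto
  ultimately show ?thesis using r
    by (intro exI[of _ r] conjI exI[of _ "\<lambda>v. v"] exI[of _ "\<lambda>_. r"] exI[of _ 0]) auto
qed

theorem divergence_theorem_zero_trace:
  fixes F :: "real^2 \<Rightarrow> real^2"
  assumes dom: "bounded_lipschitz_domain \<Omega>"
    and C1: "C1_on \<Omega> F" and cont: "continuous_on (closure \<Omega>) F"
    and C: "\<And>y. y \<in> \<Omega> \<Longrightarrow> \<bar>divergence F y\<bar> \<le> C"
    and trace: "zero_normal_trace \<Omega> F"
  shows "(LINT y:\<Omega>|lborel. divergence F y) = 0"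
proof -
  have \<Omega>: "open \<Omega>" "bounded \<Omega>" using dom by (auto simp: bounded_lipschitz_domain_def)
  have comp: "compact (closure \<Omega>)" using \<Omega> by (simp add: compact_closure)
  define chart where "chart x r \<longleftrightarrow> (\<exists>(Q :: real^2 \<Rightarrow> real^2) (g :: real \<Rightarrow> real) L.
        orthogonal_transformation Q \<and> L-lipschitz_on UNIV g \<and>
        (\<forall>y\<in>ball x r. y \<in> \<Omega> \<longleftrightarrow> Q (y - x) $ 2 < g (Q (y - x) $ 1)))" for x r
  have "\<forall>x\<in>closure \<Omega>. \<exists>r>0. chart x r"
    using lipschitz_domain_chart[OF dom] unfolding chart_def by blast
  then obtain r where r: "\<And>x. x \<in> closure \<Omega> \<Longrightarrow> r x > 0 \<and> chart x (r x)" by metis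
  \<comment> \<open>Half the chart radius leaves the gap between \<rho> and r that the local theorem
    demands.\<close>
  define \<rho> where "\<rho> x = r x / 2" for x
  have \<rho>: "0 < \<rho> x" "\<rho> x < r x" if "x \<in> closure \<Omega>" for x using r[OF that] by (auto simp: \<rho>_def)
  obtain X where X: "X \<subseteq> closure \<Omega>" "finite X" "closure \<Omega> \<subseteq> (\<Union>x\<in>X. ball x (\<rho> x))"
    using compactE_image[OF comp, of "closure \<Omega>" "\<lambda>x. ball x (\<rho> x)"] \<rho>(1)
    by (metis (no_types, lifting) UN_I centre_in_ball open_ball subsetI)
  define S where "S y = (\<Sum>x\<in>X. bump x (\<rho> x) y)" for y
  define W where "W = {y. S y \<noteq> 0}"
  have S_pos: "S y > 0" if "y \<in> closure \<Omega>" for y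
  proof -
    have "y \<in> (\<Union>x\<in>X. ball x (\<rho> x))" using X(3) that by (rule subsetD)
    then obtain x where x: "x \<in> X" "y \<in> ball x (\<rho> x)" by (rule UN_E)
    then have "0 < bump x (\<rho> x) y" using bump_pos_iff[of "\<rho> x" x y] \<rho>(1)[of x] X(1) by auto
    also have "\<dots> \<le> S y" unfolding S_def
      using x X(2) by (intro member_le_sum) (auto simp: bump_nonneg)
    finally show ?thesis .
  qed
  have W: "closure \<Omega> \<subseteq> W"
  proof
    fix y assume "y \<in> closure \<Omega>"
    from S_pos[OF this] show "y \<in> W" by (simp add: W_def)
  qed
  have \<Omega>W: "\<Omega> \<subseteq> W" using W closure_subset by blast
  define \<psi> where "\<psi> x y = bump x (\<rho> x) y / S y" for x y
  have C1\<psi>: "C1_on W (\<psi> x)" for x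
    unfolding \<psi>_def S_def
    by (intro C1_on_divide C1_on_bump C1_on_sum X(2)) (simp add: W_def S_def)
  have C1\<psi>': "C1_on \<Omega> (\<psi> x)" for x
    using C1\<psi>[of x] \<Omega>W unfolding C1_on_def by (meson continuous_on_subset subsetD)
  define Fx where "Fx x y = \<psi> x y *\<^sub>R F y" for x y
  have C1F: "C1_on \<Omega> (Fx x)" for x
    unfolding Fx_def by (rule C1_on_bilinear[OF bounded_bilinear_scaleR C1\<psi>' C1])
  have contF: "continuous_on (closure \<Omega>) (Fx x)" for x
    unfolding Fx_def using continuous_on_subset[OF C1_on_continuous[OF C1\<psi>] W] cont
    by (intro continuous_on_scaleR)
  obtain BF where BF: "BF \<ge> 0" "\<And>y. y \<in> closure \<Omega> \<Longrightarrow> norm (F y) \<le> BF"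
    using continuous_on_compact_bounded[OF comp cont] by blast
  \<comment> \<open>Localising adds only the scalar product of \<open>F\<close> with the gradient of
    \<open>\<psi> x\<close>. Both are bounded: the partial derivatives of \<open>\<psi> x\<close>
    are continuous on \<open>W\<close>, which contains the compact closure of \<Omega>.\<close>
  have bdd: "\<exists>B. \<forall>y\<in>\<Omega>. \<bar>divergence (Fx x) y\<bar> \<le> B" for x
  proof -
    obtain B0 where B0: "B0 \<ge> 0" "\<And>y. y \<in> closure \<Omega> \<Longrightarrow> norm (\<psi> x y) \<le> B0"
      using continuous_on_compact_bounded[OF comp continuous_on_subset[OF C1_on_continuous[OF C1\<psi>] W]] by blast
    obtain B1 where B1: "B1 \<ge> 0" "\<And>y. y \<in> closure \<Omega> \<Longrightarrow> norm (pd 1 (\<psi> x) y) \<le> B1"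
      using continuous_on_compact_bounded[OF comp continuous_on_subset[OF C1_on_pd_continuous[OF C1\<psi>] W]] by blast
    obtain B2 where B2: "B2 \<ge> 0" "\<And>y. y \<in> closure \<Omega> \<Longrightarrow> norm (pd 2 (\<psi> x) y) \<le> B2"
      using continuous_on_compact_bounded[OF comp continuous_on_subset[OF C1_on_pd_continuous[OF C1\<psi>] W]] by blast
    have "\<bar>divergence (Fx x) y\<bar> \<le> B0 * C + (B1 * BF + B2 * BF)" if y: "y \<in> \<Omega>" for y
    proof -
      have yc: "y \<in> closure \<Omega>" using y closure_subset by blast
      have "divergence (Fx x) y = \<psi> x y * divergence F y + (pd 1 (\<psi> x) y * F y $ 1 + pd 2 (\<psi> x) y * F y $ 2)"
        unfolding Fx_def using C1\<psi>' C1 y by (intro divergence_scaleR) (auto simp: C1_on_def)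
      moreover have "\<bar>\<psi> x y * divergence F y\<bar> \<le> B0 * C"
        unfolding abs_mult using B0 yc C[OF y] by (intro mult_mono) auto
      moreover have Fi: "\<bar>F y $ i\<bar> \<le> BF" for i
        using component_le_norm_cart BF(2)[OF yc] by (rule order_trans)
      have "\<bar>pd 1 (\<psi> x) y * F y $ 1\<bar> \<le> B1 * BF" "\<bar>pd 2 (\<psi> x) y * F y $ 2\<bar> \<le> B2 * BF"
        unfolding abs_mult
        using B1 B2 yc BF(1) Fi by (auto intro!: mult_mono)
      ultimately show ?thesis by linarith
    qed
    then show ?thesis by blast
  qed
  have int: "set_integrable lborel \<Omega> (divergence (Fx x))" for x
    using bdd[of x] set_integrable_bounded_continuous[OF \<Omega> divergence_continuous[OF C1F[of x]]] by blast
  have zero: "(LINT y:\<Omega>|lborel. divergence (Fx x) y) = 0" if x: "x \<in> X" for x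
  proof -
    have xc: "x \<in> closure \<Omega>" using X(1) x by blast
    from r[OF xc] obtain Q :: "real^2 \<Rightarrow> real^2" and g L where Q: "orthogonal_transformation Q" "L-lipschitz_on UNIV g"
      "\<And>y. y \<in> ball x (r x) \<Longrightarrow> y \<in> \<Omega> \<longleftrightarrow> Q (y - x) $ 2 < g (Q (y - x) $ 1)"
      unfolding chart_def by blast
    obtain B where B: "\<And>y. y \<in> \<Omega> \<Longrightarrow> \<bar>divergence (Fx x) y\<bar> \<le> B" using bdd[of x] by blast
    \<comment> \<open>Off the ball the numerator is 0, so \<open>\<psi> x y\<close> is 0 even where
      \<open>S y\<close> = 0.\<close>
    have supp: "Fx x y = 0" if "y \<notin> cball x (\<rho> x)" for y
      using that bump_pos_iff[of "\<rho> x" x y] bump_nonneg[of x "\<rho> x" y] \<rho>(1)[OF xc]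
      by (auto simp: Fx_def \<psi>_def)
    have tr: "zero_normal_trace \<Omega> (Fx x)"
      using trace by (auto simp: zero_normal_trace_def Fx_def)
    show ?thesis
      by (rule local_divergence_zero[OF \<Omega>(1) Q _ _ C1F contF supp B tr])
         (use \<rho>[OF xc] in auto)
  qed
  have "divergence F y = (\<Sum>x\<in>X. divergence (Fx x) y)" if y: "y \<in> \<Omega>" for y
  proof -
    have eq: "F z = (\<Sum>x\<in>X. Fx x z)" if "z \<in> \<Omega>" for z
    proof -
      have "(\<Sum>x\<in>X. \<psi> x z) = 1"
        using \<Omega>W that by (auto simp: \<psi>_def sum_divide_distrib[symmetric] S_def[symmetric] W_def)
      then show ?thesis by (simp add: Fx_def scaleR_sum_left[symmetric])
    qed
    have "divergence F y = divergence (\<lambda>z. \<Sum>x\<in>X. Fx x z) y"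
      by (rule divergence_cong[OF \<Omega>(1) y eq])
    also have "\<dots> = (\<Sum>x\<in>X. divergence (Fx x) y)"
      unfolding divergence_def using C1F y
      by (subst pd_sum) (auto simp: C1_on_def sum_2 sum.distrib)
    finally show ?thesis .
  qed
  then have "(LINT y:\<Omega>|lborel. divergence F y) = (LINT y:\<Omega>|lborel. \<Sum>x\<in>X. divergence (Fx x) y)"
    using \<Omega>(1) by (intro set_lebesgue_integral_cong) auto
  also have "\<dots> = (\<Sum>x\<in>X. LINT y:\<Omega>|lborel. divergence (Fx x) y)"
    using int unfolding set_lebesgue_integral_def set_integrable_def
    by (simp add: scaleR_sum_right Bochner_Integration.integral_sum del: real_scaleR_def)
  also have "\<dots> = 0" using zero by simp
  finally show ?thesis .
qed

section \<open>Symmetry of second derivatives\<close>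

lemma DERIV_along_axis:
  fixes f :: "real^2 \<Rightarrow> real"
  assumes "f differentiable (at (y + t *\<^sub>R axis i 1))"
  shows "((\<lambda>t. f (y + t *\<^sub>R axis i 1)) has_real_derivative pd i f (y + t *\<^sub>R axis i 1)) (at t)"
proof -
  let ?D = "frechet_derivative f (at (y + t *\<^sub>R axis i 1))"
  have D: "(f has_derivative ?D) (at (y + t *\<^sub>R axis i 1))"
    using assms by (simp add: frechet_derivative_works)
  have 1: "((\<lambda>t. y + t *\<^sub>R axis i 1) has_derivative (\<lambda>h. h *\<^sub>R axis i 1)) (at t)"
    by (auto intro!: derivative_eq_intros)
  show ?thesis
    using diff_chain_at[OF 1 D] unfolding has_field_derivative_def o_def pd_def
    by (rule has_derivative_eq_rhs) (simp add: linear_scale[OF has_derivative_linear[OF D]] mult.commute fun_eq_iff)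
qed

text \<open>The mean value theorem is used twice, along axis \<open>i\<close> and then along axis
  \<open>j\<close>. The second difference is symmetric in the two axes, so exchanging them yields
  the other mixed derivative at another intermediate point.\<close>

lemma second_difference:
  fixes f :: "real^2 \<Rightarrow> real"
  assumes f: "C1_on \<Omega> f" and fi: "C1_on \<Omega> (pd i f)"
    and h: "0 < h" and sub: "cball x (2 * h) \<subseteq> \<Omega>"
  shows "\<exists>p\<in>cball x (2 * h). f (x + h *\<^sub>R axis i 1 + h *\<^sub>R axis j 1) - f (x + h *\<^sub>R axis i 1)
    - f (x + h *\<^sub>R axis j 1) + f x = h * h * pd j (pd i f) p"
proof -
  have inc: "x + a *\<^sub>R axis i 1 + b *\<^sub>R axis j 1 \<in> cball x (2 * h)" if "0 \<le> a" "a \<le> h" "0 \<le> b" "b \<le> h" for a b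
  proof -
    have "norm (a *\<^sub>R axis i 1 + b *\<^sub>R axis j (1::real)) \<le> \<bar>a\<bar> + \<bar>b\<bar>"
      by (rule order_trans[OF norm_triangle_ineq]) simp
    then have "dist x (x + (a *\<^sub>R axis i 1 + b *\<^sub>R axis j 1)) \<le> 2 * h"
      unfolding dist_norm norm_minus_commute[of x] add_diff_cancel_left' using that by linarith
    then show ?thesis by (simp add: add.assoc)
  qed
  define \<phi> where "\<phi> t = f (x + h *\<^sub>R axis j 1 + t *\<^sub>R axis i 1) - f (x + t *\<^sub>R axis i 1)" for t
  have "\<exists>\<xi>>0. \<xi> < h \<and> \<phi> h - \<phi> 0 = (h - 0) *
      (pd i f (x + h *\<^sub>R axis j 1 + \<xi> *\<^sub>R axis i 1) - pd i f (x + \<xi> *\<^sub>R axis i 1))"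
  proof (rule MVT2[OF h])
    fix t assume t: "0 \<le> t" "t \<le> h"
    have "x + h *\<^sub>R axis j 1 + t *\<^sub>R axis i 1 \<in> \<Omega>" "x + t *\<^sub>R axis i 1 \<in> \<Omega>"
      using inc[of t h] inc[of t 0] t h sub by (auto simp: algebra_simps)
    then show "(\<phi> has_real_derivative (pd i f (x + h *\<^sub>R axis j 1 + t *\<^sub>R axis i 1) - pd i f (x + t *\<^sub>R axis i 1))) (at t)"
      unfolding \<phi>_def using f by (intro DERIV_diff DERIV_along_axis) (auto simp: C1_on_def)
  qed
  then obtain \<xi> where \<xi>: "0 < \<xi>" "\<xi> < h" and 1: "\<phi> h - \<phi> 0 = (h - 0) *
      (pd i f (x + h *\<^sub>R axis j 1 + \<xi> *\<^sub>R axis i 1) - pd i f (x + \<xi> *\<^sub>R axis i 1))"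
    by blast
  have "\<exists>\<zeta>>0. \<zeta> < h \<and> pd i f (x + \<xi> *\<^sub>R axis i 1 + h *\<^sub>R axis j 1) - pd i f (x + \<xi> *\<^sub>R axis i 1 + 0 *\<^sub>R axis j 1)
      = (h - 0) * pd j (pd i f) (x + \<xi> *\<^sub>R axis i 1 + \<zeta> *\<^sub>R axis j 1)"
  proof (rule MVT2[OF h])
    fix t assume t: "0 \<le> t" "t \<le> h"
    have "x + \<xi> *\<^sub>R axis i 1 + t *\<^sub>R axis j 1 \<in> \<Omega>"
      using inc[of \<xi> t] t \<xi> sub by auto
    then show "((\<lambda>t. pd i f (x + \<xi> *\<^sub>R axis i 1 + t *\<^sub>R axis j 1)) has_real_derivative
        pd j (pd i f) (x + \<xi> *\<^sub>R axis i 1 + t *\<^sub>R axis j 1)) (at t)"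
      using fi by (intro DERIV_along_axis) (auto simp: C1_on_def)
  qed
  then obtain \<zeta> where \<zeta>: "0 < \<zeta>" "\<zeta> < h" and 2: "pd i f (x + \<xi> *\<^sub>R axis i 1 + h *\<^sub>R axis j 1) - pd i f (x + \<xi> *\<^sub>R axis i 1 + 0 *\<^sub>R axis j 1)
      = (h - 0) * pd j (pd i f) (x + \<xi> *\<^sub>R axis i 1 + \<zeta> *\<^sub>R axis j 1)"
    by blast
  have "\<phi> h - \<phi> 0 = h * h * pd j (pd i f) (x + \<xi> *\<^sub>R axis i 1 + \<zeta> *\<^sub>R axis j 1)"
    using 1 2 by (simp add: add.assoc add.commute[of "h *\<^sub>R axis j 1"])
  moreover have "x + \<xi> *\<^sub>R axis i 1 + \<zeta> *\<^sub>R axis j 1 \<in> cball x (2 * h)"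
    using \<xi> \<zeta> by (intro inc) auto
  moreover have "\<phi> h - \<phi> 0 = f (x + h *\<^sub>R axis i 1 + h *\<^sub>R axis j 1) - f (x + h *\<^sub>R axis i 1)
    - f (x + h *\<^sub>R axis j 1) + f x"
    by (simp add: \<phi>_def algebra_simps)
  ultimately show ?thesis by (metis (no_types, lifting))
qed

text \<open>The second differences over shrinking squares equate the two mixed derivatives at points
  near \<open>x\<close>, possibly different ones; continuity equates them at
  \<open>x\<close>.\<close>

theorem pd_commute:
  fixes f :: "real^2 \<Rightarrow> real"
  assumes \<Omega>: "open \<Omega>" "x \<in> \<Omega>" and f: "C1_on \<Omega> f" and fi: "\<And>i. C1_on \<Omega> (pd i f)"
  shows "pd i (pd j f) x = pd j (pd i f) x"
proof -
  obtain r where r: "r > 0" "cball x r \<subseteq> \<Omega>" using \<Omega> open_contains_cball by blast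
  define h where "h n = r / 2 * (1 / real (Suc n))" for n
  have h: "0 < h n" "2 * h n \<le> r" for n
    using r by (auto simp: h_def field_simps)
  have h0: "h \<longlonglongrightarrow> r / 2 * 0"
    unfolding h_def using LIMSEQ_Suc[OF lim_1_over_n[where 'a = real]] by (intro tendsto_mult_left)
  have "\<exists>p q. p \<in> cball x (2 * h n) \<and> q \<in> cball x (2 * h n) \<and> pd j (pd i f) p = pd i (pd j f) q" for n
  proof -
    have sub: "cball x (2 * h n) \<subseteq> \<Omega>" using h(2)[of n] r(2) subset_cball by blast
    obtain p where p: "p \<in> cball x (2 * h n)" "f (x + h n *\<^sub>R axis i 1 + h n *\<^sub>R axis j 1) - f (x + h n *\<^sub>R axis i 1)
      - f (x + h n *\<^sub>R axis j 1) + f x = h n * h n * pd j (pd i f) p"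
      using second_difference[OF f fi h(1) sub] by blast
    obtain q where q: "q \<in> cball x (2 * h n)" "f (x + h n *\<^sub>R axis j 1 + h n *\<^sub>R axis i 1) - f (x + h n *\<^sub>R axis j 1)
      - f (x + h n *\<^sub>R axis i 1) + f x = h n * h n * pd i (pd j f) q"
      using second_difference[OF f fi h(1) sub] by blast
    have "h n * h n * pd j (pd i f) p = h n * h n * pd i (pd j f) q"
      unfolding p(2)[symmetric] q(2)[symmetric]
      by (simp add: add.assoc add.commute[of "h n *\<^sub>R axis j 1" "h n *\<^sub>R axis i 1"])
    then have "pd j (pd i f) p = pd i (pd j f) q" using h(1)[of n] by simp
    with p q show ?thesis by blast
  qed
  then obtain p q where pq: "\<And>n. p n \<in> cball x (2 * h n)" "\<And>n. q n \<in> cball x (2 * h n)"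
    "\<And>n. pd j (pd i f) (p n) = pd i (pd j f) (q n)"
    by metis
  have conv: "c \<longlonglongrightarrow> x" if "\<And>n. c n \<in> cball x (2 * h n)" for c
  proof (rule metric_tendsto_imp_tendsto)
    have "(\<lambda>n. 2 * h n) \<longlonglongrightarrow> 2 * (r / 2 * 0)" by (intro tendsto_mult_left h0)
    then show "(\<lambda>n. 2 * h n) \<longlonglongrightarrow> 0" by simp
    show "\<forall>\<^sub>F n in sequentially. dist (c n) x \<le> dist (2 * h n) 0"
      using that h(1) by (intro always_eventually) (auto simp: dist_commute less_imp_le)
  qed
  have cont: "isCont (pd k (pd l f)) x" for k l
    using C1_on_pd_continuous[OF fi] \<Omega> by (simp add: continuous_on_eq_continuous_at)
  have "(\<lambda>n. pd j (pd i f) (p n)) \<longlonglongrightarrow> pd j (pd i f) x"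
    by (rule isCont_tendsto_compose[OF cont conv[OF pq(1)]])
  moreover have "(\<lambda>n. pd i (pd j f) (q n)) \<longlonglongrightarrow> pd i (pd j f) x"
    by (rule isCont_tendsto_compose[OF cont conv[OF pq(2)]])
  ultimately show ?thesis unfolding pq(3) by (metis LIMSEQ_unique)
qed

lemma scurl_nth [simp]: "scurl \<phi> x $ 1 = pd 2 \<phi> x" "scurl \<phi> x $ 2 = - pd 1 \<phi> x"
  by (simp_all add: scurl_def)

theorem divergence_scurl:
  assumes \<Omega>: "open \<Omega>" "x \<in> \<Omega>" and f: "C1_on \<Omega> f" and s: "C1_on \<Omega> (scurl f)"
  shows "divergence (scurl f) x = 0"
proof -
  have c: "C1_on \<Omega> (\<lambda>x. scurl f x $ k)" for k
    by (rule C1_on_linear[OF bounded_linear_vec_nth s])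
  have p2: "C1_on \<Omega> (pd 2 f)" using c[of 1] by simp
  have p1: "C1_on \<Omega> (pd 1 f)" using C1_on_linear[OF bounded_linear_minus[OF bounded_linear_ident] c[of 2]] by simp
  have "C1_on \<Omega> (pd i f)" for i using p1 p2 exhaust_2[of i] by auto
  from pd_commute[OF \<Omega> f this] have comm: "pd 1 (pd 2 f) x = pd 2 (pd 1 f) x" .
  have d: "scurl f differentiable (at x)" using s \<Omega> by (simp add: C1_on_def)
  have d1: "pd 1 f differentiable (at x)" using p1 \<Omega> by (simp add: C1_on_def)
  have "pd 1 (scurl f) x $ 1 = pd 1 (pd 2 f) x"
    using pd_nth[OF d, of 1 1] by simp
  moreover have "pd 2 (scurl f) x $ 2 = - pd 2 (pd 1 f) x"
    using pd_nth[OF d, of 2 2] pd_linear[OF bounded_linear_minus[OF bounded_linear_ident] d1, of 2] by simp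
  ultimately show ?thesis using comm by (simp add: divergence_def sum_2)
qed

section \<open>Energy estimate\<close>

text \<open>The class of integrands. Continuity on the closure would ask too much: \<open>pd\<close>
  at a frontier point depends on values outside the closure, and second derivatives need not extend.
  Boundedness survives sums and products and gives integrability on a bounded domain.\<close>

definition bcont :: "(real^2) set \<Rightarrow> (real^2 \<Rightarrow> 'a::real_normed_vector) \<Rightarrow> bool"
  where "bcont \<Omega> f \<longleftrightarrow> continuous_on \<Omega> f \<and> bounded (f ` \<Omega>)"

lemma bcont_cong: "(\<And>x. x \<in> \<Omega> \<Longrightarrow> f x = g x) \<Longrightarrow> bcont \<Omega> f \<longleftrightarrow> bcont \<Omega> g"
  unfolding bcont_def by (simp cong: continuous_on_cong image_cong)

lemma bcont_transform: "bcont \<Omega> f \<Longrightarrow> (\<And>x. x \<in> \<Omega> \<Longrightarrow> g x = f x) \<Longrightarrow> bcont \<Omega> g"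
  using bcont_cong[of \<Omega> g f] by blast

lemma bcont_closure:
  assumes "bounded \<Omega>" and "continuous_on (closure \<Omega>) f"
  shows "bcont \<Omega> f"
  unfolding bcont_def
proof
  show "continuous_on \<Omega> f" using assms(2) closure_subset by (rule continuous_on_subset)
  have "compact (f ` closure \<Omega>)"
    using assms by (intro compact_continuous_image) (auto simp: compact_closure)
  then show "bounded (f ` \<Omega>)"
    by (meson bounded_subset closure_subset compact_imp_bounded image_mono)
qed

lemma bcont_bilinear:
  assumes h: "bounded_bilinear h" and f: "bcont \<Omega> f" and g: "bcont \<Omega> g"
  shows "bcont \<Omega> (\<lambda>x. h (f x) (g x))"
proof -
  obtain A where A: "\<And>x. x \<in> \<Omega> \<Longrightarrow> norm (f x) \<le> A" using f unfolding bcont_def bounded_iff by blast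
  obtain B where B: "\<And>x. x \<in> \<Omega> \<Longrightarrow> norm (g x) \<le> B" using g unfolding bcont_def bounded_iff by blast
  obtain K where K: "0 \<le> K" "\<And>a b. norm (h a b) \<le> norm a * norm b * K"
    using bounded_bilinear.nonneg_bounded[OF h] by blast
  have "norm (h (f x) (g x)) \<le> A * B * K" if "x \<in> \<Omega>" for x
    by (rule order_trans[OF K(2)])
       (use A[OF that] B[OF that] K(1) in \<open>auto intro!: mult_right_mono mult_mono intro: order_trans[OF norm_ge_zero]\<close>)
  then have "bounded ((\<lambda>x. h (f x) (g x)) ` \<Omega>)" unfolding bounded_iff by blast
  then show ?thesis using f g unfolding bcont_def by (auto intro: bounded_bilinear.continuous_on[OF h])
qed

lemma bcont_linear:
  assumes "bounded_linear h" and "bcont \<Omega> f"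
  shows "bcont \<Omega> (\<lambda>x. h (f x))"
  using assms bounded_linear_image[OF _ assms(1), of "f ` \<Omega>"]
  unfolding bcont_def by (auto simp: image_image intro: bounded_linear.continuous_on)

lemma bcont_add:
  assumes "bcont \<Omega> f" and "bcont \<Omega> g"
  shows "bcont \<Omega> (\<lambda>x. f x + g x)"
  using assms unfolding bcont_def by (auto intro: continuous_on_add bounded_plus_comp)

lemma bcont_minus: "bcont \<Omega> f \<Longrightarrow> bcont \<Omega> (\<lambda>x. - f x)"
  by (rule bcont_linear[OF bounded_linear_minus[OF bounded_linear_ident]])

lemma bcont_diff: "bcont \<Omega> f \<Longrightarrow> bcont \<Omega> g \<Longrightarrow> bcont \<Omega> (\<lambda>x. f x - g x)"
  using bcont_add[OF _ bcont_minus, of \<Omega> f g] by simp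

lemma bcont_const: "bcont \<Omega> (\<lambda>_. c)"
  unfolding bcont_def bounded_iff by auto

lemmas bcont_inner = bcont_bilinear[OF bounded_bilinear_inner]
  and bcont_mult = bcont_bilinear[OF bounded_bilinear_mult]
  and bcont_scaleR = bcont_bilinear[OF bounded_bilinear_scaleR]
  and bcont_nth = bcont_linear[OF bounded_linear_vec_nth]

lemmas bcont_intros = bcont_add bcont_diff bcont_minus bcont_const bcont_inner bcont_mult bcont_scaleR bcont_nth

lemma bcont_integrable:
  fixes f :: "real^2 \<Rightarrow> real"
  assumes "open \<Omega>" and "bounded \<Omega>" and "bcont \<Omega> f"
  shows "set_integrable lborel \<Omega> f"
proof -
  obtain A where "\<And>x. x \<in> \<Omega> \<Longrightarrow> \<bar>f x\<bar> \<le> A"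
    using assms(3) unfolding bcont_def bounded_iff by auto
  then show ?thesis
    using assms by (intro set_integrable_bounded_continuous) (auto simp: bcont_def)
qed

lemma bcont_set_integral:
  fixes f g :: "real^2 \<Rightarrow> real"
  assumes "open \<Omega>" and "bounded \<Omega>" and f: "bcont \<Omega> f" and g: "bcont \<Omega> g"
  shows "(LINT x:\<Omega>|lborel. f x + g x) = (LINT x:\<Omega>|lborel. f x) + (LINT x:\<Omega>|lborel. g x)"
    and "(LINT x:\<Omega>|lborel. f x - g x) = (LINT x:\<Omega>|lborel. f x) - (LINT x:\<Omega>|lborel. g x)"
  using bcont_integrable[OF assms(1,2) f] bcont_integrable[OF assms(1,2) g]
  by (rule set_integral_add set_integral_diff)+

lemma L2norm_square:
  "(L2norm \<Omega> f)\<^sup>2 = (LINT x:\<Omega>|lborel. (norm (f x))\<^sup>2)"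
  unfolding L2norm_def set_lebesgue_integral_def
  by (intro real_sqrt_pow2 Bochner_Integration.integral_nonneg) (simp add: indicator_def)

lemma null_divergence_integral:
  fixes F :: "real^2 \<Rightarrow> real^2"
  assumes dom: "bounded_lipschitz_domain \<Omega>"
    and C1: "C1_on \<Omega> F" and cont: "continuous_on (closure \<Omega>) F" and trace: "zero_normal_trace \<Omega> F"
    and N: "\<And>x. x \<in> \<Omega> \<Longrightarrow> divergence F x = N x" and bc: "bcont \<Omega> N"
  shows "(LINT x:\<Omega>|lborel. N x) = 0"
proof -
  have \<Omega>: "open \<Omega>" using dom by (simp add: bounded_lipschitz_domain_def)
  obtain A where A: "\<And>x. x \<in> \<Omega> \<Longrightarrow> \<bar>N x\<bar> \<le> A"
    using bc unfolding bcont_def bounded_iff by auto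
  have "(LINT x:\<Omega>|lborel. N x) = (LINT x:\<Omega>|lborel. divergence F x)"
    using N \<Omega> by (intro set_lebesgue_integral_cong) auto
  also have "\<dots> = 0"
    using A N by (intro divergence_theorem_zero_trace[OF dom C1 cont _ trace, of A]) auto
  finally show ?thesis .
qed

lemma zero_normal_trace_frontier:
  assumes "\<And>x. x \<in> frontier \<Omega> \<Longrightarrow> F x = 0"
  shows "zero_normal_trace \<Omega> F"
  using assms by (auto simp: zero_normal_trace_def outward_unit_normal_def)

lemma C1_closureD:
  assumes "C1_closure \<Omega> f" and "bounded \<Omega>"
  shows "C1_on \<Omega> f" and "continuous_on (closure \<Omega>) f" and "bcont \<Omega> f" and "bcont \<Omega> (pd i f)"
proof -
  show "C1_on \<Omega> f" and c: "continuous_on (closure \<Omega>) f" using assms(1) by (auto simp: C1_closure_def)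
  show "bcont \<Omega> f" by (rule bcont_closure[OF assms(2) c])
  obtain h where h: "continuous_on (closure \<Omega>) h" "\<And>x. x \<in> \<Omega> \<Longrightarrow> h x = pd i f x"
    using assms(1) unfolding C1_closure_def by blast
  have "bcont \<Omega> h" by (rule bcont_closure[OF assms(2) h(1)])
  then show "bcont \<Omega> (pd i f)" using bcont_cong[of \<Omega> h "pd i f"] h(2) by simp
qed

lemma first_order_regularD:
  assumes "first_order_regular \<Omega> f" and "bounded \<Omega>"
  shows "C1_on \<Omega> f" and "continuous_on (closure \<Omega>) f" and "bcont \<Omega> f"
  using assms bcont_closure by (auto simp: first_order_regular_def)

lemma second_order_imp_first_order: "second_order_regular \<Omega> f \<Longrightarrow> first_order_regular \<Omega> f"
  by (simp add: second_order_regular_def first_order_regular_def C1_closure_def)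

lemma C1_on_differentiable: "C1_on \<Omega> f \<Longrightarrow> x \<in> \<Omega> \<Longrightarrow> f differentiable (at x)"
  by (simp add: C1_on_def)

lemma grad_nth [simp]: "grad f x $ i = pd i f x"
  by (simp add: grad_def)

lemma bcont_componentwise:
  fixes F :: "real^2 \<Rightarrow> real^2"
  assumes "bcont \<Omega> (\<lambda>x. F x $ 1)" and "bcont \<Omega> (\<lambda>x. F x $ 2)"
  shows "bcont \<Omega> F"
proof -
  have "bcont \<Omega> (\<lambda>x. F x $ 1 *\<^sub>R axis 1 1 + F x $ 2 *\<^sub>R (axis 2 1 :: real^2))"
    by (intro bcont_intros assms)
  moreover have "F x = F x $ 1 *\<^sub>R axis 1 1 + F x $ 2 *\<^sub>R axis 2 1" for x
    by (simp add: vec_eq_iff forall_2)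
  ultimately show ?thesis by (metis (no_types, lifting) bcont_cong)
qed

lemma bcont_grad: "(\<And>i. bcont \<Omega> (pd i f)) \<Longrightarrow> bcont \<Omega> (grad f)"
  by (rule bcont_componentwise) simp_all

section \<open>The four integrations by parts\<close>

text \<open>A quarter turn. It converts tangential traces into normal ones and turns the curl into
  minus a divergence, so that the divergence theorem also covers the magnetic field.\<close>

definition rot :: "real^2 \<Rightarrow> real^2"
  where "rot v = (- v $ 2) *\<^sub>R axis 1 1 + v $ 1 *\<^sub>R axis 2 1"

lemma rot_nth [simp]: "rot v $ 1 = - v $ 2" "rot v $ 2 = v $ 1"
  by (simp_all add: rot_def)

lemma bounded_linear_rot: "bounded_linear rot"
  unfolding rot_def
  by (intro bounded_linear_add bounded_linear_scaleR_const bounded_linear_minus bounded_linear_vec_nth)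

lemma rot_inner: "rot v \<bullet> n = vcross v n"
  by (simp add: inner_vec_def sum_2 vcross_def)

text \<open>The flux field is \<phi> rot B, whose normal trace is \<phi> times the tangential trace
  of \<open>B\<close>.\<close>

lemma curl_integral_by_parts:
  assumes dom: "bounded_lipschitz_domain \<Omega>"
    and \<phi>: "C1_on \<Omega> \<phi>" "continuous_on (closure \<Omega>) \<phi>" and B: "C1_on \<Omega> B" "continuous_on (closure \<Omega>) B"
    and trace: "zero_tangential_trace \<Omega> B"
    and bc: "bcont \<Omega> (\<lambda>x. scurl \<phi> x \<bullet> B x - \<phi> x * curl B x)"
  shows "(LINT x:\<Omega>|lborel. scurl \<phi> x \<bullet> B x - \<phi> x * curl B x) = 0"
proof (rule null_divergence_integral[OF dom _ _ _ _ bc])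
  have r: "C1_on \<Omega> (\<lambda>x. rot (B x))" by (rule C1_on_linear[OF bounded_linear_rot B(1)])
  show "C1_on \<Omega> (\<lambda>x. \<phi> x *\<^sub>R rot (B x))" by (rule C1_on_bilinear[OF bounded_bilinear_scaleR \<phi>(1) r])
  show "continuous_on (closure \<Omega>) (\<lambda>x. \<phi> x *\<^sub>R rot (B x))"
    by (intro continuous_on_scaleR \<phi>(2) bounded_linear.continuous_on[OF bounded_linear_rot B(2)])
  show "zero_normal_trace \<Omega> (\<lambda>x. \<phi> x *\<^sub>R rot (B x))"
    using trace by (auto simp: zero_normal_trace_def zero_tangential_trace_def rot_inner)
  show "divergence (\<lambda>x. \<phi> x *\<^sub>R rot (B x)) x = scurl \<phi> x \<bullet> B x - \<phi> x * curl B x" if x: "x \<in> \<Omega>" for x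
  proof -
    have dB: "B differentiable (at x)" by (rule C1_on_differentiable[OF B(1) x])
    have "divergence (\<lambda>x. rot (B x)) x = - curl B x"
      by (simp add: divergence_def sum_2 pd_linear[OF bounded_linear_rot dB] curl_def)
    then show ?thesis
      using divergence_scaleR[OF C1_on_differentiable[OF \<phi>(1) x] C1_on_differentiable[OF r x]]
      by (simp add: inner_vec_def sum_2)
  qed
qed

text \<open>The flux field is |v|^2 u / 2. As \<open>u\<close> is solenoidal, its divergence is the
  convective term tested with \<open>v\<close>; on the boundary it vanishes together with
  \<open>v\<close>.\<close>

lemma convection_integral_zero:
  assumes dom: "bounded_lipschitz_domain \<Omega>"
    and u: "C1_on \<Omega> u" "continuous_on (closure \<Omega>) u" and div: "\<And>x. x \<in> \<Omega> \<Longrightarrow> divergence u x = 0"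
    and v: "C1_on \<Omega> v" "continuous_on (closure \<Omega>) v" and zero: "\<And>x. x \<in> frontier \<Omega> \<Longrightarrow> v x = 0"
    and bc: "bcont \<Omega> (\<lambda>x. conv u v x \<bullet> v x)"
  shows "(LINT x:\<Omega>|lborel. conv u v x \<bullet> v x) = 0"
proof (rule null_divergence_integral[OF dom _ _ _ _ bc])
  have vv: "C1_on \<Omega> (\<lambda>x. v x \<bullet> v x)" by (rule C1_on_bilinear[OF bounded_bilinear_inner v(1) v(1)])
  have \<psi>: "C1_on \<Omega> (\<lambda>x. (1/2) * (v x \<bullet> v x))"
    by (rule C1_on_linear[OF bounded_linear_mult_right vv])
  show "C1_on \<Omega> (\<lambda>x. ((1/2) * (v x \<bullet> v x)) *\<^sub>R u x)"
    by (rule C1_on_bilinear[OF bounded_bilinear_scaleR \<psi> u(1)])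
  show "continuous_on (closure \<Omega>) (\<lambda>x. ((1/2) * (v x \<bullet> v x)) *\<^sub>R u x)"
    by (intro continuous_intros u v)
  show "zero_normal_trace \<Omega> (\<lambda>x. ((1/2) * (v x \<bullet> v x)) *\<^sub>R u x)"
    by (rule zero_normal_trace_frontier) (simp add: zero)
  show "divergence (\<lambda>x. ((1/2) * (v x \<bullet> v x)) *\<^sub>R u x) x = conv u v x \<bullet> v x" if x: "x \<in> \<Omega>" for x
  proof -
    have dv: "v differentiable (at x)" by (rule C1_on_differentiable[OF v(1) x])
    have "pd i (\<lambda>x. (1/2) * (v x \<bullet> v x)) x = v x \<bullet> pd i v x" for i
      using pd_linear[OF bounded_linear_mult_right C1_on_differentiable[OF vv x], of i "1/2"]
        pd_bilinear[OF bounded_bilinear_inner dv dv, of i] by (simp add: inner_commute)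
    then show ?thesis
      using divergence_scaleR[OF C1_on_differentiable[OF \<psi> x] C1_on_differentiable[OF u(1) x]] div[OF x]
      by (simp add: conv_def sum_2 inner_simps inner_commute algebra_simps)
  qed
qed

lemma norm_vgrad_square:
  "(norm (vgrad v x))\<^sup>2 = pd 1 v x \<bullet> pd 1 v x + pd 2 v x \<bullet> pd 2 v x"
proof -
  have "vgrad v x $ i $ j = pd j v x $ i" for i j
    by (simp add: vgrad_def jacobian_def matrix_def pd_def)
  then show ?thesis
    by (simp add: power2_norm_eq_inner inner_vec_def sum_2)
qed

text \<open>The flux field is the gradient of |v|^2 / 2, which carries the factor \<open>v\<close>
  and so vanishes on the boundary.\<close>

lemma laplacian_integral_by_parts:
  assumes dom: "bounded_lipschitz_domain \<Omega>"
    and v: "second_order_regular \<Omega> v" and zero: "\<And>x. x \<in> frontier \<Omega> \<Longrightarrow> v x = 0"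
    and bc: "bcont \<Omega> (\<lambda>x. laplacian v x \<bullet> v x + (norm (vgrad v x))\<^sup>2)"
  shows "(LINT x:\<Omega>|lborel. laplacian v x \<bullet> v x + (norm (vgrad v x))\<^sup>2) = 0"
proof -
  have \<Omega>: "open \<Omega>" "bounded \<Omega>" using dom by (auto simp: bounded_lipschitz_domain_def)
  have C1: "C1_on \<Omega> v" and C1': "C1_on \<Omega> (pd i v)" and cc: "C1_closure \<Omega> v" for i
    using v by (auto simp: second_order_regular_def C2_on_def)
  have contv: "continuous_on (closure \<Omega>) v" by (rule C1_closureD[OF cc \<Omega>(2)])
  obtain h :: "2 \<Rightarrow> real^2 \<Rightarrow> real^2" where h: "\<And>i. continuous_on (closure \<Omega>) (h i)" "\<And>i x. x \<in> \<Omega> \<Longrightarrow> h i x = pd i v x"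
    using cc unfolding C1_closure_def by metis
  \<comment> \<open>On the frontier \<open>pd i v\<close> is uncontrolled, so \<open>F\<close> is
    built from the continuous extensions \<open>h\<close>, while \<open>F'\<close> is the formula to
    be differentiated inside \<Omega>.\<close>
  define F where "F x = (v x \<bullet> h 1 x) *\<^sub>R axis 1 1 + (v x \<bullet> h 2 x) *\<^sub>R (axis 2 1 :: real^2)" for x
  define F' where "F' x = (v x \<bullet> pd 1 v x) *\<^sub>R axis 1 1 + (v x \<bullet> pd 2 v x) *\<^sub>R (axis 2 1 :: real^2)" for x
  have FF': "F' x = F x" if "x \<in> \<Omega>" for x using h(2)[OF that] by (simp add: F_def F'_def)
  have q: "C1_on \<Omega> (\<lambda>x. v x \<bullet> pd i v x)" for i by (rule C1_on_bilinear[OF bounded_bilinear_inner C1 C1'])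
  have C1F': "C1_on \<Omega> F'"
    unfolding F'_def
    by (intro C1_on_add C1_on_linear[OF bounded_linear_scaleR_left] q)
  show ?thesis
  proof (rule null_divergence_integral[OF dom _ _ _ _ bc])
    show "C1_on \<Omega> F" by (rule C1_on_transform[OF C1F' \<Omega>(1) FF'])
    show "continuous_on (closure \<Omega>) F" unfolding F_def by (intro continuous_intros h contv)
    show "zero_normal_trace \<Omega> F" by (rule zero_normal_trace_frontier) (simp add: F_def zero)
    show "divergence F x = laplacian v x \<bullet> v x + (norm (vgrad v x))\<^sup>2" if x: "x \<in> \<Omega>" for x
    proof -
      have "divergence F x = divergence F' x"
        by (rule divergence_cong[OF \<Omega>(1) x]) (simp add: FF')
      also have "\<dots> = pd 1 (\<lambda>x. F' x $ 1) x + pd 2 (\<lambda>x. F' x $ 2) x"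
        using pd_nth[OF C1_on_differentiable[OF C1F' x]] by (simp add: divergence_def sum_2)
      also have "\<dots> = pd 1 (\<lambda>x. v x \<bullet> pd 1 v x) x + pd 2 (\<lambda>x. v x \<bullet> pd 2 v x) x"
        by (simp add: F'_def)
      also have "\<dots> = laplacian v x \<bullet> v x + (norm (vgrad v x))\<^sup>2"
        using pd_bilinear[OF bounded_bilinear_inner C1_on_differentiable[OF C1 x] C1_on_differentiable[OF C1' x]]
        by (simp add: norm_vgrad_square laplacian_def sum_2 inner_simps inner_commute)
      finally show ?thesis .
    qed
  qed
qed

text \<open>The flux field is p u, whose divergence reduces to the gradient term because
  \<open>u\<close> is solenoidal.\<close>

lemma gradient_orthogonal_solenoidal:
  assumes dom: "bounded_lipschitz_domain \<Omega>"
    and p: "C1_on \<Omega> p" "continuous_on (closure \<Omega>) p"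
    and u: "C1_on \<Omega> u" "continuous_on (closure \<Omega>) u" and div: "\<And>x. x \<in> \<Omega> \<Longrightarrow> divergence u x = 0"
    and trace: "zero_normal_trace \<Omega> u"
    and bc: "bcont \<Omega> (\<lambda>x. grad p x \<bullet> u x)"
  shows "(LINT x:\<Omega>|lborel. grad p x \<bullet> u x) = 0"
proof (rule null_divergence_integral[OF dom _ _ _ _ bc])
  show "C1_on \<Omega> (\<lambda>x. p x *\<^sub>R u x)" by (rule C1_on_bilinear[OF bounded_bilinear_scaleR p(1) u(1)])
  show "continuous_on (closure \<Omega>) (\<lambda>x. p x *\<^sub>R u x)" by (intro continuous_intros p u)
  show "zero_normal_trace \<Omega> (\<lambda>x. p x *\<^sub>R u x)" using trace by (simp add: zero_normal_trace_def)
  show "divergence (\<lambda>x. p x *\<^sub>R u x) x = grad p x \<bullet> u x" if x: "x \<in> \<Omega>" for x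
    using divergence_scaleR[OF C1_on_differentiable[OF p(1) x] C1_on_differentiable[OF u(1) x]] div[OF x]
    by (simp add: inner_vec_def sum_2)
qed

lemma vcross_bilinear: "bounded_bilinear vcross"
proof -
  have "bounded_bilinear (\<lambda>a b. rot a \<bullet> b)"
    using bounded_bilinear.comp[OF bounded_bilinear_inner bounded_linear_rot bounded_linear_ident] .
  then show ?thesis by (simp add: rot_inner)
qed

text \<open>Faraday's law in the plane, with \<phi> the out-of-plane electric field. Keeping \<phi>
  as one function pays off: its curl is a difference quotient of magnetic fields, hence bounded and
  continuously differentiable, which \<open>scurl (curl B')\<close> alone need not be. Both the
  energy estimate and the solenoidal constraint rest on this.\<close>

lemma magnetic_potential:
  fixes u B us B' :: "real^2 \<Rightarrow> real^2"
  assumes \<Omega>: "open \<Omega>" "bounded \<Omega>" and \<delta>t: "\<delta>t > 0"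
    and B: "first_order_regular \<Omega> B"
    and step: "magnetic_step \<Omega> \<eta> s \<delta>t u B us B'"
  defines "\<phi> \<equiv> \<lambda>x. \<eta> * curl B' x - vcross (us x) (B x)"
  shows "C1_on \<Omega> \<phi>"
    and "\<And>x. x \<in> \<Omega> \<Longrightarrow> scurl \<phi> x = (1 / \<delta>t) *\<^sub>R (B x - B' x)"
proof -
  have us: "first_order_regular \<Omega> us" and C2: "C1_on \<Omega> (pd i B')" for i
    using step by (auto simp: magnetic_step_def second_order_regular_def C2_on_def)
  have c: "C1_on \<Omega> (curl B')"
    unfolding curl_def by (intro C1_on_diff C1_on_linear[OF bounded_linear_vec_nth] C2)
  have x: "C1_on \<Omega> (\<lambda>x. vcross (us x) (B x))"
    using us B by (intro C1_on_bilinear[OF vcross_bilinear]) (auto simp: first_order_regular_def)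
  have ec: "C1_on \<Omega> (\<lambda>x. \<eta> * curl B' x)" by (rule C1_on_linear[OF bounded_linear_mult_right c])
  show "C1_on \<Omega> \<phi>" unfolding \<phi>_def by (rule C1_on_diff[OF ec x])
  fix y assume y: "y \<in> \<Omega>"
  have "pd i \<phi> y = \<eta> * pd i (curl B') y - pd i (\<lambda>x. vcross (us x) (B x)) y" for i
    unfolding \<phi>_def
    using pd_diff[OF C1_on_differentiable[OF ec y] C1_on_differentiable[OF x y], of i]
      pd_linear[OF bounded_linear_mult_right C1_on_differentiable[OF c y], of i \<eta>] by simp
  then have "scurl \<phi> y = \<eta> *\<^sub>R scurl (curl B') y - scurl (\<lambda>x. vcross (us x) (B x)) y"
    by (simp add: vec_eq_iff forall_2)
  moreover have "(1 / \<delta>t) *\<^sub>R (B' y - B y) + \<eta> *\<^sub>R scurl (curl B') y - scurl (\<lambda>y. vcross (us y) (B y)) y = 0"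
    using step y by (simp add: magnetic_step_def)
  ultimately have "(1 / \<delta>t) *\<^sub>R (B' y - B y) + scurl \<phi> y = 0"
    by (simp only: add_diff_eq)
  then show "scurl \<phi> y = (1 / \<delta>t) *\<^sub>R (B y - B' y)"
    by (simp only: add_eq_0_iff scaleR_minus_right[symmetric] minus_diff_eq)
qed

lemma magnetic_step_divergence:
  assumes \<Omega>: "open \<Omega>" "bounded \<Omega>" and \<delta>t: "\<delta>t > 0"
    and B: "first_order_regular \<Omega> B"
    and step: "magnetic_step \<Omega> \<eta> s \<delta>t u B us B'" and x: "x \<in> \<Omega>"
  shows "divergence B' x = divergence B x"
proof -
  define \<phi> where "\<phi> = (\<lambda>x. \<eta> * curl B' x - vcross (us x) (B x))"
  note pot = magnetic_potential[OF \<Omega> \<delta>t B step, folded \<phi>_def]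
  have CB: "C1_on \<Omega> B" using B by (simp add: first_order_regular_def)
  have CB': "C1_on \<Omega> B'" using step by (simp add: magnetic_step_def second_order_regular_def C2_on_def)
  have d: "C1_on \<Omega> (\<lambda>x. B x - B' x)" by (rule C1_on_diff[OF CB CB'])
  have e: "C1_on \<Omega> (\<lambda>x. (1 / \<delta>t) *\<^sub>R (B x - B' x))" by (rule C1_on_linear[OF bounded_linear_scaleR_right d])
  have "C1_on \<Omega> (scurl \<phi>)" by (rule C1_on_transform[OF e \<Omega>(1)]) (simp add: pot(2))
  then have "0 = divergence (scurl \<phi>) x" using divergence_scurl[OF \<Omega>(1) x pot(1)] by simp
  also have "\<dots> = divergence (\<lambda>x. (1 / \<delta>t) *\<^sub>R (B x - B' x)) x"
    by (rule divergence_cong[OF \<Omega>(1) x pot(2)])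
  also have "\<dots> = (1 / \<delta>t) * (divergence B x - divergence B' x)"
    unfolding divergence_def sum_2 pd_linear[OF bounded_linear_scaleR_right C1_on_differentiable[OF d x]]
      pd_diff[OF C1_on_differentiable[OF CB x] C1_on_differentiable[OF CB' x]]
    by (simp add: add_divide_distrib diff_divide_distrib)
  finally show ?thesis using \<delta>t by simp
qed

section \<open>The discrete energy balance\<close>

text \<open>The right-hand side groups the terms into the four expressions whose integrals vanish.
  The discarded squares are those of \<open>us - u\<close>, \<open>B - B'\<close> and
  \<open>us - ut'\<close>. The number \<open>n2\<close> is added on both sides; it will be the
  squared norm of the gradient of \<open>ut'\<close>, which matches the Laplacian only after
  integration.\<close>

lemma energy_identity_pointwise:
  fixes B B' u u' us ut' gp gp' cv lap scurl\<phi> :: "real^2" and c n2 \<phi> s \<eta> \<nu> \<delta>t :: real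
  assumes \<delta>t: "\<delta>t > 0" and s: "s > 0"
    and \<phi>: "\<phi> = \<eta> * c - vcross us B"
    and m1: "scurl\<phi> = (1 / \<delta>t) *\<^sub>R (B - B')"
    and m2: "(1 / \<delta>t) *\<^sub>R (us - u) + s *\<^sub>R vcross_scalar B c = 0"
    and m3: "(1 / \<delta>t) *\<^sub>R (ut' - us) + cv - \<nu> *\<^sub>R lap + gp = 0"
    and m4: "(1 / \<delta>t) *\<^sub>R (u' - ut') + (gp' - gp) = 0"
  shows "s * (B' \<bullet> B') + u' \<bullet> u' + \<delta>t\<^sup>2 * (gp' \<bullet> gp') + 2 * \<delta>t * (s * \<eta> * c\<^sup>2 + \<nu> * n2)
    - (s * (B \<bullet> B) + u \<bullet> u + \<delta>t\<^sup>2 * (gp \<bullet> gp))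
    \<le> - (2 * \<delta>t * s) * (scurl\<phi> \<bullet> B' - \<phi> * c) - 2 * \<delta>t * (cv \<bullet> ut')
      + 2 * \<delta>t * \<nu> * (lap \<bullet> ut' + n2) - 2 * \<delta>t * (gp' \<bullet> u')"
proof -
  have e1: "\<delta>t *\<^sub>R scurl\<phi> = B - B'" using m1 \<delta>t by simp
  have clear: "X + \<delta>t *\<^sub>R Y = 0" if "(1 / \<delta>t) *\<^sub>R X + Y = 0" for X Y :: "real^2"
  proof -
    have "\<delta>t *\<^sub>R ((1 / \<delta>t) *\<^sub>R X + Y) = 0" using that by simp
    then show ?thesis using \<delta>t by (simp add: scaleR_add_right)
  qed
  have e2: "us = u - \<delta>t *\<^sub>R (s *\<^sub>R vcross_scalar B c)"
    using clear[OF m2] by (simp add: algebra_simps)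
  have "(1 / \<delta>t) *\<^sub>R (ut' - us) + (cv - \<nu> *\<^sub>R lap + gp) = 0" using m3 by (simp add: algebra_simps)
  from clear[OF this] have e3: "us = ut' + \<delta>t *\<^sub>R (cv - \<nu> *\<^sub>R lap + gp)"
    by (simp add: algebra_simps)
  have e4: "ut' = u' + \<delta>t *\<^sub>R (gp' - gp)" using clear[OF m4] by (simp add: algebra_simps)
  have cross: "vcross_scalar B c \<bullet> us = c * vcross us B"
    by (simp add: vcross_scalar_def vcross_def inner_vec_def sum_2 algebra_simps)
  have "2 * ((us - u) \<bullet> us) = - (2 * \<delta>t * s) * (c * vcross us B)"
  proof -
    have "us - u = - (\<delta>t * s) *\<^sub>R vcross_scalar B c"
      using e2 by simp
    then show ?thesis using cross by simp
  qed
  moreover have "2 * ((us - u) \<bullet> us) = us \<bullet> us - u \<bullet> u + (us - u) \<bullet> (us - u)"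
    by (simp add: inner_simps inner_commute)
  ultimately have A: "us \<bullet> us - u \<bullet> u \<le> - (2 * \<delta>t * s) * (c * vcross us B)"
    using inner_ge_zero[of "us - u"] by linarith
  have "2 * ((B - B') \<bullet> B') = B \<bullet> B - B' \<bullet> B' - (B - B') \<bullet> (B - B')"
    by (simp add: inner_simps inner_commute)
  moreover have "(B - B') \<bullet> B' = \<delta>t * (scurl\<phi> \<bullet> B')" unfolding e1[symmetric] by simp
  ultimately have "B' \<bullet> B' - B \<bullet> B \<le> - (2 * \<delta>t * (scurl\<phi> \<bullet> B'))"
    using inner_ge_zero[of "B - B'"] by linarith
  then have "s * (B' \<bullet> B' - B \<bullet> B) \<le> s * (- (2 * \<delta>t * (scurl\<phi> \<bullet> B')))"
    using s by (intro mult_left_mono) auto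
  moreover have "s * (- (2 * \<delta>t * (scurl\<phi> \<bullet> B'))) = - (2 * \<delta>t * s) * (scurl\<phi> \<bullet> B' - \<phi> * c)
      - 2 * \<delta>t * (s * \<eta> * c\<^sup>2) + 2 * \<delta>t * s * (c * vcross us B)"
    unfolding \<phi> by (simp add: algebra_simps power2_eq_square)
  ultimately have B: "s * (B' \<bullet> B') - s * (B \<bullet> B) \<le> - (2 * \<delta>t * s) * (scurl\<phi> \<bullet> B' - \<phi> * c)
      - 2 * \<delta>t * (s * \<eta> * c\<^sup>2) + 2 * \<delta>t * s * (c * vcross us B)"
    unfolding right_diff_distrib[of s] by linarith
  have "2 * ((us - ut') \<bullet> ut') = us \<bullet> us - ut' \<bullet> ut' - (us - ut') \<bullet> (us - ut')"
    by (simp add: inner_simps inner_commute)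
  moreover have "(us - ut') \<bullet> ut' = \<delta>t * (cv \<bullet> ut' - \<nu> * (lap \<bullet> ut') + gp \<bullet> ut')"
    unfolding e3 by (simp add: inner_simps)
  ultimately have C: "ut' \<bullet> ut' - us \<bullet> us \<le> - (2 * \<delta>t * (cv \<bullet> ut' - \<nu> * (lap \<bullet> ut') + gp \<bullet> ut'))"
    using inner_ge_zero[of "us - ut'"] by linarith
  \<comment> \<open>The products of the two pressure gradients with each other cancel. This exact
    identity is where the pressure part of the energy, with its factor \<delta>t^2, comes
    from.\<close>
  have D: "ut' \<bullet> ut' + 2 * \<delta>t * (gp \<bullet> ut')
      = u' \<bullet> u' + \<delta>t\<^sup>2 * (gp' \<bullet> gp') - \<delta>t\<^sup>2 * (gp \<bullet> gp) + 2 * \<delta>t * (gp' \<bullet> u')"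
    unfolding e4 by (simp add: inner_simps inner_commute algebra_simps power2_eq_square)
  have "s * (B' \<bullet> B') + u' \<bullet> u' + \<delta>t\<^sup>2 * (gp' \<bullet> gp') - (s * (B \<bullet> B) + u \<bullet> u + \<delta>t\<^sup>2 * (gp \<bullet> gp))
    \<le> - (2 * \<delta>t * s) * (scurl\<phi> \<bullet> B' - \<phi> * c) - 2 * \<delta>t * (s * \<eta> * c\<^sup>2)
      - 2 * \<delta>t * (cv \<bullet> ut') + 2 * \<delta>t * \<nu> * (lap \<bullet> ut') - 2 * \<delta>t * (gp' \<bullet> u')"
    using A B C D by (simp add: algebra_simps)
  then show ?thesis by (simp add: algebra_simps)
qed

theorem energy_inequality_step:
  fixes u B us B' ut' u' :: "real^2 \<Rightarrow> real^2" and p p' :: "real^2 \<Rightarrow> real"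
  assumes dom: "bounded_lipschitz_domain \<Omega>" and pos: "s > 0" "\<delta>t > 0" "\<nu> > 0"
    and u: "first_order_regular \<Omega> u" and B: "first_order_regular \<Omega> B" and p: "C1_closure \<Omega> p"
    and divu: "\<And>x. x \<in> \<Omega> \<Longrightarrow> divergence u x = 0"
    and mag: "magnetic_step \<Omega> \<eta> s \<delta>t u B us B'"
    and mom: "momentum_step \<Omega> \<nu> \<delta>t u p us ut'"
    and proj: "projection_step \<Omega> \<delta>t p ut' u' p'"
  shows "s * (L2norm \<Omega> B')\<^sup>2 + (L2norm \<Omega> u')\<^sup>2 + \<delta>t\<^sup>2 * (L2norm \<Omega> (grad p'))\<^sup>2
      + 2 * \<delta>t * (s * \<eta> * (L2norm \<Omega> (curl B'))\<^sup>2 + \<nu> * (L2norm \<Omega> (vgrad ut'))\<^sup>2)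
    \<le> s * (L2norm \<Omega> B)\<^sup>2 + (L2norm \<Omega> u)\<^sup>2 + \<delta>t\<^sup>2 * (L2norm \<Omega> (grad p))\<^sup>2"
proof -
  have \<Omega>: "open \<Omega>" "bounded \<Omega>" using dom by (auto simp: bounded_lipschitz_domain_def)
  have B'2: "second_order_regular \<Omega> B'" and us: "first_order_regular \<Omega> us"
    and tang: "zero_tangential_trace \<Omega> B'"
    and mag2: "\<And>x. x \<in> \<Omega> \<Longrightarrow> (1 / \<delta>t) *\<^sub>R (us x - u x) + s *\<^sub>R vcross_scalar (B x) (curl B' x) = 0"
    using mag by (auto simp: magnetic_step_def)
  have ut2: "second_order_regular \<Omega> ut'" and ut0: "\<And>x. x \<in> frontier \<Omega> \<Longrightarrow> ut' x = 0"
    and mom2: "\<And>x. x \<in> \<Omega> \<Longrightarrow> (1 / \<delta>t) *\<^sub>R (ut' x - us x) + conv u ut' x - \<nu> *\<^sub>R laplacian ut' x + grad p x = 0"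
    using mom by (auto simp: momentum_step_def)
  have u': "first_order_regular \<Omega> u'" and p': "C1_closure \<Omega> p'"
    and divu': "\<And>x. x \<in> \<Omega> \<Longrightarrow> divergence u' x = 0" and tru': "zero_normal_trace \<Omega> u'"
    and proj2: "\<And>x. x \<in> \<Omega> \<Longrightarrow> (1 / \<delta>t) *\<^sub>R (u' x - ut' x) + grad (\<lambda>y. p' y - p y) x = 0"
    using proj by (auto simp: projection_step_def)
  have B'c: "C1_closure \<Omega> B'" and utc: "C1_closure \<Omega> ut'"
    using B'2 ut2 by (auto simp: second_order_regular_def)
  note reg_u = first_order_regularD[OF u \<Omega>(2)] and reg_B = first_order_regularD[OF B \<Omega>(2)]
    and reg_us = first_order_regularD[OF us \<Omega>(2)] and reg_u' = first_order_regularD[OF u' \<Omega>(2)]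
    and reg_p = C1_closureD[OF p \<Omega>(2)] and reg_p' = C1_closureD[OF p' \<Omega>(2)]
    and reg_B' = C1_closureD[OF B'c \<Omega>(2)] and reg_ut = C1_closureD[OF utc \<Omega>(2)]
  have gp: "bcont \<Omega> (grad p)" and gp': "bcont \<Omega> (grad p')"
    by (intro bcont_grad reg_p(4) reg_p'(4))+
  have c: "bcont \<Omega> (curl B')" unfolding curl_def by (intro bcont_intros reg_B'(4))
  have cv: "bcont \<Omega> (conv u ut')"
    unfolding conv_def sum_2 by (intro bcont_intros reg_u(3) reg_ut(4))
  have n2: "bcont \<Omega> (\<lambda>x. (norm (vgrad ut' x))\<^sup>2)"
    unfolding norm_vgrad_square by (intro bcont_intros reg_ut(4))
  define \<phi> where "\<phi> = (\<lambda>x. \<eta> * curl B' x - vcross (us x) (B x))"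
  note pot = magnetic_potential[OF \<Omega> pos(2) B mag, folded \<phi>_def]
  have \<phi>: "bcont \<Omega> \<phi>"
    unfolding \<phi>_def by (intro bcont_intros c bcont_bilinear[OF vcross_bilinear] reg_us(3) reg_B(3))
  \<comment> \<open>The bound comes from the induction equation; the regularity of \<open>B'\<close>
    bounds no second derivatives.\<close>
  have sc: "bcont \<Omega> (scurl \<phi>)"
  proof -
    have "bcont \<Omega> (\<lambda>x. (1 / \<delta>t) *\<^sub>R (B x - B' x))" by (intro bcont_intros reg_B(3) reg_B'(3))
    then show ?thesis by (rule bcont_transform) (rule pot(2))
  qed
  \<comment> \<open>Likewise the momentum equation, divided by \<nu>, bounds the Laplacian though
    the single second derivatives may blow up at the boundary.\<close>
  have lap: "bcont \<Omega> (laplacian ut')"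
  proof (rule bcont_transform)
    show "bcont \<Omega> (\<lambda>x. (1 / \<nu>) *\<^sub>R ((1 / \<delta>t) *\<^sub>R (ut' x - us x) + conv u ut' x + grad p x))"
      by (intro bcont_intros reg_ut(3) reg_us(3) cv gp)
    fix x assume x: "x \<in> \<Omega>"
    have "\<nu> *\<^sub>R laplacian ut' x = (1 / \<delta>t) *\<^sub>R (ut' x - us x) + conv u ut' x + grad p x"
      using mom2[OF x] by (simp add: algebra_simps)
    from this[symmetric] show "laplacian ut' x = (1 / \<nu>) *\<^sub>R ((1 / \<delta>t) *\<^sub>R (ut' x - us x) + conv u ut' x + grad p x)"
      using pos(3) by simp
  qed
  obtain h where h: "\<And>i. continuous_on (closure \<Omega>) (h i)" "\<And>i x. x \<in> \<Omega> \<Longrightarrow> h i x = pd i B' x"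
    using B'c unfolding C1_closure_def by metis
  \<comment> \<open>On the frontier \<open>curl B'\<close> is uncontrolled. Replacing the
    derivatives by their continuous extensions gives a function that agrees with
    \<open>\<phi>\<close> in \<Omega> and is continuous on the closure.\<close>
  define \<phi>' where "\<phi>' = (\<lambda>x. \<eta> * (h 1 x $ 2 - h 2 x $ 1) - vcross (us x) (B x))"
  have \<phi>\<phi>': "\<phi> x = \<phi>' x" if "x \<in> \<Omega>" for x
    using h(2)[OF that] by (simp add: \<phi>_def \<phi>'_def curl_def)
  have C1\<phi>': "C1_on \<Omega> \<phi>'" by (rule C1_on_transform[OF pot(1) \<Omega>(1) \<phi>\<phi>'])
  have cont\<phi>': "continuous_on (closure \<Omega>) \<phi>'"
    unfolding \<phi>'_def
    by (intro continuous_intros h bounded_bilinear.continuous_on[OF vcross_bilinear] reg_us(2) reg_B(2))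
  have sc\<phi>': "scurl \<phi>' x = scurl \<phi> x" if "x \<in> \<Omega>" for x
    using pd_cong[OF \<Omega>(1) that \<phi>\<phi>'] by (simp add: vec_eq_iff forall_2)
  let ?N1 = "\<lambda>x. scurl \<phi>' x \<bullet> B' x - \<phi>' x * curl B' x"
  let ?N2 = "\<lambda>x. conv u ut' x \<bullet> ut' x"
  let ?N3 = "\<lambda>x. laplacian ut' x \<bullet> ut' x + (norm (vgrad ut' x))\<^sup>2"
  let ?N4 = "\<lambda>x. grad p' x \<bullet> u' x"
  have b1: "bcont \<Omega> ?N1"
  proof (rule bcont_transform)
    show "bcont \<Omega> (\<lambda>x. scurl \<phi> x \<bullet> B' x - \<phi> x * curl B' x)"
      by (intro bcont_intros sc reg_B'(3) \<phi> c)
  qed (simp add: sc\<phi>' \<phi>\<phi>')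
  have b2: "bcont \<Omega> ?N2" by (intro bcont_intros cv reg_ut(3))
  have b3: "bcont \<Omega> ?N3" by (intro bcont_intros lap reg_ut(3) n2)
  have b4: "bcont \<Omega> ?N4" by (intro bcont_intros gp' reg_u'(3))
  have I1: "(LINT x:\<Omega>|lborel. ?N1 x) = 0"
    by (rule curl_integral_by_parts[OF dom C1\<phi>' cont\<phi>' reg_B'(1,2) tang b1])
  have I2: "(LINT x:\<Omega>|lborel. ?N2 x) = 0"
    by (rule convection_integral_zero[OF dom reg_u(1,2) divu reg_ut(1,2) ut0 b2])
  have I3: "(LINT x:\<Omega>|lborel. ?N3 x) = 0"
    by (rule laplacian_integral_by_parts[OF dom ut2 ut0 b3])
  have I4: "(LINT x:\<Omega>|lborel. ?N4 x) = 0"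
    by (rule gradient_orthogonal_solenoidal[OF dom reg_p'(1,2) reg_u'(1,2) divu' tru' b4])
  have sq: "bcont \<Omega> (\<lambda>x. (norm (f x))\<^sup>2)" if "bcont \<Omega> f" for f :: "real^2 \<Rightarrow> real^2"
    unfolding power2_norm_eq_inner by (intro bcont_intros that)
  have c2: "bcont \<Omega> (\<lambda>x. (norm (curl B' x))\<^sup>2)"
    unfolding power2_norm_eq_inner by (intro bcont_intros c)
  let ?L = "\<lambda>x. s * (norm (B' x))\<^sup>2 + (norm (u' x))\<^sup>2 + \<delta>t\<^sup>2 * (norm (grad p' x))\<^sup>2
      + 2 * \<delta>t * (s * \<eta> * (norm (curl B' x))\<^sup>2 + \<nu> * (norm (vgrad ut' x))\<^sup>2)"
  let ?R = "\<lambda>x. s * (norm (B x))\<^sup>2 + (norm (u x))\<^sup>2 + \<delta>t\<^sup>2 * (norm (grad p x))\<^sup>2"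
  let ?K = "\<lambda>x. - (2 * \<delta>t * s) * ?N1 x - 2 * \<delta>t * ?N2 x + 2 * \<delta>t * \<nu> * ?N3 x - 2 * \<delta>t * ?N4 x"
  have bL: "bcont \<Omega> ?L"
    by (intro bcont_add bcont_mult bcont_const sq c2 n2 reg_B'(3) reg_u'(3) gp')
  have bR: "bcont \<Omega> ?R"
    by (intro bcont_add bcont_mult bcont_const sq reg_B(3) reg_u(3) gp)
  have bK: "bcont \<Omega> ?K"
    by (intro bcont_add bcont_diff[OF _ bcont_mult] bcont_mult[OF bcont_const] bcont_const b1 b2 b3 b4)
  note S = bcont_set_integral[OF \<Omega>] and bs = bcont_add bcont_diff bcont_mult bcont_const sq c2 n2
    reg_B(3) reg_u(3) gp reg_B'(3) reg_u'(3) gp' b1 b2 b3 b4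
  have pointwise: "?L x - ?R x \<le> ?K x" if x: "x \<in> \<Omega>" for x
  proof -
    have g: "grad (\<lambda>y. p' y - p y) x = grad p' x - grad p x"
      using pd_diff[OF C1_on_differentiable[OF reg_p'(1) x] C1_on_differentiable[OF reg_p(1) x]]
      by (simp add: vec_eq_iff)
    have \<phi>x: "\<phi>' x = \<eta> * curl B' x - vcross (us x) (B x)"
      unfolding \<phi>\<phi>'[OF x, symmetric] \<phi>_def ..
    have sx: "scurl \<phi>' x = (1 / \<delta>t) *\<^sub>R (B x - B' x)"
      unfolding sc\<phi>'[OF x] by (rule pot(2)[OF x])
    show ?thesis
      using energy_identity_pointwise[OF pos(2,1) \<phi>x sx mag2[OF x] mom2[OF x] proj2[OF x, unfolded g],
          of "(norm (vgrad ut' x))\<^sup>2"]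
      by (simp add: power2_norm_eq_inner[where 'a = "real^2"])
  qed
  have "(LINT x:\<Omega>|lborel. ?L x) - (LINT x:\<Omega>|lborel. ?R x) = (LINT x:\<Omega>|lborel. ?L x - ?R x)"
    by (rule S(2)[OF bL bR, symmetric])
  also have "\<dots> \<le> (LINT x:\<Omega>|lborel. ?K x)"
    by (rule set_integral_mono[OF bcont_integrable[OF \<Omega> bcont_diff[OF bL bR]] bcont_integrable[OF \<Omega> bK] pointwise])
  also have "\<dots> = 0"
    by (simp only: S bs set_integral_mult_right I1 I2 I3 I4)
  finally have "(LINT x:\<Omega>|lborel. ?L x) \<le> (LINT x:\<Omega>|lborel. ?R x)" by simp
  moreover have "(LINT x:\<Omega>|lborel. ?L x) = s * (L2norm \<Omega> B')\<^sup>2 + (L2norm \<Omega> u')\<^sup>2 + \<delta>t\<^sup>2 * (L2norm \<Omega> (grad p'))\<^sup>2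
      + 2 * \<delta>t * (s * \<eta> * (L2norm \<Omega> (curl B'))\<^sup>2 + \<nu> * (L2norm \<Omega> (vgrad ut'))\<^sup>2)"
    unfolding L2norm_square by (simp only: S bs set_integral_mult_right)
  moreover have "(LINT x:\<Omega>|lborel. ?R x) = s * (L2norm \<Omega> B)\<^sup>2 + (L2norm \<Omega> u)\<^sup>2 + \<delta>t\<^sup>2 * (L2norm \<Omega> (grad p))\<^sup>2"
    unfolding L2norm_square by (simp only: S bs set_integral_mult_right)
  ultimately show ?thesis by simp
qed

theorem theorem3p1:
  fixes \<Omega> :: "(real^2) set"
    and T \<nu> \<eta> s \<delta>t :: real
    and B us ut u :: "nat \<Rightarrow> real^2 \<Rightarrow> real^2"
    and p :: "nat \<Rightarrow> real^2 \<Rightarrow> real"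
  assumes "bounded_lipschitz_domain \<Omega>"
    and "T > 0" and "\<nu> > 0" and "\<eta> > 0" and "s > 0" and "\<delta>t > 0"
    and "generated_by_scheme \<Omega> T \<nu> \<eta> s \<delta>t B us ut u p"
  shows "(\<forall>n. int n \<le> last_index T \<delta>t \<longrightarrow>
            s * (L2norm \<Omega> (B (Suc n)))\<^sup>2 + (L2norm \<Omega> (u (Suc n)))\<^sup>2
              + \<delta>t\<^sup>2 * (L2norm \<Omega> (grad (p (Suc n))))\<^sup>2
              + 2 * \<delta>t * (s * \<eta> * (L2norm \<Omega> (curl (B (Suc n))))\<^sup>2
                           + \<nu> * (L2norm \<Omega> (vgrad (ut (Suc n))))\<^sup>2)
            \<le> s * (L2norm \<Omega> (B n))\<^sup>2 + (L2norm \<Omega> (u n))\<^sup>2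
              + \<delta>t\<^sup>2 * (L2norm \<Omega> (grad (p n)))\<^sup>2)
       \<and> (\<forall>n. 1 \<le> n \<and> int n \<le> last_index T \<delta>t \<longrightarrow>
            (\<forall>k\<le>Suc n. \<forall>x\<in>\<Omega>. divergence (B k) x = 0))"
proof -
  note dom = assms(1) and pos = assms(5,6,3)
  have \<Omega>: "open \<Omega>" "bounded \<Omega>" using dom by (auto simp: bounded_lipschitz_domain_def)
  have init: "admissible_initial_data \<Omega> (u 0) (B 0) (p 0)"
    and mag: "\<And>n. int n \<le> last_index T \<delta>t \<Longrightarrow> magnetic_step \<Omega> \<eta> s \<delta>t (u n) (B n) (us n) (B (Suc n))"
    and mom: "\<And>n. int n \<le> last_index T \<delta>t \<Longrightarrow> momentum_step \<Omega> \<nu> \<delta>t (u n) (p n) (us n) (ut (Suc n))"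
    and proj: "\<And>n. int n \<le> last_index T \<delta>t \<Longrightarrow> projection_step \<Omega> \<delta>t (p n) (ut (Suc n)) (u (Suc n)) (p (Suc n))"
    using assms(7) by (auto simp: generated_by_scheme_def)
  \<comment> \<open>The range reaches one level beyond the last step, since step N creates level N +
    1; if \<delta>t > T, then N = -1 and only the initial level remains. The invariant lists what
    the next step takes from the current level: regularity of \<open>u\<close>, \<open>B\<close>,
    \<open>p\<close> and both divergence constraints.\<close>
  have inv: "first_order_regular \<Omega> (u n) \<and> first_order_regular \<Omega> (B n) \<and> C1_closure \<Omega> (p n) \<and>
      (\<forall>x\<in>\<Omega>. divergence (u n) x = 0) \<and> (\<forall>x\<in>\<Omega>. divergence (B n) x = 0)"
    if "int n \<le> last_index T \<delta>t + 1" for n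
    using that
  proof (induction n)
    case 0
    show ?case using init by (simp add: admissible_initial_data_def)
  next
    case (Suc n)
    then have n: "int n \<le> last_index T \<delta>t" and IH: "first_order_regular \<Omega> (B n)" "\<forall>x\<in>\<Omega>. divergence (B n) x = 0"
      by auto
    have "\<forall>x\<in>\<Omega>. divergence (B (Suc n)) x = 0"
      using magnetic_step_divergence[OF \<Omega> pos(2) IH(1) mag[OF n]] IH(2) by simp
    moreover have "first_order_regular \<Omega> (B (Suc n))"
      using mag[OF n] by (simp add: magnetic_step_def second_order_imp_first_order)
    ultimately show ?case using proj[OF n] by (simp add: projection_step_def)
  qed
  show ?thesis
  proof (intro conjI allI impI ballI)
    fix n assume n: "int n \<le> last_index T \<delta>t"
    then have "int n \<le> last_index T \<delta>t + 1" by simp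
    from inv[OF this] have reg: "first_order_regular \<Omega> (u n)" "first_order_regular \<Omega> (B n)"
      "C1_closure \<Omega> (p n)" "\<And>x. x \<in> \<Omega> \<Longrightarrow> divergence (u n) x = 0" by auto
    show "s * (L2norm \<Omega> (B (Suc n)))\<^sup>2 + (L2norm \<Omega> (u (Suc n)))\<^sup>2
              + \<delta>t\<^sup>2 * (L2norm \<Omega> (grad (p (Suc n))))\<^sup>2
              + 2 * \<delta>t * (s * \<eta> * (L2norm \<Omega> (curl (B (Suc n))))\<^sup>2
                           + \<nu> * (L2norm \<Omega> (vgrad (ut (Suc n))))\<^sup>2)
            \<le> s * (L2norm \<Omega> (B n))\<^sup>2 + (L2norm \<Omega> (u n))\<^sup>2
              + \<delta>t\<^sup>2 * (L2norm \<Omega> (grad (p n)))\<^sup>2"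
      by (rule energy_inequality_step[OF dom pos reg mag[OF n] mom[OF n] proj[OF n]])
  next
    fix n k x
    assume "1 \<le> n \<and> int n \<le> last_index T \<delta>t" and "k \<le> Suc n" and "x \<in> \<Omega>"
    then show "divergence (B k) x = 0" using inv[of k] by simp
  qed
qed

end
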